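(* For any $\epsilon > 0$, there exists a dynamic algorithm for distance to monotonicity with approximation factor $1+\epsilon$ and worst-case update time $O(\log^2 n)$.
   Context: The distance to monotonicity $\mathsf{DTM}(a)$ of an array $a$ of distinct numbers is the minimum number of elements whose removal leaves a strictly increasing sequence. Dynamic setting: the array starts empty; operations arrive one at a time, each either "insert$(i,x)$" (insert $x$ at position $i$, $1\le i\le|a|+1$, shifting later elements right) or "delete$(i)$" (remove the $i$-th element, shifting later elements left). After each operation the algorithm reports a value $v$ with $\mathsf{DTM}(a)\le v\le (1+\epsilon)\mathsf{DTM}(a)$ for the current array. The worst-case update time is the maximum time to process one operation, in terms of the current array size $n$. The constant in $O(\cdot)$ may depend on $\epsilon$. *)

theory Defs
  imports Complex_Main "HOL-Library.Landau_Symbols"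
begin

section \<open>Distance to monotonicity and array updates\<close>

definition dtm :: "real list \<Rightarrow> nat" where
  "dtm a = (LEAST k. \<exists>D. D \<subseteq> {..<length a} \<and> card D = k
                         \<and> sorted_wrt (<) (nths a ({..<length a} - D)))"

text \<open>Positions are counted from 1.\<close>

datatype update = Insert nat real | Delete nat

fun legal :: "real list \<Rightarrow> update \<Rightarrow> bool" where
  "legal a (Insert i x) \<longleftrightarrow> 1 \<le> i \<and> i \<le> length a + 1 \<and> x \<notin> set a"
| "legal a (Delete i) \<longleftrightarrow> 1 \<le> i \<and> i \<le> length a"

fun apply_update :: "real list \<Rightarrow> update \<Rightarrow> real list" where
  "apply_update a (Insert i x) = take (i - 1) a @ x # drop (i - 1) a"
| "apply_update a (Delete i) = take (i - 1) a @ drop i a"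

fun legal_updates :: "real list \<Rightarrow> update list \<Rightarrow> bool" where
  "legal_updates a [] \<longleftrightarrow> True"
| "legal_updates a (u # us) \<longleftrightarrow> legal a u \<and> legal_updates (apply_update a u) us"

definition array_after :: "update list \<Rightarrow> real list" where
  "array_after us = foldl apply_update [] us"


section \<open>Machine model\<close>

text \<open>
  Algorithms are finite programs for a uniform-cost random access machine, written as mutually
  recursive first-order procedures over a mutable memory. A cell or local variable holds either
  an integer word or one array element. Words are added, subtracted, compared and used as
  addresses; elements are opaque, they are only copied and compared. Multiplication, division
  and bit operations are not primitive.
\<close>

datatype val = IntV int | NumV real

type_synonym memory = "int \<Rightarrow> val"

fun less_val :: "val \<Rightarrow> val \<Rightarrow> bool option" where
  "less_val (IntV x) (IntV y) = Some (x < y)"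
| "less_val (NumV x) (NumV y) = Some (x < y)"
| "less_val _ _ = None"

text \<open>
  Local variables are de Bruijn indices. \<open>Bind e1 e2\<close> evaluates \<open>e1\<close>, pushes its value on the
  local environment and evaluates \<open>e2\<close>; \<open>IfLess e1 e2 e3 e4\<close> branches on \<open>e1 < e2\<close>; \<open>Call f es\<close>
  runs the \<open>f\<close>-th procedure body of the program in the environment of the argument values.
\<close>

datatype expr =
    Var nat
  | Const int
  | Plus expr expr
  | Minus expr expr
  | IfLess expr expr expr expr
  | Bind expr expr
  | Load expr
  | Store expr expr
  | Call nat "expr list"

type_synonym program = "expr list"

text \<open>
  \<open>eval W P env s e v s' t\<close>: in program \<open>P\<close>, with local variables \<open>env\<close> and memory \<open>s\<close>, the
  expression \<open>e\<close> terminates with value \<open>v\<close> and memory \<open>s'\<close> after \<open>t\<close> steps. Every evaluated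
  syntax node costs one step, which is a constant number of machine instructions for a fixed
  program. \<open>W\<close> bounds the words: a computation that would produce an integer of absolute value
  above \<open>W\<close>, or address a cell outside \<open>{0..W}\<close>, is stuck, as is any ill-typed operation.
\<close>

inductive eval :: "int \<Rightarrow> program \<Rightarrow> val list \<Rightarrow> memory \<Rightarrow> expr \<Rightarrow> val \<Rightarrow> memory \<Rightarrow> nat \<Rightarrow> bool"
  and evals :: "int \<Rightarrow> program \<Rightarrow> val list \<Rightarrow> memory \<Rightarrow> expr list \<Rightarrow> val list \<Rightarrow> memory \<Rightarrow> nat \<Rightarrow> bool"
  for W :: int and P :: program where
  Var: "i < length env \<Longrightarrow> eval W P env s (Var i) (env ! i) s 1"
| Const: "\<bar>k\<bar> \<le> W \<Longrightarrow> eval W P env s (Const k) (IntV k) s 1"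
| Plus: "eval W P env s e1 (IntV x) s1 t1 \<Longrightarrow> eval W P env s1 e2 (IntV y) s2 t2 \<Longrightarrow> \<bar>x + y\<bar> \<le> W
    \<Longrightarrow> eval W P env s (Plus e1 e2) (IntV (x + y)) s2 (t1 + t2 + 1)"
| Minus: "eval W P env s e1 (IntV x) s1 t1 \<Longrightarrow> eval W P env s1 e2 (IntV y) s2 t2 \<Longrightarrow> \<bar>x - y\<bar> \<le> W
    \<Longrightarrow> eval W P env s (Minus e1 e2) (IntV (x - y)) s2 (t1 + t2 + 1)"
| IfLess: "eval W P env s e1 v1 s1 t1 \<Longrightarrow> eval W P env s1 e2 v2 s2 t2 \<Longrightarrow> less_val v1 v2 = Some b
    \<Longrightarrow> eval W P env s2 (if b then e3 else e4) v s3 t3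
    \<Longrightarrow> eval W P env s (IfLess e1 e2 e3 e4) v s3 (t1 + t2 + t3 + 1)"
| Bind: "eval W P env s e1 v1 s1 t1 \<Longrightarrow> eval W P (v1 # env) s1 e2 v s2 t2
    \<Longrightarrow> eval W P env s (Bind e1 e2) v s2 (t1 + t2 + 1)"
| Load: "eval W P env s e (IntV p) s1 t1 \<Longrightarrow> 0 \<le> p \<Longrightarrow> p \<le> W
    \<Longrightarrow> eval W P env s (Load e) (s1 p) s1 (t1 + 1)"
| Store: "eval W P env s e1 (IntV p) s1 t1 \<Longrightarrow> eval W P env s1 e2 v s2 t2 \<Longrightarrow> 0 \<le> p \<Longrightarrow> p \<le> W
    \<Longrightarrow> eval W P env s (Store e1 e2) v (s2(p := v)) (t1 + t2 + 1)"
| Call: "evals W P env s es vs s1 t1 \<Longrightarrow> f < length P \<Longrightarrow> eval W P vs s1 (P ! f) v s2 t2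
    \<Longrightarrow> eval W P env s (Call f es) v s2 (t1 + t2 + 1)"
| Nil: "evals W P env s [] [] s 0"
| Cons: "eval W P env s e v s1 t1 \<Longrightarrow> evals W P env s1 es vs s2 t2
    \<Longrightarrow> evals W P env s (e # es) (v # vs) s2 (t1 + t2)"

text \<open>The machine is deterministic, so \<open>eval\<close> describes the unique run of a program.\<close>

lemma eval_deterministic:
  "eval W P env s e v s' t \<Longrightarrow> eval W P env s e w r u \<Longrightarrow> w = v \<and> r = s' \<and> u = t"
  "evals W P env s es vs s' t \<Longrightarrow> evals W P env s es ws r u \<Longrightarrow> ws = vs \<and> r = s' \<and> u = t"
proof (induction arbitrary: w r u and ws r u rule: eval_evals.inducts)
  case (Var i env s)
  from Var.prems show ?case by cases auto
next
  case (Const k env s)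
  from Const.prems show ?case by cases auto
next
  case (Plus env s e1 x s1 t1 e2 y s2 t2)
  from Plus.prems show ?case by cases (metis Plus.IH val.inject(1))
next
  case (Minus env s e1 x s1 t1 e2 y s2 t2)
  from Minus.prems show ?case by cases (metis Minus.IH val.inject(1))
next
  case (IfLess env s e1 v1 s1 t1 e2 v2 s2 t2 b e3 e4 v s3 t3)
  from IfLess.prems show ?case by cases (metis IfLess.IH IfLess.hyps option.inject)
next
  case (Bind env s e1 v1 s1 t1 e2 v s2 t2)
  from Bind.prems show ?case by cases (metis Bind.IH)
next
  case (Load env s e p s1 t1)
  from Load.prems show ?case by cases (metis Load.IH val.inject(1))
next
  case (Store env s e1 p s1 t1 e2 v s2 t2)
  from Store.prems show ?case by cases (metis Store.IH val.inject(1))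
next
  case (Call env s es vs s1 t1 f v s2 t2)
  from Call.prems show ?case by cases (metis Call.IH)
next
  case (Nil env s)
  from Nil.prems show ?case by cases auto
next
  case (Cons env s e v s1 t1 es vs s2 t2)
  from Cons.prems show ?case by cases (metis Cons.IH)
qed


section \<open>Dynamic algorithms\<close>

text \<open>
  Procedure 0 handles insertions and procedure 1 handles deletions; the reported value is the
  integer returned. Only the memory persists between updates. \<open>run W P s us rs\<close> says that,
  started in memory \<open>s\<close>, the program processes the updates \<open>us\<close> one after another, where \<open>rs\<close>
  lists for each update the reported value and the number of steps spent on it.
\<close>

fun invoke :: "update \<Rightarrow> nat \<times> val list" where
  "invoke (Insert i x) = (0, [IntV (int i), NumV x])"
| "invoke (Delete i) = (1, [IntV (int i)])"

inductive run :: "int \<Rightarrow> program \<Rightarrow> memory \<Rightarrow> update list \<Rightarrow> (int \<times> nat) list \<Rightarrow> bool"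
  for W :: int and P :: program where
  Done: "run W P s [] []"
| Step: "invoke u = (f, args) \<Longrightarrow> f < length P \<Longrightarrow> eval W P args s (P ! f) (IntV v) s' t
    \<Longrightarrow> run W P s' us rs \<Longrightarrow> run W P s (u # us) ((v, t) # rs)"

definition initial_memory :: memory where
  "initial_memory = (\<lambda>_. IntV 0)"

text \<open>
  Approximation factor \<open>\<alpha>\<close> and worst-case update time \<open>T\<close>, a function of the size of the current
  array. The program must work on every machine whose words hold all integers up to \<open>(m + 2) ^ c\<close>
  in absolute value, \<open>m\<close> being the number of updates: words of \<open>O(log m)\<close> bits, with \<open>P\<close>, \<open>c\<close>
  and \<open>T\<close> independent of \<open>m\<close> and of the updates.
\<close>

definition dynamic_dtm_algorithm :: "program \<Rightarrow> nat \<Rightarrow> real \<Rightarrow> (nat \<Rightarrow> real) \<Rightarrow> bool" where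
  "dynamic_dtm_algorithm P c \<alpha> T \<longleftrightarrow>
     (\<forall>us W. legal_updates [] us \<longrightarrow> (int (length us) + 2) ^ c \<le> W \<longrightarrow>
       (\<exists>rs. run W P initial_memory us rs \<and>
         (\<forall>j < length us.
            let a = array_after (take (Suc j) us); (v, t) = rs ! j in
              real (dtm a) \<le> real_of_int v \<and> real_of_int v \<le> \<alpha> * real (dtm a) \<and>
              real t \<le> T (length a))))"

end

theory Submission
  imports Defs "HOL-Library.Tree" "HOL-Library.Sublist"
begin

text \<open>
  Two elements of the array that form an inversion cannot both be kept, so the distance to
  monotonicity is at least the number of disjoint inverted pairs. The algorithm maintains a
  splitting of the array into an increasing subsequence \<open>U\<close> and a set \<open>S\<close> of size
  \<open>O(dtm)\<close>: an element that conflicts with a neighbour in \<open>U\<close> is put into \<open>S\<close> together with this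
  neighbour. Deletions may break pairs; therefore \<open>S\<close> is swept in rounds, in which each of its
  elements is taken out and placed anew.

  At the start of a round a snapshot is taken, and patience sorting is run on it. A run of elements
  of \<open>U\<close> that are larger than all current tails costs nothing, so \<open>O(|S|)\<close> steps of
  logarithmic cost compute the exact distance of the snapshot. Each update performs a constant
  number \<open>N\<close> of steps of the sweep and of the sorting. Hence a round lasts \<open>O(dtm / N)\<close>
  updates, during which the distance changes by at most a fraction \<open>\<epsilon>\<close>; a round that fits into
  a single update reports the exact value. As all data structures are persistent trees, a snapshot
  is just a pointer, and it suffices to verify a functional program and a compiler for it.
\<close>

section \<open>A language of immutable records\<close>

text \<open>The accounting rests on \<open>excess\<close>, the number of elements with one mark
  minus twice their distance: an inverted pair adds two elements and at least one to the distance,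
  and a deletion raises the value by at most one. Marks 1 and 2 swap roles from round to round, so
  that the pairs formed in a round are told apart from the elements still to be swept. For the
  number K of swept elements and the distance D of the snapshot this gives K \<le> 3 D + 1, and
  sweep and sorting each take at most 2 K + 1 steps. A published distance stays in use until the
  next round ends, so it is up to two rounds old. The report is this distance plus its age: it never
  falls below the true value and exceeds it by at most twice the age, which is at most 60 / (N - 6)
  times the current distance. This dictates N. For fixed \<epsilon> the time is in fact O(log n).
  Memory is never reclaimed; the words only have to address every cell ever allocated, and for this
  reason the exponent of the word bound depends on \<epsilon>.\<close>

datatype rval = RI int | RN real | RC "rval list"

datatype rexpr =
    V nat
  | K int
  | Add rexpr rexpr
  | Sub rexpr rexpr
  | Less rexpr rexpr rexpr rexpr
  | Let rexpr rexpr
  | IfNil rexpr rexpr rexpr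
  | Fld nat rexpr
  | FldZ nat rexpr
  | Rec "rexpr list"
  | App nat "rexpr list"

fun less_rval :: "rval \<Rightarrow> rval \<Rightarrow> bool option" where
  "less_rval (RI x) (RI y) = Some (x < y)"
| "less_rval (RN x) (RN y) = Some (x < y)"
| "less_rval _ _ = None"

text \<open>Serves to read a cached size, height or count of a tree that may be empty: the number 0,
  which encodes \<open>Leaf\<close>, has the value 0 in every field.\<close>

fun field_or_zero :: "nat \<Rightarrow> rval \<Rightarrow> rval option" where
  "field_or_zero i (RI x) = (if x = 0 then Some (RI 0) else None)"
| "field_or_zero i (RC vs) = (if i < length vs then Some (vs ! i) else None)"
| "field_or_zero i (RN x) = None"

text \<open>At most 99 steps for the body of \<open>alloc\<close> and one for its call; this also
  exceeds the nine cells claimed.\<close>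

definition max_alloc_cost :: nat where "max_alloc_cost = 100"

text \<open>The step counts are upper bounds for the steps of the compiled code, and at the same time
  for the number of memory cells that it allocates.\<close>

inductive reval :: "int \<Rightarrow> rexpr list \<Rightarrow> rval list \<Rightarrow> rexpr \<Rightarrow> rval \<Rightarrow> nat \<Rightarrow> bool"
  and revals :: "int \<Rightarrow> rexpr list \<Rightarrow> rval list \<Rightarrow> rexpr list \<Rightarrow> rval list \<Rightarrow> nat \<Rightarrow> bool"
  for B :: int and R :: "rexpr list" where
  V: "i < length env \<Longrightarrow> reval B R env (V i) (env ! i) 1"
| K: "\<bar>k\<bar> \<le> B \<Longrightarrow> reval B R env (K k) (RI k) 1"
| Add: "reval B R env e1 (RI x) t1 \<Longrightarrow> reval B R env e2 (RI y) t2 \<Longrightarrow> \<bar>x + y\<bar> \<le> B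
    \<Longrightarrow> reval B R env (Add e1 e2) (RI (x + y)) (t1 + t2 + 1)"
| Sub: "reval B R env e1 (RI x) t1 \<Longrightarrow> reval B R env e2 (RI y) t2 \<Longrightarrow> \<bar>x - y\<bar> \<le> B
    \<Longrightarrow> reval B R env (Sub e1 e2) (RI (x - y)) (t1 + t2 + 1)"
| Less: "reval B R env e1 v1 t1 \<Longrightarrow> reval B R env e2 v2 t2 \<Longrightarrow> less_rval v1 v2 = Some b
    \<Longrightarrow> reval B R env (if b then e3 else e4) v t3
    \<Longrightarrow> reval B R env (Less e1 e2 e3 e4) v (t1 + t2 + t3 + 1)"
| Let: "reval B R env e1 v1 t1 \<Longrightarrow> reval B R (v1 # env) e2 v t2
    \<Longrightarrow> reval B R env (Let e1 e2) v (t1 + t2 + 1)"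
| IfNil0: "reval B R env e (RI 0) t1 \<Longrightarrow> reval B R env e1 v t2
    \<Longrightarrow> reval B R env (IfNil e e1 e2) v (t1 + t2 + 2)"
| IfNil1: "reval B R env e (RC vs) t1 \<Longrightarrow> reval B R env e2 v t2
    \<Longrightarrow> reval B R env (IfNil e e1 e2) v (t1 + t2 + 2)"
| Fld: "reval B R env e (RC vs) t1 \<Longrightarrow> i < length vs
    \<Longrightarrow> reval B R env (Fld i e) (vs ! i) (t1 + 3)"
| FldZ: "reval B R env e v t1 \<Longrightarrow> field_or_zero i v = Some w
    \<Longrightarrow> reval B R env (FldZ i e) w (t1 + 8)"
| Rec: "revals B R env es vs t1 \<Longrightarrow> length vs = 9
    \<Longrightarrow> reval B R env (Rec es) (RC vs) (t1 + max_alloc_cost)"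
| App: "revals B R env es vs t1 \<Longrightarrow> f < length R \<Longrightarrow> reval B R vs (R ! f) v t2
    \<Longrightarrow> reval B R env (App f es) v (t1 + t2 + 1)"
| Nil: "revals B R env [] [] 0"
| Cons: "reval B R env e v t1 \<Longrightarrow> revals B R env es vs t2
    \<Longrightarrow> revals B R env (e # es) (v # vs) (t1 + t2)"

section \<open>Compilation to the machine\<close>

text \<open>Cell 0 counts the allocated cells and cell 1 holds the state of the algorithm; records
  occupy nine consecutive cells from address 2 on. The address 0 stands for the empty record.\<close>

definition alloc :: expr where
  "alloc = Bind (Load (Const 0)) (Bind (Store (Const 0) (Plus (Var 0) (Const 9)))
     (foldr (\<lambda>i e. Bind (Store (Plus (Var (1 + i)) (Const (2 + int i))) (Var (2 + i + i))) e)
       [0..<9] (Plus (Var 10) (Const 2))))"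

text \<open>Records have positive addresses, so a comparison with 0 separates them from the empty
  record. Slots 0 and 1 of the program are the entry points and slot 2 is \<open>alloc\<close>,
  hence the shift by 3 in \<open>App\<close>.\<close>

fun compile :: "rexpr \<Rightarrow> expr" where
  "compile (V i) = Var i"
| "compile (K k) = Const k"
| "compile (Add e1 e2) = Plus (compile e1) (compile e2)"
| "compile (Sub e1 e2) = Minus (compile e1) (compile e2)"
| "compile (Less e1 e2 e3 e4) = IfLess (compile e1) (compile e2) (compile e3) (compile e4)"
| "compile (Let e1 e2) = Bind (compile e1) (compile e2)"
| "compile (IfNil e e1 e2) = IfLess (Const 0) (compile e) (compile e2) (compile e1)"
| "compile (Fld i e) = Load (Plus (compile e) (Const (int i)))"
| "compile (FldZ i e) = Bind (compile e)
     (IfLess (Const 0) (Var 0) (Load (Plus (Var 0) (Const (int i)))) (Const 0))"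
| "compile (Rec es) = Call 2 (map compile es)"
| "compile (App f es) = Call (f + 3) (map compile es)"

definition link :: "expr \<Rightarrow> expr \<Rightarrow> rexpr list \<Rightarrow> program" where
  "link e0 e1 R = e0 # e1 # alloc # map compile R"

text \<open>A record and all records below it must lie under the allocation frontier h + 2. Cells
  there are never rewritten by compiled code, which makes the relation stable under further
  allocation.\<close>

inductive rep :: "memory \<Rightarrow> val \<Rightarrow> rval \<Rightarrow> bool" for s where
  RI: "rep s (IntV k) (RI k)"
| RN: "rep s (NumV x) (RN x)"
| RC: "s 0 = IntV h \<Longrightarrow> 2 \<le> p \<Longrightarrow> p + int (length vs) \<le> h + 2
    \<Longrightarrow> (\<And>i. i < length vs \<Longrightarrow> rep s (s (p + int i)) (vs ! i)) \<Longrightarrow> rep s (IntV p) (RC vs)"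

inductive_cases rep_RIE: "rep s v (RI k)"
inductive_cases rep_RNE: "rep s v (RN x)"
inductive_cases rep_RCE: "rep s v (RC vs)"

text \<open>Cell 0 is exempt as the allocation counter; the root in cell 1 counts as preserved,
  because compiled procedures do not touch it.\<close>

definition grows :: "nat \<Rightarrow> memory \<Rightarrow> memory \<Rightarrow> bool" where
  "grows n s s' \<longleftrightarrow> (\<exists>h h'. s 0 = IntV h \<and> s' 0 = IntV h' \<and> 0 \<le> h \<and> h \<le> h' \<and> h' \<le> h + int n \<and>
     (\<forall>a. a \<noteq> 0 \<longrightarrow> a < h + 2 \<longrightarrow> s' a = s a))"

lemma rep_grows: "rep s v r \<Longrightarrow> grows n s s' \<Longrightarrow> rep s' v r"
proof (induction rule: rep.induct)
  case (RC h p vs)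
  then obtain h' where h': "s' 0 = IntV h'" "h \<le> h'" "\<forall>a. a \<noteq> 0 \<longrightarrow> a < h + 2 \<longrightarrow> s' a = s a"
    by (auto simp: grows_def)
  show ?case
  proof (rule rep.RC[where h = h'])
    fix i assume i: "i < length vs"
    then have "s' (p + int i) = s (p + int i)"
      using h'(3) RC.hyps by auto
    then show "rep s' (s' (p + int i)) (vs ! i)"
      using RC.IH[OF i RC.prems] by simp
  next
    show "p + int (length vs) \<le> h' + 2" using RC.hyps h'(2) by linarith
  qed (fact h' RC.hyps)+
qed (auto intro: rep.intros)

lemma grows_trans: "grows n s s' \<Longrightarrow> grows m s' s'' \<Longrightarrow> grows (n + m) s s''"
  unfolding grows_def by fastforce

lemma grows_mono: "grows n s s' \<Longrightarrow> n \<le> m \<Longrightarrow> grows m s s'"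
  unfolding grows_def by fastforce

text \<open>An allocation with counter h writes up to cell h + 10 and uses constants up to 10, so 12
  words beyond h suffice; n is the further growth that is allowed.\<close>

definition room :: "int \<Rightarrow> memory \<Rightarrow> nat \<Rightarrow> bool" where
  "room W s n \<longleftrightarrow> (\<exists>h. s 0 = IntV h \<and> 0 \<le> h \<and> h + 12 + int n \<le> W)"

lemma room_grows: "room W s (n + m) \<Longrightarrow> grows n s s' \<Longrightarrow> room W s' m"
  unfolding room_def grows_def by auto

lemma room_less: "room W s n \<Longrightarrow> m \<le> n \<Longrightarrow> room W s m"
  unfolding room_def by auto

lemma room_refl: "room W s n \<Longrightarrow> grows 0 s s"
  unfolding room_def grows_def by auto

lemma eval_alloc:
  assumes "length vs = 9" "s 0 = IntV h" "0 \<le> h" "h + 11 \<le> W"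
  defines "s' \<equiv> (\<lambda>a. if a = 0 then IntV (h + 9) else if h + 2 \<le> a \<and> a < h + 11 then vs ! nat (a - h - 2) else s a)"
  shows "\<exists>t \<le> 99. eval W P vs s alloc (IntV (h + 2)) s' t"
proof -
  obtain v0 v1 v2 v3 v4 v5 v6 v7 v8 where vs: "vs = [v0,v1,v2,v3,v4,v5,v6,v7,v8]"
    using assms(1) by (auto simp: numeral_eq_Suc length_Suc_conv)
  define u where "u = s(0 := IntV (h+9), h+2 := v0, h+3 := v1, h+4 := v2, h+5 := v3, h+6 := v4,
    h+7 := v5, h+8 := v6, h+9 := v7, h+10 := v8)"
  have upt: "[0..<9] = [0,1,2,3,4,5,6,7,8::nat]" by (simp add: upt_rec)
  have pl: "eval W P env s (Plus (Var i) (Const k)) (IntV (h + k)) s 3"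
    if "i < length env" "env ! i = IntV h" "0 \<le> k" "k \<le> 10" for env i s k
  proof -
    have "eval W P env s (Var i) (IntV h) s 1" using eval_evals.Var[of i env] that by metis
    from eval_evals.Plus[OF this eval_evals.Const[of k]] show ?thesis using that assms(3,4) by (simp add: numeral_3_eq_3)
  qed
  have st: "eval W P env s (Bind (Store (Plus (Var i) (Const k)) (Var j)) e) w s' (t + 6)" 
    if e: "eval W P (v # env) (s(h + k := v)) e w s' t" and i: "i < length env" "env ! i = IntV h"
      and k: "0 \<le> k" "k \<le> 10" and j: "j < length env" "env ! j = v" for env i s k v j e w s' t
  proof -
    have "eval W P env s (Store (Plus (Var i) (Const k)) (Var j)) v (s(h + k := v)) (3 + 1 + 1)"
      using eval_evals.Store[OF pl[OF i k] eval_evals.Var[OF j(1)]] j k assms(3,4) by simp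
    from eval_evals.Bind[OF this e] show ?thesis by (simp add: add.commute)
  qed
  \<comment> \<open>The remaining time is written as \<open>t - 6\<close>, so that the rule works
    backwards from a known total: nine stores of 6 steps each and 3 steps for the result make
    57.\<close>
  have st': "eval W P env s (Bind (Store (Plus (Var i) (Const k)) (Var j)) e) w s' t"
    if "eval W P (v # env) (s(h + k := v)) e w s' (t - 6)" "6 \<le> t" "i < length env" "env ! i = IntV h"
      "0 \<le> k" "k \<le> 10" "j < length env" "env ! j = v" for env i s k v j e w s' t
    using st[OF that(1,3-)] that(2) by simp
  have "eval W P vs s alloc (IntV (h + 2)) u (2 + (3 + 1 + 1 + 57 + 1) + 1)"
    unfolding alloc_def
  proof (rule eval_evals.Bind)
    show "eval W P vs s (Load (Const 0)) (IntV h) s 2"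
      using eval_evals.Load[OF eval_evals.Const[of 0 W P vs s]] assms(2-4) by (simp add: numeral_2_eq_2)
  next
    let ?e1 = "IntV h # vs"
    have "eval W P ?e1 s (Store (Const 0) (Plus (Var 0) (Const 9))) (IntV (h + 9))
       (s(0 := IntV (h + 9))) (1 + 3 + 1)"
      by (rule eval_evals.Store[OF eval_evals.Const pl]) (use assms(3,4) in auto)
    moreover have "eval W P (IntV (h + 9) # ?e1) (s(0 := IntV (h + 9)))
       (foldr (\<lambda>i e. Bind (Store (Plus (Var (1 + i)) (Const (2 + int i))) (Var (2 + i + i))) e)
       [0..<9] (Plus (Var 10) (Const 2))) (IntV (h + 2)) u 57"
      unfolding upt foldr.simps o_def id_def
      apply (rule st'[where v = v0], rule st'[where v = v1], rule st'[where v = v2],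
        rule st'[where v = v3], rule st'[where v = v4], rule st'[where v = v5],
        rule st'[where v = v6], rule st'[where v = v7], rule st'[where v = v8])
      subgoal using pl[of 10 "[v8,v7,v6,v5,v4,v3,v2,v1,v0,IntV (h+9), IntV h] @ vs" 2 u]
        by (simp add: vs u_def fun_upd_def)
      by (simp_all add: vs)
    ultimately show "eval W P ?e1 s (Bind (Store (Const 0) (Plus (Var 0) (Const 9)))
     (foldr (\<lambda>i e. Bind (Store (Plus (Var (1 + i)) (Const (2 + int i))) (Var (2 + i + i))) e)
       [0..<9] (Plus (Var 10) (Const 2)))) (IntV (h + 2)) u (3 + 1 + 1 + 57 + 1)"
      using eval_evals.Bind[of W P ?e1 s _ "IntV (h + 9)" "s(0 := IntV (h + 9))" "1 + 3 + 1"] by fastforce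
  qed
  moreover have "u = s'"
  proof
    fix a
    have "a = 0 \<or> a = h + 2 \<or> a = h + 3 \<or> a = h + 4 \<or> a = h + 5 \<or> a = h + 6 \<or> a = h + 7
      \<or> a = h + 8 \<or> a = h + 9 \<or> a = h + 10 \<or> (a < h + 2 \<and> a \<noteq> 0) \<or> (h + 11 \<le> a \<and> a \<noteq> 0)"
      by presburger
    then show "u a = s' a"
      using assms(3) by (elim disjE) (simp_all add: u_def s'_def vs nat_diff_distrib)
  qed
  ultimately show ?thesis by (intro exI[of _ 66]) simp
qed

lemma env_grows: "list_all2 (rep s) cenv env \<Longrightarrow> grows n s s' \<Longrightarrow> list_all2 (rep s') cenv env"
  by (erule list_all2_mono) (auto intro: rep_grows)

text \<open>The slack \<open>n\<close> is the room needed by the rest of the computation.\<close>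

definition simulates :: "int \<Rightarrow> program \<Rightarrow> rval list \<Rightarrow> rexpr \<Rightarrow> rval \<Rightarrow> nat \<Rightarrow> bool" where
  "simulates W P env e v t \<longleftrightarrow> (\<forall>cenv s n. list_all2 (rep s) cenv env \<longrightarrow> room W s (t + n) \<longrightarrow>
     (\<exists>cv s' t'. eval W P cenv s (compile e) cv s' t' \<and> t' \<le> t \<and> rep s' cv v \<and> grows t s s'))"

definition simulates_list :: "int \<Rightarrow> program \<Rightarrow> rval list \<Rightarrow> rexpr list \<Rightarrow> rval list \<Rightarrow> nat \<Rightarrow> bool" where
  "simulates_list W P env es vs t \<longleftrightarrow> (\<forall>cenv s n. list_all2 (rep s) cenv env \<longrightarrow> room W s (t + n) \<longrightarrow>
     (\<exists>cvs s' t'. evals W P cenv s (map compile es) cvs s' t' \<and> t' \<le> t \<and>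
        list_all2 (rep s') cvs vs \<and> grows t s s'))"

lemma simulatesE:
  assumes "simulates W P env e v t" "list_all2 (rep s) cenv env" "room W s m" "t \<le> m"
  obtains cv s' t' where "eval W P cenv s (compile e) cv s' t'" "t' \<le> t" "rep s' cv v" "grows t s s'"
    "room W s' (m - t)" "list_all2 (rep s') cenv env"
proof -
  have "room W s (t + (m - t))" using assms(3,4) by simp
  with assms(1,2) obtain cv s' t' where *: "eval W P cenv s (compile e) cv s' t'" "t' \<le> t" "rep s' cv v"
    "grows t s s'" unfolding simulates_def by blast
  show thesis
    using that[OF *] room_grows[OF \<open>room W s (t + (m - t))\<close> *(4)] env_grows[OF assms(2) *(4)] by blast
qed

lemma simulates_listE:
  assumes "simulates_list W P env es vs t" "list_all2 (rep s) cenv env" "room W s m" "t \<le> m"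
  obtains cvs s' t' where "evals W P cenv s (map compile es) cvs s' t'" "t' \<le> t" "list_all2 (rep s') cvs vs"
    "grows t s s'" "room W s' (m - t)" "list_all2 (rep s') cenv env"
proof -
  have "room W s (t + (m - t))" using assms(3,4) by simp
  with assms(1,2) obtain cvs s' t' where *: "evals W P cenv s (map compile es) cvs s' t'" "t' \<le> t"
    "list_all2 (rep s') cvs vs" "grows t s s'" unfolding simulates_list_def by blast
  show thesis
    using that[OF *] room_grows[OF \<open>room W s (t + (m - t))\<close> *(4)] env_grows[OF assms(2) *(4)] by blast
qed

lemma simulatesI:
  assumes "\<And>cenv s. list_all2 (rep s) cenv env \<Longrightarrow> room W s t \<Longrightarrow>
    \<exists>cv s' t'. eval W P cenv s (compile e) cv s' t' \<and> t' \<le> t \<and> rep s' cv v \<and> grows t s s'"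
  shows "simulates W P env e v t"
  unfolding simulates_def using assms room_less by (metis le_add1)

text \<open>Induction on the source evaluation. A value computed earlier stays represented while
  later subexpressions allocate, as memory only grows above the frontier. The step count bounds the
  growth as well, so one assumption on the room pays for both.\<close>

lemma compile_correct:
  fixes e0 e1 R
  assumes BW: "B \<le> W"
  defines "P \<equiv> link e0 e1 R"
  shows "reval B R env e v t \<Longrightarrow> simulates W P env e v t"
    and "revals B R env es vs t \<Longrightarrow> simulates_list W P env es vs t"
proof (induction rule: reval_revals.inducts)
  case (V i env)
  show ?case
  proof (rule simulatesI)
    fix cenv s assume a: "list_all2 (rep s) cenv env" "room W s 1"
    then have "eval W P cenv s (compile (V i)) (cenv ! i) s 1" "rep s (cenv ! i) (env ! i)"
      using V eval_evals.Var[of i cenv W P s] by (auto dest: list_all2_lengthD list_all2_nthD2)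
    then show "\<exists>cv s' t'. eval W P cenv s (compile (V i)) cv s' t' \<and> t' \<le> 1 \<and> rep s' cv (env ! i) \<and> grows 1 s s'"
      using grows_mono[OF room_refl[OF a(2)]] by fastforce
  qed
next
  case (K k env)
  show ?case
  proof (rule simulatesI)
    fix cenv s assume a: "list_all2 (rep s) cenv env" "room W s 1"
    have "eval W P cenv s (compile (K k)) (IntV k) s 1"
      using K BW eval_evals.Const[of k W P cenv s] by simp
    then show "\<exists>cv s' t'. eval W P cenv s (compile (K k)) cv s' t' \<and> t' \<le> 1 \<and> rep s' cv (RI k) \<and> grows 1 s s'"
      using grows_mono[OF room_refl[OF a(2)]] rep.RI by fastforce
  qed
next
  case (Add env e1 x t1 e2 y t2)
  show ?case
  proof (rule simulatesI)
    fix cenv s assume a: "list_all2 (rep s) cenv env" "room W s (t1 + t2 + 1)"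
    obtain cv1 s1 u1 where 1: "eval W P cenv s (compile e1) cv1 s1 u1" "u1 \<le> t1" "rep s1 cv1 (RI x)"
      "grows t1 s s1" "room W s1 (t1 + t2 + 1 - t1)" "list_all2 (rep s1) cenv env"
      by (rule simulatesE[OF Add.IH(2) a]) simp
    obtain cv2 s2 u2 where 2: "eval W P cenv s1 (compile e2) cv2 s2 u2" "u2 \<le> t2" "rep s2 cv2 (RI y)"
      "grows t2 s1 s2"
      by (rule simulatesE[OF Add.IH(4) 1(6,5)]) simp
    have "eval W P cenv s (compile (Add e1 e2)) (IntV (x + y)) s2 (u1 + u2 + 1)"
      using 1(1,3) 2(1,3) Add BW eval_evals.Plus[of W P cenv s _ x s1 u1 _ y s2 u2] by (auto elim!: rep_RIE)
    then show "\<exists>cv s' t'. eval W P cenv s (compile (Add e1 e2)) cv s' t' \<and> t' \<le> t1 + t2 + 1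
       \<and> rep s' cv (RI (x + y)) \<and> grows (t1 + t2 + 1) s s'"
      using grows_mono[OF grows_trans[OF 1(4) 2(4)], of "t1 + t2 + 1"] rep.RI 1(2) 2(2) by fastforce
  qed
next
  case (Sub env e1 x t1 e2 y t2)
  show ?case
  proof (rule simulatesI)
    fix cenv s assume a: "list_all2 (rep s) cenv env" "room W s (t1 + t2 + 1)"
    obtain cv1 s1 u1 where 1: "eval W P cenv s (compile e1) cv1 s1 u1" "u1 \<le> t1" "rep s1 cv1 (RI x)"
      "grows t1 s s1" "room W s1 (t1 + t2 + 1 - t1)" "list_all2 (rep s1) cenv env"
      by (rule simulatesE[OF Sub.IH(2) a]) simp
    obtain cv2 s2 u2 where 2: "eval W P cenv s1 (compile e2) cv2 s2 u2" "u2 \<le> t2" "rep s2 cv2 (RI y)"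
      "grows t2 s1 s2"
      by (rule simulatesE[OF Sub.IH(4) 1(6,5)]) simp
    have "eval W P cenv s (compile (Sub e1 e2)) (IntV (x - y)) s2 (u1 + u2 + 1)"
      using 1(1,3) 2(1,3) Sub BW eval_evals.Minus[of W P cenv s _ x s1 u1 _ y s2 u2] by (auto elim!: rep_RIE)
    then show "\<exists>cv s' t'. eval W P cenv s (compile (Sub e1 e2)) cv s' t' \<and> t' \<le> t1 + t2 + 1
       \<and> rep s' cv (RI (x - y)) \<and> grows (t1 + t2 + 1) s s'"
      using grows_mono[OF grows_trans[OF 1(4) 2(4)], of "t1 + t2 + 1"] rep.RI 1(2) 2(2) by fastforce
  qed
next
  case (Less env e1 v1 t1 e2 v2 t2 b e3 e4 v t3)
  show ?case
  proof (rule simulatesI)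
    fix cenv s assume a: "list_all2 (rep s) cenv env" "room W s (t1 + t2 + t3 + 1)"
    obtain cv1 s1 u1 where 1: "eval W P cenv s (compile e1) cv1 s1 u1" "u1 \<le> t1" "rep s1 cv1 v1"
      "grows t1 s s1" "room W s1 (t1 + t2 + t3 + 1 - t1)" "list_all2 (rep s1) cenv env"
      by (rule simulatesE[OF Less.IH(2) a]) simp
    obtain cv2 s2 u2 where 2: "eval W P cenv s1 (compile e2) cv2 s2 u2" "u2 \<le> t2" "rep s2 cv2 v2"
      "grows t2 s1 s2" "room W s2 (t1 + t2 + t3 + 1 - t1 - t2)" "list_all2 (rep s2) cenv env"
      by (rule simulatesE[OF Less.IH(4) 1(6,5)]) simp
    obtain cv3 s3 u3 where 3: "eval W P cenv s2 (compile (if b then e3 else e4)) cv3 s3 u3" "u3 \<le> t3"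
      "rep s3 cv3 v" "grows t3 s2 s3"
      by (rule simulatesE[OF Less.IH(6) 2(6,5)]) simp
    have "less_val cv1 cv2 = Some b"
      using 1(3) 2(3) Less by (cases v1; cases v2; auto elim!: rep_RIE rep_RNE)
    then have "eval W P cenv s (compile (Less e1 e2 e3 e4)) cv3 s3 (u1 + u2 + u3 + 1)"
      using eval_evals.IfLess[OF 1(1) 2(1), of b "compile e3" "compile e4"] 3(1) by (cases b) auto
    then show "\<exists>cv s' t'. eval W P cenv s (compile (Less e1 e2 e3 e4)) cv s' t' \<and> t' \<le> t1 + t2 + t3 + 1
       \<and> rep s' cv v \<and> grows (t1 + t2 + t3 + 1) s s'"
      using grows_mono[OF grows_trans[OF grows_trans[OF 1(4) 2(4)] 3(4)], of "t1 + t2 + t3 + 1"]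
        1(2) 2(2) 3(2,3) by (intro exI[of _ cv3] exI[of _ s3] exI[of _ "u1 + u2 + u3 + 1"]) auto
  qed
next
  case (Let env e1 v1 t1 e2 v t2)
  show ?case
  proof (rule simulatesI)
    fix cenv s assume a: "list_all2 (rep s) cenv env" "room W s (t1 + t2 + 1)"
    obtain cv1 s1 u1 where 1: "eval W P cenv s (compile e1) cv1 s1 u1" "u1 \<le> t1" "rep s1 cv1 v1"
      "grows t1 s s1" "room W s1 (t1 + t2 + 1 - t1)" "list_all2 (rep s1) cenv env"
      by (rule simulatesE[OF Let.IH(2) a]) simp
    have "list_all2 (rep s1) (cv1 # cenv) (v1 # env)" using 1 by simp
    then obtain cv2 s2 u2 where 2: "eval W P (cv1 # cenv) s1 (compile e2) cv2 s2 u2" "u2 \<le> t2" "rep s2 cv2 v"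
      "grows t2 s1 s2"
      by (rule simulatesE[OF Let.IH(4) _ 1(5)]) simp
    have "eval W P cenv s (compile (Let e1 e2)) cv2 s2 (u1 + u2 + 1)"
      using eval_evals.Bind[OF 1(1) 2(1)] by simp
    then show "\<exists>cv s' t'. eval W P cenv s (compile (Let e1 e2)) cv s' t' \<and> t' \<le> t1 + t2 + 1
       \<and> rep s' cv v \<and> grows (t1 + t2 + 1) s s'"
      using grows_mono[OF grows_trans[OF 1(4) 2(4)], of "t1 + t2 + 1"] 1(2) 2(2,3)
      by (intro exI[of _ cv2] exI[of _ s2] exI[of _ "u1 + u2 + 1"]) auto
  qed
next
  case (IfNil0 env e t1 e1 v t2 e2)
  show ?case
  proof (rule simulatesI)
    fix cenv s assume a: "list_all2 (rep s) cenv env" "room W s (t1 + t2 + 2)"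
    then have W0: "0 \<le> W" by (auto simp: room_def)
    obtain cv1 s1 u1 where 1: "eval W P cenv s (compile e) cv1 s1 u1" "u1 \<le> t1" "rep s1 cv1 (RI 0)"
      "grows t1 s s1" "room W s1 (t1 + t2 + 2 - t1)" "list_all2 (rep s1) cenv env"
      by (rule simulatesE[OF IfNil0.IH(2) a]) simp
    obtain cv2 s2 u2 where 2: "eval W P cenv s1 (compile e1) cv2 s2 u2" "u2 \<le> t2" "rep s2 cv2 v"
      "grows t2 s1 s2"
      by (rule simulatesE[OF IfNil0.IH(4) 1(6,5)]) simp
    have "eval W P cenv s (compile (IfNil e e1 e2)) cv2 s2 (1 + u1 + u2 + 1)"
      using eval_evals.IfLess[OF eval_evals.Const[of 0], of W P cenv s "compile e" cv1 s1 u1 False] W0 1(1,3) 2(1)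
      by (auto elim: rep_RIE)
    then show "\<exists>cv s' t'. eval W P cenv s (compile (IfNil e e1 e2)) cv s' t' \<and> t' \<le> t1 + t2 + 2
       \<and> rep s' cv v \<and> grows (t1 + t2 + 2) s s'"
      using grows_mono[OF grows_trans[OF 1(4) 2(4)], of "t1 + t2 + 2"] 1(2) 2(2,3)
      by (intro exI[of _ cv2] exI[of _ s2] exI[of _ "1 + u1 + u2 + 1"]) auto
  qed
next
  case (IfNil1 env e vs t1 e2 v t2 e1)
  show ?case
  proof (rule simulatesI)
    fix cenv s assume a: "list_all2 (rep s) cenv env" "room W s (t1 + t2 + 2)"
    then have W0: "0 \<le> W" by (auto simp: room_def)
    obtain cv1 s1 u1 where 1: "eval W P cenv s (compile e) cv1 s1 u1" "u1 \<le> t1" "rep s1 cv1 (RC vs)"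
      "grows t1 s s1" "room W s1 (t1 + t2 + 2 - t1)" "list_all2 (rep s1) cenv env"
      by (rule simulatesE[OF IfNil1.IH(2) a]) simp
    obtain cv2 s2 u2 where 2: "eval W P cenv s1 (compile e2) cv2 s2 u2" "u2 \<le> t2" "rep s2 cv2 v"
      "grows t2 s1 s2"
      by (rule simulatesE[OF IfNil1.IH(4) 1(6,5)]) simp
    have "eval W P cenv s (compile (IfNil e e1 e2)) cv2 s2 (1 + u1 + u2 + 1)"
      using eval_evals.IfLess[OF eval_evals.Const[of 0], of W P cenv s "compile e" cv1 s1 u1 True] W0 1(1,3) 2(1)
      by (auto elim!: rep_RCE)
    then show "\<exists>cv s' t'. eval W P cenv s (compile (IfNil e e1 e2)) cv s' t' \<and> t' \<le> t1 + t2 + 2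
       \<and> rep s' cv v \<and> grows (t1 + t2 + 2) s s'"
      using grows_mono[OF grows_trans[OF 1(4) 2(4)], of "t1 + t2 + 2"] 1(2) 2(2,3)
      by (intro exI[of _ cv2] exI[of _ s2] exI[of _ "1 + u1 + u2 + 1"]) auto
  qed
next
  case (Fld env e vs t1 i)
  show ?case
  proof (rule simulatesI)
    fix cenv s assume a: "list_all2 (rep s) cenv env" "room W s (t1 + 3)"
    obtain cv1 s1 u1 where 1: "eval W P cenv s (compile e) cv1 s1 u1" "u1 \<le> t1" "rep s1 cv1 (RC vs)"
      "grows t1 s s1" "room W s1 (t1 + 3 - t1)"
      by (rule simulatesE[OF Fld.IH(2) a]) simp
    obtain h p where p: "cv1 = IntV p" "s1 0 = IntV h" "2 \<le> p" "p + int (length vs) \<le> h + 2"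
      "rep s1 (s1 (p + int i)) (vs ! i)" using 1(3) Fld by (auto elim!: rep_RCE)
    have "eval W P cenv s (compile (Fld i e)) (s1 (p + int i)) s1 (u1 + 1 + 1 + 1)"
      unfolding compile.simps
      by (rule eval_evals.Load[OF eval_evals.Plus[OF 1(1)[unfolded p(1)] eval_evals.Const]])
        (use p 1(5) Fld in \<open>auto simp: room_def\<close>)
    then show "\<exists>cv s' t'. eval W P cenv s (compile (Fld i e)) cv s' t' \<and> t' \<le> t1 + 3
       \<and> rep s' cv (vs ! i) \<and> grows (t1 + 3) s s'"
      using grows_mono[OF 1(4), of "t1 + 3"] 1(2) p(5)
      by (intro exI[of _ "s1 (p + int i)"] exI[of _ s1] exI[of _ "u1 + 1 + 1 + 1"]) auto
  qed
next
  case (FldZ env e v t1 i w)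
  show ?case
  proof (rule simulatesI)
    fix cenv s assume a: "list_all2 (rep s) cenv env" "room W s (t1 + 8)"
    then have W0: "0 \<le> W" by (auto simp: room_def)
    obtain cv1 s1 u1 where 1: "eval W P cenv s (compile e) cv1 s1 u1" "u1 \<le> t1" "rep s1 cv1 v"
      "grows t1 s s1" "room W s1 (t1 + 8 - t1)"
      by (rule simulatesE[OF FldZ.IH(2) a]) simp
    let ?c = "IfLess (Const 0) (Var 0) (Load (Plus (Var 0) (Const (int i)))) (Const 0)"
    have "\<exists>cw t'. eval W P (cv1 # cenv) s1 ?c cw s1 t' \<and> t' \<le> 7 \<and> rep s1 cw w"
    proof (cases v)
      case (RI x)
      then have x: "cv1 = IntV 0" "w = RI 0" using 1(3) FldZ by (auto elim!: rep_RIE split: if_splits)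
      have "eval W P (cv1 # cenv) s1 ?c (IntV 0) s1 (1 + 1 + 1 + 1)"
        by (rule eval_evals.IfLess[OF eval_evals.Const eval_evals.Var, where b = False])
          (use W0 x in \<open>auto intro: eval_evals.Const[of 0, simplified]\<close>)
      then show ?thesis using x(2) rep.RI by fastforce
    next
      case (RC vs)
      obtain h p where p: "cv1 = IntV p" "s1 0 = IntV h" "2 \<le> p" "p + int (length vs) \<le> h + 2"
        "rep s1 (s1 (p + int i)) w" "i < length vs"
        using 1(3) FldZ RC by (auto elim!: rep_RCE split: if_splits)
      have v: "eval W P (cv1 # cenv) s1 (Var 0) (IntV p) s1 1"
        using eval_evals.Var[of 0 "cv1 # cenv"] p(1) by simp
      have c: "eval W P (cv1 # cenv) s1 (Load (Plus (Var 0) (Const (int i)))) (s1 (p + int i)) s1 (1+1+1+1)"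
        by (rule eval_evals.Load[OF eval_evals.Plus[OF v eval_evals.Const]])
          (use p 1(5) in \<open>auto simp: room_def\<close>)
      have "eval W P (cv1 # cenv) s1 ?c (s1 (p + int i)) s1 (1 + 1 + (1+1+1+1) + 1)"
        by (rule eval_evals.IfLess[OF eval_evals.Const v, where b = True])
          (use W0 p c in auto)
      then show ?thesis using p(5) by fastforce
    qed (use FldZ in auto)
    then obtain cw t' where w: "eval W P (cv1 # cenv) s1 ?c cw s1 t'" "t' \<le> 7" "rep s1 cw w" by blast
    have "eval W P cenv s (compile (FldZ i e)) cw s1 (u1 + t' + 1)"
      unfolding compile.simps by (rule eval_evals.Bind[OF 1(1) w(1)])
    then show "\<exists>cv s' t'. eval W P cenv s (compile (FldZ i e)) cv s' t' \<and> t' \<le> t1 + 8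
       \<and> rep s' cv w \<and> grows (t1 + 8) s s'"
      using grows_mono[OF 1(4), of "t1 + 8"] 1(2) w(2,3)
      by (intro exI[of _ cw] exI[of _ s1] exI[of _ "u1 + t' + 1"]) auto
  qed
next
  case (Rec env es vs t1)
  show ?case
  proof (rule simulatesI)
    let ?t = "t1 + max_alloc_cost"
    fix cenv s assume a: "list_all2 (rep s) cenv env" "room W s ?t"
    obtain cvs s1 u1 where 1: "evals W P cenv s (map compile es) cvs s1 u1" "u1 \<le> t1"
      "list_all2 (rep s1) cvs vs" "grows t1 s s1" "room W s1 (?t - t1)"
      by (rule simulates_listE[OF Rec.IH(2) a]) simp
    obtain h where h: "s1 0 = IntV h" "0 \<le> h" "h + 11 \<le> W" using 1(5) by (auto simp: room_def)
    define s2 where "s2 = (\<lambda>a. if a = 0 then IntV (h + 9) else if h + 2 \<le> a \<and> a < h + 11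
      then cvs ! nat (a - h - 2) else s1 a)"
    have len: "length cvs = 9" using 1(3) Rec by (auto dest: list_all2_lengthD)
    obtain u2 where u2: "eval W P cvs s1 alloc (IntV (h + 2)) s2 u2" "u2 \<le> 99"
      using eval_alloc[OF len, of s1 h W P] h unfolding s2_def by blast
    have g: "grows 9 s1 s2" unfolding grows_def s2_def using h by auto
    have "rep s2 (IntV (h + 2)) (RC vs)"
    proof (rule rep.RC)
      show "s2 0 = IntV (h + 9)" by (simp add: s2_def)
      fix i assume i: "i < length vs"
      have "rep s2 (cvs ! i) (vs ! i)"
        using i 1(3) rep_grows[OF _ g] by (auto dest: list_all2_nthD2)
      then show "rep s2 (s2 (h + 2 + int i)) (vs ! i)"
        using i Rec h(2) by (simp add: s2_def)
    qed (use h Rec in auto)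
    moreover have "eval W P cenv s (compile (Rec es)) (IntV (h + 2)) s2 (u1 + u2 + 1)"
      unfolding compile.simps by (rule eval_evals.Call[OF 1(1)]) (use u2(1) in \<open>auto simp: P_def link_def\<close>)
    ultimately show "\<exists>cv s' t'. eval W P cenv s (compile (Rec es)) cv s' t' \<and> t' \<le> ?t
       \<and> rep s' cv (RC vs) \<and> grows ?t s s'"
      using grows_mono[OF grows_trans[OF 1(4) g], of ?t] 1(2) u2(2)
      by (intro exI[of _ "IntV (h + 2)"] exI[of _ s2] exI[of _ "u1 + u2 + 1"]) (auto simp: max_alloc_cost_def)
  qed
next
  case (App env es vs t1 f v t2)
  show ?case
  proof (rule simulatesI)
    fix cenv s assume a: "list_all2 (rep s) cenv env" "room W s (t1 + t2 + 1)"
    obtain cvs s1 u1 where 1: "evals W P cenv s (map compile es) cvs s1 u1" "u1 \<le> t1"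
      "list_all2 (rep s1) cvs vs" "grows t1 s s1" "room W s1 (t1 + t2 + 1 - t1)"
      by (rule simulates_listE[OF App.IH(2) a]) simp
    obtain cv2 s2 u2 where 2: "eval W P cvs s1 (compile (R ! f)) cv2 s2 u2" "u2 \<le> t2" "rep s2 cv2 v"
      "grows t2 s1 s2"
      by (rule simulatesE[OF App.IH(5) 1(3,5)]) simp
    have "eval W P cenv s (compile (App f es)) cv2 s2 (u1 + u2 + 1)"
      unfolding compile.simps by (rule eval_evals.Call[OF 1(1)])
        (use 2(1) App in \<open>auto simp: P_def link_def\<close>)
    then show "\<exists>cv s' t'. eval W P cenv s (compile (App f es)) cv s' t' \<and> t' \<le> t1 + t2 + 1
       \<and> rep s' cv v \<and> grows (t1 + t2 + 1) s s'"
      using grows_mono[OF grows_trans[OF 1(4) 2(4)], of "t1 + t2 + 1"] 1(2) 2(2,3)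
      by (intro exI[of _ cv2] exI[of _ s2] exI[of _ "u1 + u2 + 1"]) auto
  qed
next
  case (Nil env)
  then show ?case
    unfolding simulates_list_def using eval_evals.Nil room_refl by fastforce
next
  case (Cons env e v t1 es vs t2)
  show ?case
    unfolding simulates_list_def
  proof (intro allI impI)
    fix cenv s n assume a: "list_all2 (rep s) cenv env" "room W s (t1 + t2 + n)"
    obtain cv1 s1 u1 where 1: "eval W P cenv s (compile e) cv1 s1 u1" "u1 \<le> t1" "rep s1 cv1 v"
      "grows t1 s s1" "room W s1 (t1 + t2 + n - t1)" "list_all2 (rep s1) cenv env"
      by (rule simulatesE[OF Cons.IH(2) a]) simp
    obtain cvs s2 u2 where 2: "evals W P cenv s1 (map compile es) cvs s2 u2" "u2 \<le> t2"
      "list_all2 (rep s2) cvs vs" "grows t2 s1 s2"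
      by (rule simulates_listE[OF Cons.IH(4) 1(6,5)]) simp
    have "evals W P cenv s (map compile (e # es)) (cv1 # cvs) s2 (u1 + u2)"
      using eval_evals.Cons[OF 1(1) 2(1)] by simp
    moreover have "list_all2 (rep s2) (cv1 # cvs) (v # vs)"
      using rep_grows[OF 1(3) 2(4)] 2(3) by simp
    ultimately show "\<exists>cvs s' t'. evals W P cenv s (map compile (e # es)) cvs s' t' \<and> t' \<le> t1 + t2 \<and>
        list_all2 (rep s') cvs (v # vs) \<and> grows (t1 + t2) s s'"
      using grows_trans[OF 1(4) 2(4)] 1(2) 2(2)
      by (intro exI[of _ "cv1 # cvs"] exI[of _ s2] exI[of _ "u1 + u2"]) auto
  qed
qed

section \<open>Sequences as AVL trees\<close>

type_synonym elem = "real \<times> int"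

definition mark_count :: "int \<Rightarrow> elem list \<Rightarrow> int" where
  "mark_count k xs = int (length (filter (\<lambda>e. snd e = k) xs))"

lemma mark_count_simps [simp]:
  "mark_count k [] = 0"
  "mark_count k (e # xs) = (if snd e = k then 1 else 0) + mark_count k xs"
  "mark_count k (xs @ ys) = mark_count k xs + mark_count k ys"
  by (auto simp: mark_count_def)

lemma mark_count_bounds: "0 \<le> mark_count k xs" "mark_count k xs \<le> int (length xs)"
  by (auto simp: mark_count_def length_filter_le)

fun avl :: "'a tree \<Rightarrow> bool" where
  "avl Leaf \<longleftrightarrow> True"
| "avl (Node l a r) \<longleftrightarrow> avl l \<and> avl r \<and> height l \<le> height r + 1 \<and> height r \<le> height l + 1"

text \<open>Both subtrees of a tree of height h have height at least h - 2, so size plus one doubles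
  whenever h grows by 2. The sharper Fibonacci bound would only improve constants.\<close>

lemma avl_size: "avl t \<Longrightarrow> 2 ^ (height t div 2) \<le> size t + 1"
proof (induction "height t" arbitrary: t rule: less_induct)
  case less
  show ?case
  proof (cases t)
    case Leaf then show ?thesis by simp
  next
    case (Node l a r)
    show ?thesis
    proof (cases "height t \<le> 1")
      case True
      then have "height t div 2 = 0" by simp
      then show ?thesis by simp
    next
      case False
      have b: "2 ^ ((height t - 2) div 2) \<le> size u + 1" if "u = l \<or> u = r" for u
      proof -
        have "height u < height t" "height t - 2 \<le> height u" "avl u"
          using that Node less.prems by auto
        moreover then have "(2::nat) ^ ((height t - 2) div 2) \<le> 2 ^ (height u div 2)"
          by (intro power_increasing div_le_mono) auto
        ultimately show ?thesis using less.hyps[of u] by linarith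
      qed
      have "height t div 2 = Suc ((height t - 2) div 2)" using False by presburger
      then show ?thesis using b[of l] b[of r] Node by simp
    qed
  qed
qed

text \<open>The \<open>Leaf\<close> branches are unreachable: the higher side has height at least 2,
  and a double rotation occurs only if its inner child is higher than the outer one.\<close>

definition bal :: "'a tree \<Rightarrow> 'a \<Rightarrow> 'a tree \<Rightarrow> 'a tree" where
  "bal l a r = (if height r + 1 < height l then
      (case l of Node ll b lr \<Rightarrow>
         if height ll < height lr then
           (case lr of Node p c q \<Rightarrow> Node (Node ll b p) c (Node q a r) | Leaf \<Rightarrow> Leaf)
         else Node ll b (Node lr a r)
       | Leaf \<Rightarrow> Leaf)
    else if height l + 1 < height r then
      (case r of Node rl b rr \<Rightarrow>
         if height rr < height rl then
           (case rl of Node p c q \<Rightarrow> Node (Node l a p) c (Node q b rr) | Leaf \<Rightarrow> Leaf)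
         else Node (Node l a rl) b rr
       | Leaf \<Rightarrow> Leaf)
    else Node l a r)"

text \<open>Positions, not keys, guide the operation; so the same code serves the unsorted array and
  the sorted trees, where \<open>rank\<close> supplies the position.\<close>

fun ins :: "int \<Rightarrow> 'a \<Rightarrow> 'a tree \<Rightarrow> 'a tree" where
  "ins i a Leaf = Node Leaf a Leaf"
| "ins i a (Node l b r) = (if int (size l) < i then bal l b (ins (i - int (size l) - 1) a r)
     else bal (ins i a l) b r)"

fun get :: "int \<Rightarrow> 'a tree \<Rightarrow> 'a" where
  "get i (Node l b r) = (if i < int (size l) then get i l
     else if int (size l) < i then get (i - int (size l) - 1) r else b)"

fun del :: "int \<Rightarrow> 'a tree \<Rightarrow> 'a tree" where
  "del i Leaf = Leaf"
| "del i (Node l b r) = (if i < int (size l) then bal (del i l) b r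
     else if int (size l) < i then bal l b (del (i - int (size l) - 1) r)
     else if r = Leaf then l else if l = Leaf then r else bal l (get 0 r) (del 0 r))"

text \<open>A binary search, which counts the keys below v provided that the keys increase.\<close>

fun rank :: "real \<Rightarrow> elem tree \<Rightarrow> int" where
  "rank v Leaf = 0"
| "rank v (Node l b r) = (if fst b < v then int (size l) + 1 + rank v r else rank v l)"

fun prefix_count :: "int \<Rightarrow> int \<Rightarrow> elem tree \<Rightarrow> int" where
  "prefix_count k i Leaf = 0"
| "prefix_count k i (Node l b r) = (if int (size l) < i
     then mark_count k (inorder l) + (if snd b = k then 1 else 0) + prefix_count k (i - int (size l) - 1) r
     else prefix_count k i l)"

text \<open>The inverse of \<open>prefix_count\<close>: the position of the element number j,
  counted from 0, among those with mark k.\<close>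

fun select :: "int \<Rightarrow> int \<Rightarrow> elem tree \<Rightarrow> int" where
  "select k j Leaf = 0"
| "select k j (Node l b r) = (if j < mark_count k (inorder l) then select k j l
     else if snd b = k then
       (if mark_count k (inorder l) < j
        then int (size l) + 1 + select k (j - mark_count k (inorder l) - 1) r else int (size l))
     else int (size l) + 1 + select k (j - mark_count k (inorder l)) r)"

subsection \<open>Contents\<close>

lemma inorder_bal [simp]: "inorder (bal l a r) = inorder l @ a # inorder r"
proof -
  have "\<not> height x + 1 < height (Leaf :: 'a tree)" "\<not> height x < height (Leaf :: 'a tree)" for x :: "'a tree"
    by simp_all
  then show ?thesis by (auto simp: bal_def split: tree.splits)
qed

lemma size_bal [simp]: "size (bal l a r) = size l + size r + 1"
  by (metis inorder_bal length_inorder length_append length_Cons add_Suc_right Suc_eq_plus1)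

lemma inorder_ins:
  "0 \<le> i \<Longrightarrow> i \<le> int (size t) \<Longrightarrow> inorder (ins i a t) = take (nat i) (inorder t) @ a # drop (nat i) (inorder t)"
proof (induction i a t rule: ins.induct)
  case (2 i a l b r)
  show ?case
  proof (cases "int (size l) < i")
    case True
    then have "nat i - size l = Suc (nat (i - int (size l) - 1))" by linarith
    then show ?thesis using 2 True by simp
  qed (use 2 in auto)
qed auto

lemma size_ins [simp]: "size (ins i a t) = size t + 1"
  by (induction i a t rule: ins.induct) auto

lemma get_inorder: "0 \<le> i \<Longrightarrow> i < int (size t) \<Longrightarrow> get i t = inorder t ! nat i"
proof (induction i t rule: get.induct)
  case (1 i l b r)
  show ?case
  proof (cases "int (size l) < i")
    case True
    then have "nat i - size l = Suc (nat (i - int (size l) - 1))" by linarith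
    moreover have "\<not> nat i < size l" using True by linarith
    ultimately show ?thesis using 1 True by (simp add: nth_append)
  next
    case False
    then show ?thesis using 1 by (cases "i = int (size l)") (auto simp: nth_append)
  qed
qed auto

lemma inorder_del:
  "0 \<le> i \<Longrightarrow> i < int (size t) \<Longrightarrow> inorder (del i t) = take (nat i) (inorder t) @ drop (Suc (nat i)) (inorder t)"
proof (induction i t rule: del.induct)
  case (2 i l b r)
  consider "i < int (size l)" | "int (size l) < i" | "i = int (size l)" by linarith
  then show ?case
  proof cases
    case 2
    then have "nat i - size l = Suc (nat (i - int (size l) - 1))"
      "Suc (nat i) - size l = Suc (Suc (nat (i - int (size l) - 1)))" by linarith+
    then show ?thesis using "2.prems" "2.IH"(2) 2 by simp
  next
    case 3
    show ?thesis
    proof (cases "r = Leaf \<or> l = Leaf")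
      case False
      then obtain x xs where r: "inorder r = x # xs" by (cases "inorder r") (auto simp: inorder.simps)
      then have "0 < size r" using length_inorder[of r] by simp
      then show ?thesis using 3 False r "2.IH"(3) get_inorder[of 0 r] by simp
    qed (use 3 in auto)
  next
    case 1 then show ?thesis using "2.IH"(1) "2.prems" by simp
  qed
qed auto

lemma size_del: "0 \<le> i \<Longrightarrow> i < int (size t) \<Longrightarrow> size (del i t) = size t - 1"
  using inorder_del[of i t] length_inorder[of "del i t"] by auto

lemma rank_bounds: "0 \<le> rank v t" "rank v t \<le> int (size t)"
  by (induction v t rule: rank.induct) auto

lemma rank_inorder:
  "sorted_wrt (<) (map fst (inorder t)) \<Longrightarrow> rank v t = int (length (filter (\<lambda>e. fst e < v) (inorder t)))"
proof (induction v t rule: rank.induct)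
  case (2 v l b r)
  have s: "\<forall>x\<in>set (inorder l). fst x < fst b" "\<forall>x\<in>set (inorder r). fst b < fst x"
    using "2.prems" by (auto simp: sorted_wrt_append)
  show ?case
  proof (cases "fst b < v")
    case True
    then have "filter (\<lambda>e. fst e < v) (inorder l) = inorder l"
      using s by (force intro: filter_True)
    then show ?thesis using True 2 by (simp add: sorted_wrt_append)
  next
    case False
    then have "filter (\<lambda>e. fst e < v) (inorder r) = []"
      using s by (force intro: filter_False)
    then show ?thesis using False 2 by (simp add: sorted_wrt_append)
  qed
qed auto

lemma prefix_count_inorder:
  "i \<le> int (size t) \<Longrightarrow> prefix_count k i t = mark_count k (take (nat i) (inorder t))"
proof (induction k i t rule: prefix_count.induct)
  case (2 k i l b r)
  show ?case
  proof (cases "int (size l) < i")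
    case True
    then have "nat i - size l = Suc (nat (i - int (size l) - 1))" by linarith
    then show ?thesis using 2 True by simp
  qed (use 2 in auto)
qed auto

lemma select_inorder:
  "0 \<le> j \<Longrightarrow> j < mark_count k (inorder t) \<Longrightarrow>
   0 \<le> select k j t \<and> select k j t < int (size t) \<and> snd (inorder t ! nat (select k j t)) = k \<and>
   mark_count k (take (nat (select k j t)) (inorder t)) = j"
proof (induction k j t rule: select.induct)
  case (2 k j l b r)
  let ?m = "mark_count k (inorder l)"
  have *: "nat (int (size l) + 1 + i) = Suc (size l + nat i)" if "0 \<le> i" for i using that by linarith
  consider "j < ?m" | "\<not> j < ?m" "snd b = k" "?m < j" | "j = ?m" "snd b = k" | "\<not> j < ?m" "snd b \<noteq> k"
    by linarith
  then show ?case
  proof cases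
    case 1 then show ?thesis using "2.IH"(1) "2.prems" by (auto simp: nth_append)
  next
    case a: 2 then show ?thesis using "2.IH"(2) "2.prems" by (auto simp: nth_append *)
  next
    case 3 then show ?thesis by (auto simp: nth_append)
  next
    case 4 then show ?thesis using "2.IH"(3) "2.prems" by (auto simp: nth_append *)
  qed
qed auto

subsection \<open>Balance\<close>

lemma height_0_Leaf: "height x < height y \<Longrightarrow> y \<noteq> Leaf"
  by auto

text \<open>The height bounds are what the inductions for insertion and deletion need: a rotation
  may swallow the level that the higher side has gained, while a node that is balanced already keeps
  its exact height.\<close>

lemma avl_bal:
  fixes l r :: "'a tree"
  assumes "avl l" "avl r" "height l \<le> height r + 2" "height r \<le> height l + 2"
  shows "avl (bal l a r) \<and> height (bal l a r) \<le> max (height l) (height r) + 1 \<and>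
    max (height l) (height r) \<le> height (bal l a r) \<and>
    (height l \<le> height r + 1 \<and> height r \<le> height l + 1 \<longrightarrow>
      height (bal l a r) = max (height l) (height r) + 1)"
proof -
  consider "height r + 1 < height l" | "height l + 1 < height r"
    | "height l \<le> height r + 1" "height r \<le> height l + 1" by linarith
  then show ?thesis
  proof cases
    case 1
    then obtain ll b lr where l: "l = Node ll b lr" using height_0_Leaf by (metis tree.exhaust not_less_zero height_tree.simps(1))
    show ?thesis
    proof (cases "height ll < height lr")
      case True
      then obtain p c q where lr: "lr = Node p c q" by (cases lr) auto
      have "bal l a r = Node (Node ll b p) c (Node q a r)"
        using 1 True unfolding bal_def l lr by simp
      then show ?thesis using assms 1 True unfolding l lr by (simp add: max_def split: if_splits)
    next
      case False
      then have "bal l a r = Node ll b (Node lr a r)"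
        using 1 unfolding bal_def l by simp
      then show ?thesis using assms 1 False unfolding l by (simp add: max_def split: if_splits)
    qed
  next
    case 2
    then obtain rl b rr where r: "r = Node rl b rr" using height_0_Leaf by (metis tree.exhaust not_less_zero height_tree.simps(1))
    show ?thesis
    proof (cases "height rr < height rl")
      case True
      then obtain p c q where rl: "rl = Node p c q" by (cases rl) auto
      have "bal l a r = Node (Node l a p) c (Node q b rr)"
        using 2 True unfolding bal_def r rl by simp
      then show ?thesis using assms 2 True unfolding r rl by (simp add: max_def split: if_splits)
    next
      case False
      then have "bal l a r = Node (Node l a rl) b rr"
        using 2 unfolding bal_def r by simp
      then show ?thesis using assms 2 False unfolding r by (simp add: max_def split: if_splits)
    qed
  next
    case 3
    then show ?thesis using assms by (auto simp: bal_def)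
  qed
qed

lemma avl_ins: "avl t \<Longrightarrow> avl (ins i a t) \<and> height t \<le> height (ins i a t) \<and> height (ins i a t) \<le> height t + 1"
proof (induction i a t rule: ins.induct)
  case (2 i a l b r)
  show ?case
  proof (cases "int (size l) < i")
    case True
    with 2 show ?thesis using avl_bal[of l "ins (i - int (size l) - 1) a r" b] by force
  next
    case False
    with 2 show ?thesis using avl_bal[of "ins i a l" r b] by force
  qed
qed auto

lemma avl_del: "avl t \<Longrightarrow> avl (del i t) \<and> height t \<le> height (del i t) + 1 \<and> height (del i t) \<le> height t"
proof (induction i t rule: del.induct)
  case (2 i l b r)
  consider "i < int (size l)" | "int (size l) < i" | "i = int (size l)" "r = Leaf \<or> l = Leaf"
    | "i = int (size l)" "r \<noteq> Leaf" "l \<noteq> Leaf" by linarith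
  then show ?case
  proof cases
    case 1
    with 2 show ?thesis using avl_bal[of "del i l" r b] by force
  next
    case a: 2
    with 2 show ?thesis using avl_bal[of l "del (i - int (size l) - 1) r" b] by force
  next
    case 3
    with 2 show ?thesis by auto
  next
    case 4
    with 2 show ?thesis using avl_bal[of l "del 0 r" "get 0 r"] by force
  qed
qed auto

section \<open>Programs on records\<close>

text \<open>A postcondition speaks of value and time together, and the rules below are equivalences,
  so that code can be executed symbolically by rewriting. Execution stops at a call, at
  \<open>wpc\<close>, where the correctness lemma of the procedure takes over.\<close>

definition wp :: "int \<Rightarrow> rexpr list \<Rightarrow> rexpr \<Rightarrow> rval list \<Rightarrow> (rval \<Rightarrow> nat \<Rightarrow> bool) \<Rightarrow> bool" where
  "wp B R e env Q \<longleftrightarrow> (\<exists>v t. reval B R env e v t \<and> Q v t)"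

definition wps :: "int \<Rightarrow> rexpr list \<Rightarrow> rexpr list \<Rightarrow> rval list \<Rightarrow> (rval list \<Rightarrow> nat \<Rightarrow> bool) \<Rightarrow> bool" where
  "wps B R es env Q \<longleftrightarrow> (\<exists>vs t. revals B R env es vs t \<and> Q vs t)"

definition wpc :: "int \<Rightarrow> rexpr list \<Rightarrow> nat \<Rightarrow> rval list \<Rightarrow> (rval \<Rightarrow> nat \<Rightarrow> bool) \<Rightarrow> bool" where
  "wpc B R f vs Q \<longleftrightarrow> f < length R \<and> wp B R (R ! f) vs Q"

inductive_cases reval_VE: "reval B R env (V i) v t"
inductive_cases reval_KE: "reval B R env (K i) v t"
inductive_cases reval_AddE: "reval B R env (Add e1 e2) v t"
inductive_cases reval_SubE: "reval B R env (Sub e1 e2) v t"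
inductive_cases reval_LessE: "reval B R env (Less e1 e2 e3 e4) v t"
inductive_cases reval_LetE: "reval B R env (Let e1 e2) v t"
inductive_cases reval_IfNilE: "reval B R env (IfNil e e1 e2) v t"
inductive_cases reval_FldE: "reval B R env (Fld i e) v t"
inductive_cases reval_FldZE: "reval B R env (FldZ i e) v t"
inductive_cases reval_RecE: "reval B R env (Rec es) v t"
inductive_cases reval_AppE: "reval B R env (App f es) v t"
inductive_cases revals_NilE: "revals B R env [] v t"
inductive_cases revals_ConsE: "revals B R env (e # es) v t"

lemma wp_V: "wp B R (V i) env Q \<longleftrightarrow> i < length env \<and> Q (env ! i) 1"
  unfolding wp_def
  by (rule iffI; elim exE conjE reval_VE; fastforce intro: reval_revals.V)

lemma wp_K: "wp B R (K k) env Q \<longleftrightarrow> \<bar>k\<bar> \<le> B \<and> Q (RI k) 1"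
  unfolding wp_def
  by (rule iffI; elim exE conjE reval_KE; fastforce intro: reval_revals.K)

lemma wp_Add: "wp B R (Add e1 e2) env Q \<longleftrightarrow> wp B R e1 env (\<lambda>v1 t1. wp B R e2 env (\<lambda>v2 t2.
    \<exists>x y. v1 = RI x \<and> v2 = RI y \<and> \<bar>x + y\<bar> \<le> B \<and> Q (RI (x + y)) (t1 + t2 + 1)))"
  unfolding wp_def
  by (rule iffI; elim exE conjE reval_AddE; fastforce intro: reval_revals.Add)

lemma wp_Sub: "wp B R (Sub e1 e2) env Q \<longleftrightarrow> wp B R e1 env (\<lambda>v1 t1. wp B R e2 env (\<lambda>v2 t2.
    \<exists>x y. v1 = RI x \<and> v2 = RI y \<and> \<bar>x - y\<bar> \<le> B \<and> Q (RI (x - y)) (t1 + t2 + 1)))"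
  unfolding wp_def
  by (rule iffI; elim exE conjE reval_SubE; fastforce intro: reval_revals.Sub)

lemma wp_Less: "wp B R (Less e1 e2 e3 e4) env Q \<longleftrightarrow> wp B R e1 env (\<lambda>v1 t1. wp B R e2 env (\<lambda>v2 t2.
    case less_rval v1 v2 of None \<Rightarrow> False | Some b \<Rightarrow>
      (b \<longrightarrow> wp B R e3 env (\<lambda>v t3. Q v (t1 + t2 + t3 + 1))) \<and>
      (\<not> b \<longrightarrow> wp B R e4 env (\<lambda>v t3. Q v (t1 + t2 + t3 + 1)))))"
  (is "?l \<longleftrightarrow> ?r")
proof
  assume ?l
  then obtain v t where "reval B R env (Less e1 e2 e3 e4) v t" "Q v t" unfolding wp_def by blast
  then show ?r
  proof (elim reval_LessE)
    fix v1 t1 v2 t2 b t3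
    assume *: "reval B R env e1 v1 t1" "reval B R env e2 v2 t2" "less_rval v1 v2 = Some b"
      and t: "t = Suc (t1 + t2 + t3)" and r: "reval B R env (if b then e3 else e4) v t3" and "Q v t"
    show ?r
      unfolding wp_def
      apply (rule exI[of _ v1], rule exI[of _ t1], rule conjI[OF *(1)])
      apply (rule exI[of _ v2], rule exI[of _ t2], rule conjI[OF *(2)])
      using * r t \<open>Q v t\<close> by (cases b) auto
  qed
next
  assume ?r
  then obtain v1 t1 v2 t2 b where *: "reval B R env e1 v1 t1" "reval B R env e2 v2 t2"
    "less_rval v1 v2 = Some b" and **: "b \<longrightarrow> wp B R e3 env (\<lambda>v t3. Q v (t1 + t2 + t3 + 1))"
    "\<not> b \<longrightarrow> wp B R e4 env (\<lambda>v t3. Q v (t1 + t2 + t3 + 1))"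
    unfolding wp_def[of _ _ e1] wp_def[of _ _ e2] by (auto split: option.splits)
  from ** obtain v t3 where "reval B R env (if b then e3 else e4) v t3" "Q v (t1 + t2 + t3 + 1)"
    unfolding wp_def by (cases b) auto
  with reval_revals.Less[OF * this(1)] show ?l unfolding wp_def by blast
qed

lemma wp_Let: "wp B R (Let e1 e2) env Q \<longleftrightarrow> wp B R e1 env (\<lambda>v1 t1. wp B R e2 (v1 # env)
    (\<lambda>v t2. Q v (t1 + t2 + 1)))"
  unfolding wp_def
  by (rule iffI; elim exE conjE reval_LetE; fastforce intro: reval_revals.Let)

lemma wp_IfNil: "wp B R (IfNil e e1 e2) env Q \<longleftrightarrow> wp B R e env (\<lambda>v1 t1.
    (v1 = RI 0 \<and> wp B R e1 env (\<lambda>v t2. Q v (t1 + t2 + 2))) \<or>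
    (\<exists>vs. v1 = RC vs \<and> wp B R e2 env (\<lambda>v t2. Q v (t1 + t2 + 2))))"
  unfolding wp_def
  by (rule iffI; elim exE conjE disjE reval_IfNilE; fastforce intro: reval_revals.IfNil0 reval_revals.IfNil1)

lemma wp_Fld: "wp B R (Fld i e) env Q \<longleftrightarrow> wp B R e env (\<lambda>v1 t1.
    \<exists>vs. v1 = RC vs \<and> i < length vs \<and> Q (vs ! i) (t1 + 3))"
  unfolding wp_def
  by (rule iffI; elim exE conjE reval_FldE; fastforce intro: reval_revals.Fld)

lemma wp_FldZ: "wp B R (FldZ i e) env Q \<longleftrightarrow> wp B R e env (\<lambda>v1 t1.
    \<exists>w. field_or_zero i v1 = Some w \<and> Q w (t1 + 8))"
  unfolding wp_def
  by (rule iffI; elim exE conjE reval_FldZE; fastforce intro: reval_revals.FldZ)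

lemma wp_Rec: "wp B R (Rec es) env Q \<longleftrightarrow> wps B R es env (\<lambda>vs t1.
    length vs = 9 \<and> Q (RC vs) (t1 + max_alloc_cost))"
  unfolding wp_def wps_def
  by (rule iffI; elim exE conjE reval_RecE; fastforce intro: reval_revals.Rec)

lemma wp_App: "wp B R (App f es) env Q \<longleftrightarrow> wps B R es env (\<lambda>vs t1. wpc B R f vs (\<lambda>v t2. Q v (t1 + t2 + 1)))"
  unfolding wp_def wps_def wpc_def
  by (rule iffI; elim exE conjE reval_AppE; fastforce intro: reval_revals.App)

lemma wps_Nil: "wps B R [] env Q \<longleftrightarrow> Q [] 0"
  unfolding wps_def by (auto elim: revals_NilE intro: reval_revals.Nil)

lemma wps_Cons: "wps B R (e # es) env Q \<longleftrightarrow> wp B R e env (\<lambda>v t1. wps B R es env (\<lambda>vs t2. Q (v # vs) (t1 + t2)))"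
  unfolding wp_def wps_def
  by (rule iffI; elim exE conjE revals_ConsE; fastforce intro: reval_revals.Cons)

lemmas wp_simps = wp_V wp_K wp_Add wp_Sub wp_Less wp_Let wp_IfNil wp_Fld wp_FldZ wp_Rec wp_App wps_Nil wps_Cons
  max_alloc_cost_def

definition computes :: "int \<Rightarrow> rexpr list \<Rightarrow> nat \<Rightarrow> rval list \<Rightarrow> rval \<Rightarrow> nat \<Rightarrow> bool" where
  "computes B R f vs v T \<longleftrightarrow> wpc B R f vs (\<lambda>w t. w = v \<and> t \<le> T)"

lemma computesD: "computes B R f vs v T \<Longrightarrow> (\<And>t. t \<le> T \<Longrightarrow> Q v t) \<Longrightarrow> wpc B R f vs Q"
  unfolding computes_def wpc_def wp_def by blast

text \<open>Size, height and the count of each of the three marks are cached, so that every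
  operation follows a single path. With children, key and mark this makes nine fields, the fixed
  record length.\<close>

fun enc :: "elem tree \<Rightarrow> rval" where
  "enc Leaf = RI 0"
| "enc (Node l a r) = RC [enc l, enc r, RN (fst a), RI (snd a), RI (int (size (Node l a r))),
     RI (int (height (Node l a r))), RI (mark_count 0 (inorder (Node l a r))),
     RI (mark_count 1 (inorder (Node l a r))), RI (mark_count 2 (inorder (Node l a r)))]"

lemma field_enc [simp]:
  "field_or_zero 4 (enc t) = Some (RI (int (size t)))"
  "field_or_zero 5 (enc t) = Some (RI (int (height t)))"
  "field_or_zero 6 (enc t) = Some (RI (mark_count 0 (inorder t)))"
  "field_or_zero 7 (enc t) = Some (RI (mark_count 1 (inorder t)))"
  "field_or_zero 8 (enc t) = Some (RI (mark_count 2 (inorder t)))"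
  by (cases t; simp)+

declare enc.simps(2) [simp del]

definition if_eq :: "rexpr \<Rightarrow> rexpr \<Rightarrow> rexpr \<Rightarrow> rexpr \<Rightarrow> rexpr" where
  "if_eq a b t f = Less a b f (Less b a f t)"

definition count_field :: "rexpr \<Rightarrow> rexpr \<Rightarrow> rexpr" where
  "count_field k e = Less k (K 1) (FldZ 6 e) (Less k (K 2) (FldZ 7 e) (FldZ 8 e))"

definition node_code :: rexpr where
  "node_code = Rec [V 0, V 3, V 1, V 2, Add (Add (FldZ 4 (V 0)) (FldZ 4 (V 3))) (K 1),
     Add (Less (FldZ 5 (V 0)) (FldZ 5 (V 3)) (FldZ 5 (V 3)) (FldZ 5 (V 0))) (K 1),
     Add (Add (FldZ 6 (V 0)) (FldZ 6 (V 3))) (if_eq (V 2) (K 0) (K 1) (K 0)),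
     Add (Add (FldZ 7 (V 0)) (FldZ 7 (V 3))) (if_eq (V 2) (K 1) (K 1) (K 0)),
     Add (Add (FldZ 8 (V 0)) (FldZ 8 (V 3))) (if_eq (V 2) (K 2) (K 1) (K 0))]"

definition bal_code :: rexpr where
  "bal_code = Less (Add (FldZ 5 (V 3)) (K 1)) (FldZ 5 (V 0))
     (Less (FldZ 5 (Fld 0 (V 0))) (FldZ 5 (Fld 1 (V 0)))
       (App 0 [App 0 [Fld 0 (V 0), Fld 2 (V 0), Fld 3 (V 0), Fld 0 (Fld 1 (V 0))],
          Fld 2 (Fld 1 (V 0)), Fld 3 (Fld 1 (V 0)), App 0 [Fld 1 (Fld 1 (V 0)), V 1, V 2, V 3]])
       (App 0 [Fld 0 (V 0), Fld 2 (V 0), Fld 3 (V 0), App 0 [Fld 1 (V 0), V 1, V 2, V 3]]))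
     (Less (Add (FldZ 5 (V 0)) (K 1)) (FldZ 5 (V 3))
       (Less (FldZ 5 (Fld 1 (V 3))) (FldZ 5 (Fld 0 (V 3)))
         (App 0 [App 0 [V 0, V 1, V 2, Fld 0 (Fld 0 (V 3))], Fld 2 (Fld 0 (V 3)), Fld 3 (Fld 0 (V 3)),
            App 0 [Fld 1 (Fld 0 (V 3)), Fld 2 (V 3), Fld 3 (V 3), Fld 1 (V 3)]])
         (App 0 [App 0 [V 0, V 1, V 2, Fld 0 (V 3)], Fld 2 (V 3), Fld 3 (V 3), Fld 1 (V 3)]))
       (App 0 [V 0, V 1, V 2, V 3]))"

definition ins_code :: rexpr where
  "ins_code = IfNil (V 3) (App 0 [K 0, V 1, V 2, K 0])
     (Less (FldZ 4 (Fld 0 (V 3))) (V 0)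
       (App 1 [Fld 0 (V 3), Fld 2 (V 3), Fld 3 (V 3),
          App 2 [Sub (Sub (V 0) (FldZ 4 (Fld 0 (V 3)))) (K 1), V 1, V 2, Fld 1 (V 3)]])
       (App 1 [App 2 [V 0, V 1, V 2, Fld 0 (V 3)], Fld 2 (V 3), Fld 3 (V 3), Fld 1 (V 3)]))"

definition del_code :: rexpr where
  "del_code = IfNil (V 1) (K 0)
     (Less (V 0) (FldZ 4 (Fld 0 (V 1)))
       (App 1 [App 3 [V 0, Fld 0 (V 1)], Fld 2 (V 1), Fld 3 (V 1), Fld 1 (V 1)])
       (Less (FldZ 4 (Fld 0 (V 1))) (V 0)
         (App 1 [Fld 0 (V 1), Fld 2 (V 1), Fld 3 (V 1),
            App 3 [Sub (Sub (V 0) (FldZ 4 (Fld 0 (V 1)))) (K 1), Fld 1 (V 1)]])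
         (IfNil (Fld 1 (V 1)) (Fld 0 (V 1)) (IfNil (Fld 0 (V 1)) (Fld 1 (V 1))
           (App 1 [Fld 0 (V 1), App 4 [K 0, Fld 1 (V 1)], App 5 [K 0, Fld 1 (V 1)],
              App 3 [K 0, Fld 1 (V 1)]])))))"

definition get_code :: "nat \<Rightarrow> nat \<Rightarrow> rexpr" where
  "get_code i f = Less (V 0) (FldZ 4 (Fld 0 (V 1))) (App f [V 0, Fld 0 (V 1)])
     (Less (FldZ 4 (Fld 0 (V 1))) (V 0)
       (App f [Sub (Sub (V 0) (FldZ 4 (Fld 0 (V 1)))) (K 1), Fld 1 (V 1)])
       (Fld i (V 1)))"

definition rank_code :: rexpr where
  "rank_code = IfNil (V 1) (K 0)
     (Less (Fld 2 (V 1)) (V 0)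
       (Add (Add (FldZ 4 (Fld 0 (V 1))) (K 1)) (App 6 [V 0, Fld 1 (V 1)]))
       (App 6 [V 0, Fld 0 (V 1)]))"

definition prefix_count_code :: rexpr where
  "prefix_count_code = IfNil (V 2) (K 0)
     (Less (FldZ 4 (Fld 0 (V 2))) (V 1)
       (Add (Add (count_field (V 0) (Fld 0 (V 2))) (if_eq (Fld 3 (V 2)) (V 0) (K 1) (K 0)))
          (App 7 [V 0, Sub (Sub (V 1) (FldZ 4 (Fld 0 (V 2)))) (K 1), Fld 1 (V 2)]))
       (App 7 [V 0, V 1, Fld 0 (V 2)]))"

definition select_code :: rexpr where
  "select_code = IfNil (V 2) (K 0)
     (Let (count_field (V 0) (Fld 0 (V 2)))
       (Less (V 2) (V 0) (App 8 [V 1, V 2, Fld 0 (V 3)])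
         (if_eq (Fld 3 (V 3)) (V 1)
           (Less (V 0) (V 2)
              (Add (Add (FldZ 4 (Fld 0 (V 3))) (K 1))
                 (App 8 [V 1, Sub (Sub (V 2) (V 0)) (K 1), Fld 1 (V 3)]))
              (FldZ 4 (Fld 0 (V 3))))
           (Add (Add (FldZ 4 (Fld 0 (V 3))) (K 1)) (App 8 [V 1, Sub (V 2) (V 0), Fld 1 (V 3)])))))"

definition tree_code :: "rexpr list" where
  "tree_code = [node_code, bal_code, ins_code, del_code, get_code 2 4, get_code 3 5, rank_code,
     prefix_count_code, select_code]"

text \<open>All three marks lead to the same continuation, so the case distinction is confined to
  this rule instead of tripling what follows it.\<close>

lemma wp_count_field:
  assumes "k = 0 \<or> k = 1 \<or> k = 2" "2 \<le> B" "i < length env" "env ! i = RI k"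
    and "wp B R e env (\<lambda>v u. v = enc t \<and> u \<le> c)"
    and Q: "\<And>u. u \<le> c + 16 \<Longrightarrow> Q (RI (mark_count k (inorder t))) u"
  shows "wp B R (count_field (V i) e) env Q"
proof -
  have 1: "wp B R e env (\<lambda>v u. Q' v (f u))"
    if "\<And>u. u \<le> c \<Longrightarrow> Q' (enc t) (f u)" for Q' :: "rval \<Rightarrow> nat \<Rightarrow> bool" and f :: "nat \<Rightarrow> nat"
    using assms(5) that unfolding wp_def by blast
  show ?thesis
    using assms(1)
    by (elim disjE; use assms(2-4) Q in \<open>auto simp: count_field_def wp_simps intro!: 1\<close>)
qed

section \<open>Correctness and cost of the tree procedures\<close>

locale machine =
  fixes B :: int and R :: "rexpr list"
  assumes code: "take 9 R = tree_code"
begin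

lemma R_tree: "i < 9 \<Longrightarrow> i < length R \<and> R ! i = tree_code ! i"
proof -
  assume i: "i < 9"
  have l: "length (take 9 R) = 9" using code by (simp add: tree_code_def)
  then show ?thesis using i code by (metis length_take min.strict_boundedE nth_take)
qed

lemma computesI:
  "i < 9 \<Longrightarrow> wp B R (tree_code ! i) vs (\<lambda>w t. w = v \<and> t \<le> T) \<Longrightarrow> computes B R i vs v T"
  unfolding computes_def wpc_def using R_tree by simp

lemmas bal_computesI = computesI[of 1, unfolded tree_code_def, simplified, folded One_nat_def]
lemmas ins_computesI = computesI[of 2, unfolded tree_code_def, simplified]
lemmas del_computesI = computesI[of 3, unfolded tree_code_def, simplified]
lemmas getx_computesI = computesI[of 4, unfolded tree_code_def, simplified]
lemmas getm_computesI = computesI[of 5, unfolded tree_code_def, simplified]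
lemmas rank_computesI = computesI[of 6, unfolded tree_code_def, simplified]
lemmas prefix_count_computesI = computesI[of 7, unfolded tree_code_def, simplified]
lemmas select_computesI = computesI[of 8, unfolded tree_code_def, simplified]

lemma node_computes:
  assumes "int (size l + size r) + 10 \<le> B"
  shows "computes B R 0 [enc l, RN x, RI m, enc r] (enc (Node l (x, m) r)) 300"
proof -
  have h: "height l \<le> size l" "height r \<le> size r" by (rule height_le_size_tree)+
  have c: "0 \<le> mark_count k (inorder t)" "mark_count k (inorder t) \<le> int (size t)" for k t
    using mark_count_bounds[of k "inorder t"] by simp_all
  show ?thesis
    unfolding computes_def wpc_def
    using R_tree[of 0] assms h c[of 0 l] c[of 1 l] c[of 2 l] c[of 0 r] c[of 1 r] c[of 2 r]
    by (simp add: tree_code_def node_code_def wp_simps if_eq_def max_def enc.simps(2))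
qed

lemma bal_computes:
  assumes "int (size l + size r) + 10 \<le> B"
  shows "computes B R 1 [enc l, RN x, RI m, enc r] (enc (bal l (x, m) r)) 1500"
proof -
  have h: "height l \<le> size l" "height r \<le> size r" by (rule height_le_size_tree)+
  note node = computesD[OF node_computes]
  consider "height r + 1 < height l" | "height l + 1 < height r"
    | "\<not> height r + 1 < height l" "\<not> height l + 1 < height r" by linarith
  then show ?thesis
  proof cases
    case 1
    then obtain ll b lr where l: "l = Node ll b lr" using height_0_Leaf by (metis tree.exhaust not_less_zero height_tree.simps(1))
    show ?thesis
    proof (cases "height ll < height lr")
      case True
      then obtain p c q where lr: "lr = Node p c q" by (cases lr) auto
      have bal: "bal l (x, m) r = Node (Node ll b p) c (Node q (x, m) r)"
        using 1 True unfolding bal_def l lr by simp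
      have s: "size l = size ll + size p + size q + 2" unfolding l lr by simp
      show ?thesis
        unfolding bal
        using assms h 1 True s
        apply (intro bal_computesI)
        apply (simp add: bal_code_def wp_simps enc.simps(2)[of ll b lr, folded l] enc.simps(2)[of p c q, folded lr])
        apply (rule node, simp)+
        by simp
    next
      case False
      then have bal: "bal l (x, m) r = Node ll b (Node lr (x, m) r)"
        using 1 unfolding bal_def l by simp
      have s: "size l = size ll + size lr + 1" unfolding l by simp
      show ?thesis
        unfolding bal
        using assms h 1 False s
        apply (intro bal_computesI)
        apply (simp add: bal_code_def wp_simps enc.simps(2)[of ll b lr, folded l])
        apply (rule node, simp)+
        by simp
    qed
  next
    case 2
    then obtain rl b rr where r: "r = Node rl b rr" using height_0_Leaf by (metis tree.exhaust not_less_zero height_tree.simps(1))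
    show ?thesis
    proof (cases "height rr < height rl")
      case True
      then obtain p c q where rl: "rl = Node p c q" by (cases rl) auto
      have bal: "bal l (x, m) r = Node (Node l (x, m) p) c (Node q b rr)"
        using 2 True unfolding bal_def r rl by simp
      have s: "size r = size rr + size p + size q + 2" unfolding r rl by simp
      show ?thesis
        unfolding bal
        using assms h 2 True s
        apply (intro bal_computesI)
        apply (simp add: bal_code_def wp_simps enc.simps(2)[of rl b rr, folded r] enc.simps(2)[of p c q, folded rl])
        apply (rule node, simp)+
        by simp
    next
      case False
      then have bal: "bal l (x, m) r = Node (Node l (x, m) rl) b rr"
        using 2 unfolding bal_def r by simp
      have s: "size r = size rl + size rr + 1" unfolding r by simp
      show ?thesis
        unfolding bal
        using assms h 2 False s
        apply (intro bal_computesI)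
        apply (simp add: bal_code_def wp_simps enc.simps(2)[of rl b rr, folded r])
        apply (rule node, simp)+
        by simp
    qed
  next
    case 3
    then have bal: "bal l (x, m) r = Node l (x, m) r" by (simp add: bal_def)
    show ?thesis
      unfolding bal
      using assms h 3
      apply (intro bal_computesI)
        apply (simp add: bal_code_def wp_simps)
      apply (rule node, simp)+
      by simp
  qed
qed


text \<open>Per level 1500 steps for one \<open>bal\<close>, and 200 for reading fields and for the
  calls.\<close>

lemma ins_computes:
  assumes "0 \<le> i" "i \<le> int (size t)" "int (size t) + 10 \<le> B"
  shows "computes B R 2 [RI i, RN x, RI m, enc t] (enc (ins i (x, m) t)) (1700 * (height t + 1))"
  using assms
proof (induction i "(x, m)" t rule: ins.induct)
  case (1 i)
  note node = node_computes[of Leaf Leaf x m, simplified]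
  show ?case using 1
    apply (intro ins_computesI)
    apply (simp add: ins_code_def wp_simps)
    apply (rule computesD[OF node], simp)
    by simp
next
  case (2 i l b r)
  obtain bx bm where b: "b = (bx, bm)" by (cases b)
  note bal = computesD[OF bal_computes[unfolded One_nat_def]]
  note E = enc.simps(2)[of l "(bx, bm)" r]
  show ?case
  proof (cases "int (size l) < i")
    case True
    have "computes B R 2 [RI (i - int (size l) - 1), RN x, RI m, enc r] (enc (ins (i - int (size l) - 1) (x, m) r)) (1700 * (height r + 1))"
      using 2 True by simp
    note IH = computesD[OF this]
    show ?thesis using 2(4-) True
      apply (intro ins_computesI)
      apply (simp add: ins_code_def E b wp_simps)
      apply (rule IH, rule bal, simp)
      by simp
  next
    case False
    then have "computes B R 2 [RI i, RN x, RI m, enc l] (enc (ins i (x, m) l)) (1700 * (height l + 1))"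
      using 2 by simp
    note IH = computesD[OF this]
    show ?thesis using 2(4-) False
      apply (intro ins_computesI)
      apply (simp add: ins_code_def E b wp_simps)
      apply (rule IH, rule bal, simp)
      by simp
  qed
qed

lemma getx_computes:
  assumes "0 \<le> i" "i < int (size t)" "int (size t) + 10 \<le> B"
  shows "computes B R 4 [RI i, enc t] (RN (fst (get i t))) (100 * (height t + 1))"
  using assms
proof (induction i t rule: get.induct)
  case (1 i l b r)
  note E = enc.simps(2)[of l b r]
  consider "i < int (size l)" | "int (size l) < i" | "i = int (size l)" by linarith
  then show ?case
  proof cases
    case a: 1
    then have IH: "computes B R 4 [RI i, enc l] (RN (fst (get i l))) (100 * (height l + 1))"
      using 1 by simp
    show ?thesis using 1(3-) a
      apply (intro getx_computesI)
      apply (simp add: get_code_def E wp_simps)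
      apply (rule computesD[OF IH])
      by simp
  next
    case 2
    then have IH: "computes B R 4 [RI (i - int (size l) - 1), enc r] (RN (fst (get (i - int (size l) - 1) r))) (100 * (height r + 1))"
      using 1 by simp
    show ?thesis using 1(3-) 2
      apply (intro getx_computesI)
      apply (simp add: get_code_def E wp_simps)
      apply (rule computesD[OF IH])
      by simp
  next
    case 3
    show ?thesis using 1(3-) 3
      apply (intro getx_computesI)
      by (simp add: get_code_def E wp_simps)
  qed
qed simp

lemma getm_computes:
  assumes "0 \<le> i" "i < int (size t)" "int (size t) + 10 \<le> B"
  shows "computes B R 5 [RI i, enc t] (RI (snd (get i t))) (100 * (height t + 1))"
  using assms
proof (induction i t rule: get.induct)
  case (1 i l b r)
  note E = enc.simps(2)[of l b r]
  consider "i < int (size l)" | "int (size l) < i" | "i = int (size l)" by linarith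
  then show ?case
  proof cases
    case a: 1
    then have IH: "computes B R 5 [RI i, enc l] (RI (snd (get i l))) (100 * (height l + 1))"
      using 1 by simp
    show ?thesis using 1(3-) a
      apply (intro getm_computesI)
      apply (simp add: get_code_def E wp_simps)
      apply (rule computesD[OF IH])
      by simp
  next
    case 2
    then have IH: "computes B R 5 [RI (i - int (size l) - 1), enc r] (RI (snd (get (i - int (size l) - 1) r))) (100 * (height r + 1))"
      using 1 by simp
    show ?thesis using 1(3-) 2
      apply (intro getm_computesI)
      apply (simp add: get_code_def E wp_simps)
      apply (rule computesD[OF IH])
      by simp
  next
    case 3
    show ?thesis using 1(3-) 3
      apply (intro getm_computesI)
      by (simp add: get_code_def E wp_simps)
  qed
qed simp

text \<open>The first element never sits in a node with two children, so its deletion needs no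
  successor. Treating it apart leaves 200 per level in the general bound \<open>2200\<close>, which
  pays for the two lookups, of key and mark, that are made once in a general deletion.\<close>

lemma del_first_computes:
  assumes "t \<noteq> Leaf" "int (size t) + 10 \<le> B"
  shows "computes B R 3 [RI 0, enc t] (enc (del 0 t)) (2000 * (height t + 1))"
  using assms
proof (induction "0 :: int" t rule: del.induct)
  case (2 l b r)
  obtain bx bm where b: "b = (bx, bm)" by (cases b)
  note bal = computesD[OF bal_computes[unfolded One_nat_def]]
  note E = enc.simps(2)[of l "(bx, bm)" r]
  consider "l \<noteq> Leaf" | "l = Leaf" "r = Leaf" | "l = Leaf" "r \<noteq> Leaf"
    by linarith
  then show ?case
  proof cases
    case 1
    then have l: "0 < size l" by (cases l) auto
    then have "computes B R 3 [RI 0, enc l] (enc (del 0 l)) (2000 * (height l + 1))"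
      using 2 1 by simp
    note IH = computesD[OF this]
    show ?thesis using 2(5) 1 l size_del[of 0 l]
      apply (intro del_computesI)
      apply (simp add: del_code_def E b wp_simps)
      apply (rule IH, rule bal, simp)
      by simp
  next
    case a: 2
    then show ?thesis using 2(5)
      apply (intro del_computesI)
      by (simp add: del_code_def E[unfolded a] b wp_simps)
  next
    case 3
    then obtain vs where vs: "enc r = RC vs" using enc.simps(2) by (cases r) auto
    show ?thesis using 2(5) 3
      apply (intro del_computesI)
      by (simp add: del_code_def E[unfolded 3 vs] b vs wp_simps)
  qed
qed simp

lemma del_computes:
  assumes "0 \<le> i" "i < int (size t)" "int (size t) + 10 \<le> B"
  shows "computes B R 3 [RI i, enc t] (enc (del i t)) (2200 * (height t + 1))"
  using assms
proof (induction i t rule: del.induct)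
  case (2 i l b r)
  obtain bx bm where b: "b = (bx, bm)" by (cases b)
  note bal = computesD[OF bal_computes[unfolded One_nat_def]]
  note E = enc.simps(2)[of l "(bx, bm)" r]
  consider "i < int (size l)" | "int (size l) < i" | "i = int (size l)" "r = Leaf"
    | "i = int (size l)" "r \<noteq> Leaf" "l = Leaf" | "i = int (size l)" "r \<noteq> Leaf" "l \<noteq> Leaf"
    by linarith
  then show ?case
  proof cases
    case 1
    then have "computes B R 3 [RI i, enc l] (enc (del i l)) (2200 * (height l + 1))"
      using 2 by simp
    note IH = computesD[OF this]
    show ?thesis using 2(4-) 1 size_del[of i l]
      apply (intro del_computesI)
      apply (simp add: del_code_def E b wp_simps)
      apply (rule IH, rule bal, simp)
      by simp
  next
    case a: 2
    then have "computes B R 3 [RI (i - int (size l) - 1), enc r] (enc (del (i - int (size l) - 1) r)) (2200 * (height r + 1))"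
      using 2 by simp
    note IH = computesD[OF this]
    show ?thesis using 2(4-) a size_del[of "i - int (size l) - 1" r]
      apply (intro del_computesI)
      apply (simp add: del_code_def E b wp_simps)
      apply (rule IH, rule bal, simp)
      by simp
  next
    case 3
    then show ?thesis using 2(4-)
      apply (intro del_computesI)
      by (simp add: del_code_def E[unfolded 3] b wp_simps)
  next
    case 4
    then obtain vs where vs: "enc r = RC vs" using enc.simps(2) by (cases r) auto
    show ?thesis using 2(4-) 4
      apply (intro del_computesI)
      by (simp add: del_code_def E[unfolded 4 vs] b vs wp_simps)
  next
    case 5
    then have r: "0 < size r" by (cases r) auto
    have "computes B R 3 [RI 0, enc r] (enc (del 0 r)) (2000 * (height r + 1))"
      using 2(4-) del_first_computes[OF 5(2)] by simp
    note IH = computesD[OF this]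
    note x = computesD[OF getx_computes[of 0 r]]
    note m = computesD[OF getm_computes[of 0 r]]
    obtain vs ws where vs: "enc r = RC vs" "enc l = RC ws" using 5 enc.simps(2) by (cases r; cases l) auto
    show ?thesis using 2(4-) 5 size_del[of 0 r] r
      apply (intro del_computesI)
      apply (simp add: del_code_def E b wp_simps)
      apply (rule disjI2, rule conjI, rule exI[of _ vs], rule vs)
      apply (rule disjI2, rule conjI, rule exI[of _ ws], rule vs)
      apply (rule x, simp, simp, simp, rule m, simp, simp, simp, rule IH)
      apply (rule computesD[OF bal_computes[of l "del 0 r" "fst (get 0 r)" "snd (get 0 r)", unfolded One_nat_def prod.collapse]], simp)
      by simp
  qed
qed simp

lemma rank_computes:
  assumes "int (size t) + 10 \<le> B"
  shows "computes B R 6 [RN v, enc t] (RI (rank v t)) (100 * (height t + 1)) \<and> 0 \<le> rank v t \<and> rank v t \<le> int (size t)"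
  using assms
proof (induction v t rule: rank.induct)
  case (1 v)
  then show ?case
    apply simp
    apply (intro rank_computesI)
    by (simp add: rank_code_def wp_simps)
next
  case (2 v l b r)
  note E = enc.simps(2)[of l b r]
  show ?case
  proof (cases "fst b < v")
    case True
    with 2 have IH: "computes B R 6 [RN v, enc r] (RI (rank v r)) (100 * (height r + 1))"
      "0 \<le> rank v r" "rank v r \<le> int (size r)" by simp_all
    show ?thesis using 2(3-) True IH(2,3)
      apply simp
      apply (intro rank_computesI)
      apply (simp add: rank_code_def E wp_simps)
      apply (rule computesD[OF IH(1)])
      by simp
  next
    case False
    with 2 have IH: "computes B R 6 [RN v, enc l] (RI (rank v l)) (100 * (height l + 1))"
      "0 \<le> rank v l" "rank v l \<le> int (size l)" by simp_all
    show ?thesis using 2(3-) False IH(2,3)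
      apply simp
      apply (intro rank_computesI)
      apply (simp add: rank_code_def E wp_simps)
      apply (rule computesD[OF IH(1)])
      by simp
  qed
qed

lemma prefix_count_computes:
  assumes "int (size t) + 10 \<le> B" "i \<le> int (size t)" "0 \<le> i" "k = 0 \<or> k = 1 \<or> k = 2"
  shows "computes B R 7 [RI k, RI i, enc t] (RI (prefix_count k i t)) (200 * (height t + 1))"
  using assms
proof (induction k i t rule: prefix_count.induct)
  case (1 k i)
  then show ?case
    apply (intro prefix_count_computesI)
    by (simp add: prefix_count_code_def wp_simps)
next
  case (2 k i l b r)
  obtain a0 a1 a2 a3 a4 where E: "enc (Node l b r) = RC [enc l, enc r, RN (fst b), RI (snd b), a0, a1, a2, a3, a4]"
    using enc.simps(2) by blast
  have c: "0 \<le> mark_count k (inorder l)" "mark_count k (inorder l) \<le> int (size l)"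
    using mark_count_bounds[of k "inorder l"] by simp_all
  have d: "0 \<le> prefix_count k (i - int (size l) - 1) r \<and> prefix_count k (i - int (size l) - 1) r \<le> int (size r)"
    if "int (size l) < i"
  proof -
    have "length (take (nat (i - int (size l) - 1)) (inorder r)) \<le> size r" by simp
    then show ?thesis using 2(4) that prefix_count_inorder[of "i - int (size l) - 1" r k]
      mark_count_bounds[of k "take (nat (i - int (size l) - 1)) (inorder r)"] by simp
  qed
  show ?case
  proof (cases "int (size l) < i")
    case True
    with 2 have "computes B R 7 [RI k, RI (i - int (size l) - 1), enc r] (RI (prefix_count k (i - int (size l) - 1) r)) (200 * (height r + 1))"
      by simp
    note IH = computesD[OF this]
    \<comment> \<open>When the mark of the root agrees with k, the execution is expressed in terms
      of \<open>snd b\<close>; the induction hypothesis is needed in this form too.\<close>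
    have IH': "k = snd b \<Longrightarrow> (\<And>t. t \<le> 200 * (height r + 1) \<Longrightarrow> Q (RI (prefix_count (snd b) (i - int (size l) - 1) r)) t)
      \<Longrightarrow> wpc B R 7 [RI (snd b), RI (i - int (size l) - 1), enc r] Q" for Q
      using IH by simp
    show ?thesis using "2.prems"(1-3) True c d
      apply (intro prefix_count_computesI)
      apply (simp add: prefix_count_code_def E wp_simps if_eq_def)
      apply (rule wp_count_field[OF "2.prems"(4), where t = l and c = 4], simp, simp, simp, simp add: wp_simps)
      apply (auto intro!: IH IH')
      done
  next
    case False
    with 2 have "computes B R 7 [RI k, RI i, enc l] (RI (prefix_count k i l)) (200 * (height l + 1))"
      by simp
    note IH = computesD[OF this]
    show ?thesis using "2.prems"(1-3) False
      apply (intro prefix_count_computesI)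
      apply (simp add: prefix_count_code_def E wp_simps)
      apply (rule IH)
      by simp
  qed
qed

lemma select_computes:
  assumes "int (size t) + 10 \<le> B" "0 \<le> j" "j < mark_count k (inorder t)" "k = 0 \<or> k = 1 \<or> k = 2"
  shows "computes B R 8 [RI k, RI j, enc t] (RI (select k j t)) (200 * (height t + 1))"
  using assms
proof (induction k j t rule: select.induct)
  case (1 k j)
  then show ?case by simp
next
  case (2 k j l b r)
  let ?m = "mark_count k (inorder l)"
  obtain a0 a1 a2 a3 a4 where E: "enc (Node l b r) = RC [enc l, enc r, RN (fst b), RI (snd b), a0, a1, a2, a3, a4]"
    using enc.simps(2) by blast
  have c: "0 \<le> ?m" "?m \<le> int (size l)"
    using mark_count_bounds[of k "inorder l"] by simp_all
  have d: "mark_count k (inorder r) \<le> int (size r)"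
    using mark_count_bounds[of k "inorder r"] by simp
  consider "j < ?m" | "\<not> j < ?m" "snd b = k" "?m < j" | "j = ?m" "snd b = k" | "\<not> j < ?m" "snd b \<noteq> k"
    by linarith
  then show ?case
  proof cases
    case 1
    with 2 have "computes B R 8 [RI k, RI j, enc l] (RI (select k j l)) (200 * (height l + 1))"
      by simp
    note IH = computesD[OF this]
    show ?thesis using "2.prems"(1-3) 1 c d
      apply (intro select_computesI)
      apply (simp add: select_code_def E wp_simps)
      apply (rule wp_count_field[OF "2.prems"(4), where t = l and c = 4], simp, simp, simp, simp add: wp_simps)
      apply (auto simp: wp_simps if_eq_def intro!: IH)
      done
  next
    case a: 2
    with 2 have "computes B R 8 [RI k, RI (j - ?m - 1), enc r] (RI (select k (j - ?m - 1) r)) (200 * (height r + 1))"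
      "0 \<le> select k (j - ?m - 1) r" "select k (j - ?m - 1) r < int (size r)"
      using select_inorder[of "j - ?m - 1" k r] by simp_all
    note IH = computesD[OF this(1)] this(2-)
    have IH': "k = snd b \<Longrightarrow> (\<And>t. t \<le> 200 * (height r + 1) \<Longrightarrow> Q (RI (select (snd b) (j - mark_count (snd b) (inorder l) - 1) r)) t)
      \<Longrightarrow> wpc B R 8 [RI (snd b), RI (j - mark_count (snd b) (inorder l) - 1), enc r] Q" for Q
      using IH(1) by simp
    show ?thesis using "2.prems"(1-3) a c d IH(2,3)
      apply (intro select_computesI)
      apply (simp add: select_code_def E wp_simps)
      apply (rule wp_count_field[OF "2.prems"(4), where t = l and c = 4], simp, simp, simp, simp add: wp_simps)
      apply (auto simp: wp_simps if_eq_def intro!: IH(1) IH')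
      done
  next
    case 3
    show ?thesis using "2.prems"(1-3) 3 c d
      apply (intro select_computesI)
      apply (simp add: select_code_def E wp_simps)
      apply (rule wp_count_field[OF "2.prems"(4), where t = l and c = 4], simp, simp, simp, simp add: wp_simps)
      apply (auto simp: wp_simps if_eq_def)
      done
  next
    case 4
    with 2 have "computes B R 8 [RI k, RI (j - ?m), enc r] (RI (select k (j - ?m) r)) (200 * (height r + 1))"
      "0 \<le> select k (j - ?m) r" "select k (j - ?m) r < int (size r)"
      using select_inorder[of "j - ?m" k r] by simp_all
    note IH = computesD[OF this(1)] this(2-)
    show ?thesis using "2.prems"(1-3) 4 c d IH(2,3)
      apply (intro select_computesI)
      apply (simp add: select_code_def E wp_simps)
      apply (rule wp_count_field[OF "2.prems"(4), where t = l and c = 4], simp, simp, simp, simp add: wp_simps)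
      apply (auto simp: wp_simps if_eq_def intro!: IH(1))
      done
  qed
qed

end

section \<open>The algorithm\<close>

text \<open>Snapshots of array and subsequence; mark of the other elements; numbers of marked and
  unmarked elements read; a tree for the unmarked and one for the marked tails; cost; completion
  flag. The first of these trees starts as the whole subsequence and loses the displaced tails, so
  that reading an unmarked element needs no insertion.\<close>

datatype dp = DP "elem tree" "elem tree" int int int "elem tree" "elem tree" int int

text \<open>Array and subsequence; the mark still to be swept; the sorting; the published value; the
  age of the current snapshot and that of the snapshot behind the published value, both in updates;
  whether a round is active.\<close>

datatype st = St "elem tree" "elem tree" int dp int int int int

text \<open>The partner is re-marked by deletion and reinsertion at its position i. This restores
  the size of T, so j is still the right place for x.\<close>

definition conflict :: "int \<Rightarrow> real \<Rightarrow> int \<Rightarrow> int \<Rightarrow> elem tree \<Rightarrow> elem tree \<Rightarrow> elem tree \<times> elem tree" where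
  "conflict j x m q T U = (let i = select 0 q T
     in (ins j (x, m) (ins i (fst (get q U), m) (del i T)), del q U))"

text \<open>Since U increases, x fits into it as soon as it fits between its neighbours there, the
  elements number p - 1 and p.\<close>

definition place :: "int \<Rightarrow> real \<Rightarrow> int \<Rightarrow> elem tree \<Rightarrow> elem tree \<Rightarrow> elem tree \<times> elem tree" where
  "place j x m T U = (let p = prefix_count 0 j T in
     if 0 < p \<and> x < fst (get (p - 1) U) then conflict j x m (p - 1) T U
     else if p < int (size U) \<and> fst (get p U) < x then conflict j x m p T U
     else (ins j (x, 0) T, ins p (x, 0) U))"

definition refresh :: "int \<Rightarrow> elem tree \<Rightarrow> elem tree \<Rightarrow> elem tree \<times> elem tree" where
  "refresh old T U = (if 0 < mark_count old (inorder T) then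
       let i = select old 0 T in place i (fst (get i T)) (3 - old) (del i T) U
     else (T, U))"

text \<open>Patience sorting among the marked tails. A replacement reads one more element without a
  new tail, so \<open>cost\<close>, the elements read minus the tails, is the distance of the prefix
  read. Both tree operations use the index \<open>rq\<close> because the removed key is larger than
  s.\<close>

fun q_step :: "int \<Rightarrow> real \<Rightarrow> int \<Rightarrow> dp \<Rightarrow> dp" where
  "q_step lm s rq (DP ts us m k c v q cost dn) = (if rq < int (size q)
     then DP ts us m (k + 1) lm v (ins rq (s, 0) (del rq q)) (cost + 1) 0
     else DP ts us m (k + 1) lm v (ins rq (s, 0) q) cost 0)"

text \<open>The tail displaced by s is the smaller one of its successors in q and in v. Unread
  elements of v are not tails; the successor in v has been read iff its rank in \<open>us\<close> is
  below \<open>lm\<close>.\<close>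

fun s_step :: "int \<Rightarrow> real \<Rightarrow> dp \<Rightarrow> dp" where
  "s_step lm s (DP ts us m k c v q cost dn) = (let rq = rank s q; rv = rank s v in
     if rv < int (size v) \<and> rank (fst (get rv v)) us < lm \<and>
        \<not> (rq < int (size q) \<and> fst (get rq q) < fst (get rv v))
     then DP ts us m (k + 1) lm (del rv v) (ins rq (s, 0) q) (cost + 1) 0
     else q_step lm s rq (DP ts us m k c v q cost dn))"

fun next_step :: "int \<Rightarrow> dp \<Rightarrow> dp" where
  "next_step lm (DP ts us m k c v q cost dn) = (if k < mark_count m (inorder ts)
     then s_step lm (fst (get (k + lm) ts)) (DP ts us m k c v q cost dn)
     else DP ts us m k c v q cost 1)"

text \<open>Earlier elements of the increasing subsequence are smaller than its next one, so only a
  marked tail can be displaced by it. If no marked tail is larger, the whole run up to the next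
  marked element lies above all tails.\<close>

fun bump_step :: "int \<Rightarrow> dp \<Rightarrow> dp" where
  "bump_step lm (DP ts us m k c v q cost dn) =
    (if c < lm \<and> rank (fst (get c us)) q < int (size q)
     then DP ts us m k (c + 1) v (del (rank (fst (get c us)) q) q) (cost + 1) 0
     else next_step lm (DP ts us m k c v q cost dn))"

text \<open>The marked element number k has k marked ones in front of it, so the difference counts
  the unmarked ones; behind the last marked element the run extends to the end.\<close>

fun limit :: "dp \<Rightarrow> int" where
  "limit (DP ts us m k c v q cost dn) = (if k < mark_count m (inorder ts)
     then select m k ts - k else int (size us))"

fun dp_step :: "dp \<Rightarrow> dp" where
  "dp_step (DP ts us m k c v q cost dn) = (if 0 < dn then DP ts us m k c v q cost dn
     else bump_step (limit (DP ts us m k c v q cost dn)) (DP ts us m k c v q cost dn))"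

fun work :: "st \<Rightarrow> st" where
  "work (St T U par d est ages agee act) =
     (let p = refresh par T U in St (fst p) (snd p) par (dp_step d) est ages agee act)"

text \<open>The published value now belongs to the snapshot of the round that just ended, whose age
  is \<open>ages\<close>.\<close>

fun publish :: "st \<Rightarrow> st" where
  "publish (St T U par (DP ts us m k c v q cost dn) est ages agee act) =
     (if 0 < dn \<and> \<not> 0 < mark_count par (inorder T)
      then St T U par (DP ts us m k c v q cost dn) cost ages ages 0
      else St T U par (DP ts us m k c v q cost dn) est ages agee act)"

text \<open>Called after the update has been applied to the trees. When a round starts, no element
  carries \<open>par\<close> any more; swapping the marks therefore turns all marked elements of the
  snapshot, a newly inserted one included, into those to be swept.\<close>

fun begin_update :: "st \<Rightarrow> st" where
  "begin_update (St T U par d est ages agee act) =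
     (if 0 < act then St T U par d est (ages + 1) (agee + 1) 1
      else St T U (3 - par) (DP T U (3 - par) 0 0 U Leaf 0 0) est 0 (agee + 1) 1)"

definition finish_update :: "int \<Rightarrow> st \<Rightarrow> st" where
  "finish_update n s = publish ((work ^^ nat n) (begin_update s))"

fun insert_update :: "int \<Rightarrow> int \<Rightarrow> real \<Rightarrow> st \<Rightarrow> st" where
  "insert_update n i x (St T U par d est ages agee act) =
     (let p = place (i - 1) x (3 - par) T U
      in finish_update n (St (fst p) (snd p) par d est ages agee act))"

text \<open>The deleted element is unmarked iff the prefix count jumps at it, and the smaller count
  is then its index in U.\<close>

fun delete_update :: "int \<Rightarrow> int \<Rightarrow> st \<Rightarrow> st" where
  "delete_update n i (St T U par d est ages agee act) =
     (let p = prefix_count 0 (i - 1) T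
      in finish_update n (St (del (i - 1) T) (if p < prefix_count 0 i T then del p U else U)
           par d est ages agee act))"

text \<open>A completed round on the empty array, so that the first update starts a new one.\<close>

definition initial_st :: st where
  "initial_st = St Leaf Leaf 1 (DP Leaf Leaf 1 0 0 Leaf Leaf 0 1) 0 0 0 0"

subsection \<open>Code\<close>

fun enc_pair :: "elem tree \<times> elem tree \<Rightarrow> rval" where
  "enc_pair (a, b) = RC [enc a, enc b, RI 0, RI 0, RI 0, RI 0, RI 0, RI 0, RI 0]"

fun enc_dp :: "dp \<Rightarrow> rval" where
  "enc_dp (DP ts us m k c v q cost dn) =
     RC [enc ts, enc us, RI m, RI k, RI c, enc v, enc q, RI cost, RI dn]"

fun enc_st :: "st \<Rightarrow> rval" where
  "enc_st (St T U par d est ages agee act) =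
     RC [enc T, enc U, RI par, enc_dp d, RI est, RI ages, RI agee, RI act, RI 0]"

abbreviation pair_code :: "rexpr \<Rightarrow> rexpr \<Rightarrow> rexpr" where
  "pair_code a b \<equiv> Rec [a, b, K 0, K 0, K 0, K 0, K 0, K 0, K 0]"

text \<open>The comment above each procedure body lists its arguments, the de Bruijn indices 0, 1, \<open>\<dots>\<close>
  on entry; \<open>s\<close> and \<open>d\<close> are states of the algorithm and of the incremental sorting.\<close>

(* j x m q T U *)
definition conflict_code :: rexpr where
  "conflict_code = Let (App 8 [K 0, V 3, V 4])
     (pair_code (App 2 [V 1, V 2, V 3, App 2 [V 0, App 4 [V 4, V 6], V 3, App 3 [V 0, V 5]]])
        (App 3 [V 4, V 6]))"

(* j x m T U *)
definition place_code :: rexpr where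
  "place_code = Let (App 7 [K 0, V 0, V 3])
     (Less (K 0) (V 0)
       (Less (V 2) (App 4 [Sub (V 0) (K 1), V 5])
         (App 9 [V 1, V 2, V 3, Sub (V 0) (K 1), V 4, V 5])
         (App 11 [V 0, V 1, V 2, V 3, V 4, V 5]))
       (App 11 [V 0, V 1, V 2, V 3, V 4, V 5]))"

(* p j x m T U *)
definition place_right_code :: rexpr where
  "place_right_code = Less (V 0) (FldZ 4 (V 5))
     (Less (App 4 [V 0, V 5]) (V 2) (App 9 [V 1, V 2, V 3, V 0, V 4, V 5])
        (pair_code (App 2 [V 1, V 2, K 0, V 4]) (App 2 [V 0, V 2, K 0, V 5])))
     (pair_code (App 2 [V 1, V 2, K 0, V 4]) (App 2 [V 0, V 2, K 0, V 5]))"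

(* old T U *)
definition refresh_code :: rexpr where
  "refresh_code = Less (K 0) (count_field (V 0) (V 1))
     (Let (App 8 [V 0, K 0, V 1])
       (App 10 [V 0, App 4 [V 0, V 2], Sub (K 3) (V 1), App 3 [V 0, V 2], V 3]))
     (pair_code (V 1) (V 2))"

(* d *)
definition dp_step_code :: rexpr where
  "dp_step_code = Less (K 0) (Fld 8 (V 0)) (V 0)
     (Let (Fld 2 (V 0))
       (App 14 [Less (Fld 3 (V 1)) (count_field (V 0) (Fld 0 (V 1)))
           (Sub (App 8 [V 0, Fld 3 (V 1), Fld 0 (V 1)]) (Fld 3 (V 1)))
           (FldZ 4 (Fld 1 (V 1))), V 1]))"

(* lim d *)
definition bump_step_code :: rexpr where
  "bump_step_code = Less (Fld 4 (V 1)) (V 0)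
     (Let (App 6 [App 4 [Fld 4 (V 1), Fld 1 (V 1)], Fld 6 (V 1)])
       (Less (V 0) (FldZ 4 (Fld 6 (V 2)))
         (Rec [Fld 0 (V 2), Fld 1 (V 2), Fld 2 (V 2), Fld 3 (V 2), Add (Fld 4 (V 2)) (K 1),
            Fld 5 (V 2), App 3 [V 0, Fld 6 (V 2)], Add (Fld 7 (V 2)) (K 1), K 0])
         (App 15 [V 1, V 2])))
     (App 15 [V 0, V 1])"

(* lim d *)
definition next_step_code :: rexpr where
  "next_step_code = Let (Fld 2 (V 1))
     (Less (Fld 3 (V 2)) (count_field (V 0) (Fld 0 (V 2)))
       (App 16 [V 1, App 4 [Add (Fld 3 (V 2)) (V 1), Fld 0 (V 2)], V 2])
       (Rec [Fld 0 (V 2), Fld 1 (V 2), Fld 2 (V 2), Fld 3 (V 2), Fld 4 (V 2),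
          Fld 5 (V 2), Fld 6 (V 2), Fld 7 (V 2), K 1]))"

(* lim s d *)
definition s_step_code :: rexpr where
  "s_step_code = Let (App 6 [V 1, Fld 6 (V 2)]) (Let (App 6 [V 2, Fld 5 (V 3)])
     (Less (V 0) (FldZ 4 (Fld 5 (V 4)))
       (Less (App 6 [App 4 [V 0, Fld 5 (V 4)], Fld 1 (V 4)]) (V 2)
         (Less (V 1) (FldZ 4 (Fld 6 (V 4)))
           (Less (App 4 [V 1, Fld 6 (V 4)]) (App 4 [V 0, Fld 5 (V 4)])
             (App 17 [V 2, V 3, V 1, V 4])
             (App 18 [V 2, V 3, V 1, V 0, V 4]))
           (App 18 [V 2, V 3, V 1, V 0, V 4]))
         (App 17 [V 2, V 3, V 1, V 4]))
       (App 17 [V 2, V 3, V 1, V 4])))"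

(* lim s rq d *)
definition q_step_code :: rexpr where
  "q_step_code = Less (V 2) (FldZ 4 (Fld 6 (V 3)))
     (Rec [Fld 0 (V 3), Fld 1 (V 3), Fld 2 (V 3), Add (Fld 3 (V 3)) (K 1), V 0, Fld 5 (V 3),
        App 2 [V 2, V 1, K 0, App 3 [V 2, Fld 6 (V 3)]], Add (Fld 7 (V 3)) (K 1), K 0])
     (Rec [Fld 0 (V 3), Fld 1 (V 3), Fld 2 (V 3), Add (Fld 3 (V 3)) (K 1), V 0, Fld 5 (V 3),
        App 2 [V 2, V 1, K 0, Fld 6 (V 3)], Fld 7 (V 3), K 0])"

(* lim s rq rv d *)
definition v_step_code :: rexpr where
  "v_step_code = Rec [Fld 0 (V 4), Fld 1 (V 4), Fld 2 (V 4), Add (Fld 3 (V 4)) (K 1), V 0,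
     App 3 [V 3, Fld 5 (V 4)], App 2 [V 2, V 1, K 0, Fld 6 (V 4)], Add (Fld 7 (V 4)) (K 1), K 0]"

(* s *)
definition work_code :: rexpr where
  "work_code = Let (App 12 [Fld 2 (V 0), Fld 0 (V 0), Fld 1 (V 0)])
     (Rec [Fld 0 (V 0), Fld 1 (V 0), Fld 2 (V 1), App 13 [Fld 3 (V 1)], Fld 4 (V 1), Fld 5 (V 1),
        Fld 6 (V 1), Fld 7 (V 1), K 0])"

(* n s *)
definition loop_code :: rexpr where
  "loop_code = Less (K 0) (V 0) (App 20 [Sub (V 0) (K 1), App 19 [V 1]]) (V 1)"

(* s *)
definition publish_code :: rexpr where
  "publish_code = Less (K 0) (Fld 8 (Fld 3 (V 0)))
     (Let (Fld 2 (V 0))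
       (Less (K 0) (count_field (V 0) (Fld 0 (V 1))) (V 1)
         (Rec [Fld 0 (V 1), Fld 1 (V 1), Fld 2 (V 1), Fld 3 (V 1), Fld 7 (Fld 3 (V 1)), Fld 5 (V 1),
            Fld 5 (V 1), K 0, K 0])))
     (V 0)"

(* n s *)
definition finish_code :: rexpr where
  "finish_code = Let (Less (K 0) (Fld 7 (V 1))
       (Rec [Fld 0 (V 1), Fld 1 (V 1), Fld 2 (V 1), Fld 3 (V 1), Fld 4 (V 1), Add (Fld 5 (V 1)) (K 1),
          Add (Fld 6 (V 1)) (K 1), K 1, K 0])
       (Rec [Fld 0 (V 1), Fld 1 (V 1), Sub (K 3) (Fld 2 (V 1)),
          Rec [Fld 0 (V 1), Fld 1 (V 1), Sub (K 3) (Fld 2 (V 1)), K 0, K 0, Fld 1 (V 1), K 0, K 0, K 0],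
          Fld 4 (V 1), K 0, Add (Fld 6 (V 1)) (K 1), K 1, K 0]))
     (App 21 [App 20 [V 1, V 0]])"

abbreviation initial_code :: rexpr where
  "initial_code \<equiv> Rec [K 0, K 0, K 1, Rec [K 0, K 0, K 1, K 0, K 0, K 0, K 0, K 0, K 1],
     K 0, K 0, K 0, K 0, K 0]"

(* n i x s *)
definition insert_code :: rexpr where
  "insert_code = Let (IfNil (V 3) initial_code (V 3))
     (Let (App 10 [Sub (V 2) (K 1), V 3, Sub (K 3) (Fld 2 (V 0)), Fld 0 (V 0), Fld 1 (V 0)])
       (App 22 [V 2, Rec [Fld 0 (V 0), Fld 1 (V 0), Fld 2 (V 1), Fld 3 (V 1), Fld 4 (V 1), Fld 5 (V 1),
          Fld 6 (V 1), Fld 7 (V 1), K 0]]))"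

(* n i s *)
definition delete_code :: rexpr where
  "delete_code = Let (IfNil (V 2) initial_code (V 2))
     (Let (App 7 [K 0, Sub (V 2) (K 1), Fld 0 (V 0)])
       (App 22 [V 2, Rec [App 3 [Sub (V 3) (K 1), Fld 0 (V 1)],
          Less (V 0) (App 7 [K 0, V 3, Fld 0 (V 1)]) (App 3 [V 0, Fld 1 (V 1)]) (Fld 1 (V 1)),
          Fld 2 (V 1), Fld 3 (V 1), Fld 4 (V 1), Fld 5 (V 1), Fld 6 (V 1), Fld 7 (V 1), K 0]]))"

definition alg_code :: "rexpr list" where
  "alg_code = tree_code @ [conflict_code, place_code, place_right_code, refresh_code, dp_step_code,
     bump_step_code, next_step_code, s_step_code, q_step_code, v_step_code, work_code, loop_code,
     publish_code, finish_code, insert_code, delete_code]"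

lemma alg_code_nth:
  "alg_code ! 9 = conflict_code" "alg_code ! 10 = place_code" "alg_code ! 11 = place_right_code"
  "alg_code ! 12 = refresh_code" "alg_code ! 13 = dp_step_code" "alg_code ! 14 = bump_step_code"
  "alg_code ! 15 = next_step_code" "alg_code ! 16 = s_step_code" "alg_code ! 17 = q_step_code"
  "alg_code ! 18 = v_step_code" "alg_code ! 19 = work_code" "alg_code ! 20 = loop_code"
  "alg_code ! 21 = publish_code" "alg_code ! 22 = finish_code" "alg_code ! 23 = insert_code"
  "alg_code ! 24 = delete_code" "length alg_code = 25"
  by (simp_all add: alg_code_def tree_code_def)

lemma tree_code_prefix: "take 9 alg_code = tree_code"
  by (simp add: alg_code_def tree_code_def)

text \<open>The zero in the root cell of the initial memory stands for the initial state; both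
  update procedures replace it when they meet it.\<close>

definition represents :: "rval \<Rightarrow> st \<Rightarrow> bool" where
  "represents r s \<longleftrightarrow> r = enc_st s \<or> (r = RI 0 \<and> s = initial_st)"

section \<open>Correctness and cost of the update procedures\<close>

locale bounded_machine =
  fixes B :: int and X \<tau> :: nat
  assumes XB: "int X + 20 \<le> B"
    and height_bound: "avl t \<Longrightarrow> size t \<le> X \<Longrightarrow> height (t :: elem tree) + 1 \<le> \<tau>"
begin

sublocale machine B alg_code
  by unfold_locales (rule tree_code_prefix)

lemma tau_pos: "1 \<le> \<tau>"
  using height_bound[of Leaf] by simp

text \<open>X bounds the sizes of all trees in play and \<tau> their heights plus one. Where an
  element is inserted, a strict bound on the size leaves the room for it.\<close>

definition small :: "elem tree \<Rightarrow> bool" where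
  "small t \<longleftrightarrow> avl t \<and> size t \<le> X"

lemma small_ins: "small t \<Longrightarrow> size t < X \<Longrightarrow> small (ins i a t)"
  using avl_ins[of t i a] by (simp add: small_def)

lemma small_del: "small t \<Longrightarrow> 0 \<le> i \<Longrightarrow> i < int (size t) \<Longrightarrow> small (del i t)"
  using avl_del[of t i] size_del[of i t] by (auto simp: small_def)

lemma computes_mono: "computes B' R f vs v T \<Longrightarrow> T \<le> T' \<Longrightarrow> computes B' R f vs v T'"
  unfolding computes_def wpc_def wp_def by (meson order_trans)

lemma scale: "small t \<Longrightarrow> c * (height t + 1) \<le> c * \<tau>"
  using height_bound[of t] by (intro mult_le_mono2) (simp add: small_def)

lemma small_B: "small t \<Longrightarrow> int (size t) + 20 \<le> B"
  using XB by (simp add: small_def)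

lemma ins_small:
  "small t \<Longrightarrow> 0 \<le> i \<Longrightarrow> i \<le> int (size t) \<Longrightarrow>
    computes B alg_code 2 [RI i, RN x, RI m, enc t] (enc (ins i (x, m) t)) (1700 * \<tau>)"
  using small_B[of t] by (intro computes_mono[OF ins_computes scale]) auto

lemma del_small:
  "small t \<Longrightarrow> 0 \<le> i \<Longrightarrow> i < int (size t) \<Longrightarrow>
    computes B alg_code 3 [RI i, enc t] (enc (del i t)) (2200 * \<tau>)"
  using small_B[of t] by (intro computes_mono[OF del_computes scale]) auto

lemma getx_small:
  "small t \<Longrightarrow> 0 \<le> i \<Longrightarrow> i < int (size t) \<Longrightarrow>
    computes B alg_code 4 [RI i, enc t] (RN (fst (get i t))) (100 * \<tau>)"
  using small_B[of t] by (intro computes_mono[OF getx_computes scale]) auto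

lemma rank_small:
  "small t \<Longrightarrow> computes B alg_code 6 [RN v, enc t] (RI (rank v t)) (100 * \<tau>)"
  using small_B[of t] rank_computes by (intro computes_mono[OF conjunct1[OF rank_computes] scale]) auto

lemma prefix_count_small:
  "small t \<Longrightarrow> 0 \<le> i \<Longrightarrow> i \<le> int (size t) \<Longrightarrow> k = 0 \<or> k = 1 \<or> k = 2 \<Longrightarrow>
    computes B alg_code 7 [RI k, RI i, enc t] (RI (prefix_count k i t)) (200 * \<tau>)"
  using small_B[of t] by (intro computes_mono[OF prefix_count_computes scale]) auto

lemma select_small:
  "small t \<Longrightarrow> 0 \<le> j \<Longrightarrow> j < mark_count k (inorder t) \<Longrightarrow> k = 0 \<or> k = 1 \<or> k = 2 \<Longrightarrow>
    computes B alg_code 8 [RI k, RI j, enc t] (RI (select k j t)) (200 * \<tau>)"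
  using small_B[of t] by (intro computes_mono[OF select_computes scale]) auto

lemma start:
  "wp B alg_code (alg_code ! i) vs (\<lambda>w t. w = v \<and> t \<le> T) \<Longrightarrow> i < 25 \<Longrightarrow> computes B alg_code i vs v T"
  unfolding computes_def wpc_def by (simp add: alg_code_nth)

lemmas starts = start[where i = 9] start[where i = 10] start[where i = 11] start[where i = 12] start[where i = 13]
  start[where i = 14] start[where i = 15] start[where i = 16] start[where i = 17] start[where i = 18]
  start[where i = 19] start[where i = 20] start[where i = 21] start[where i = 22] start[where i = 23]
  start[where i = 24]

lemmas alg_start = starts[unfolded alg_code_nth, simplified]

lemma twenty_le_B: "20 \<le> B"
  using XB by simp

lemma conflict_computes:
  assumes "small T" "small U" "size T < X" "0 \<le> j" "j \<le> int (size T)" "0 \<le> q" "q < int (size U)"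
    "mark_count 0 (inorder T) = int (size U)"
  shows "computes B alg_code 9 [RI j, RN x, RI m, RI q, enc T, enc U] (enc_pair (conflict j x m q T U)) (9000 * \<tau>)"
proof -
  define i where "i = select 0 q T"
  have i: "0 \<le> i" "i < int (size T)" using select_inorder[of q 0 T] assms unfolding i_def by auto
  let ?T1 = "del i T"
  have T1: "small ?T1" "size ?T1 = size T - 1" "size ?T1 < X"
    using i assms small_del[of T i] size_del[of i T] by auto
  let ?T2 = "ins i (fst (get q U), m) ?T1"
  have T2: "small ?T2" "size ?T2 = size T"
    using T1 i small_ins[of ?T1] by auto
  have c: "conflict j x m q T U = (ins j (x, m) ?T2, del q U)"
    unfolding conflict_def i_def by (simp add: Let_def)
  show ?thesis
    unfolding c
    apply (rule alg_start)
    apply (simp add: conflict_code_def wp_simps)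
    apply (intro conjI)
    subgoal using twenty_le_B by simp
    apply (rule computesD[OF select_small[of T q 0, folded i_def]])
    using assms apply (simp_all)[4]
    apply (rule computesD[OF getx_small[of U q]])
    using assms apply (simp_all)[3]
    apply (rule computesD[OF del_small[of T i]])
    using assms i apply (simp_all)[3]
    apply (rule computesD[OF ins_small[of ?T1 i "fst (get q U)" m]])
    using assms i T1 apply (simp_all)[3]
    apply (rule computesD[OF ins_small[of ?T2 j x m]])
    using assms i T2 apply (simp_all)[3]
    apply (rule computesD[OF del_small[of U q]])
    using assms apply (simp_all)[3]
    using tau_pos twenty_le_B by simp
qed

lemma place_right_computes:
  assumes "small T" "small U" "size T < X" "size U < X" "0 \<le> j" "j \<le> int (size T)" "0 \<le> p" "p \<le> int (size U)"
    "mark_count 0 (inorder T) = int (size U)"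
  shows "computes B alg_code 11 [RI p, RI j, RN x, RI m, enc T, enc U]
    (enc_pair (if p < int (size U) \<and> fst (get p U) < x then conflict j x m p T U
     else (ins j (x, 0) T, ins p (x, 0) U))) (13000 * \<tau>)"
  using assms tau_pos twenty_le_B
  apply (intro alg_start)
  apply (simp add: place_right_code_def wp_simps)
  apply (auto intro!: computesD[OF getx_small[of U p]] computesD[OF conflict_computes] computesD[OF ins_small]
    simp: wp_simps)
  done

lemma place_computes:
  assumes "small T" "small U" "size T < X" "size U < X" "0 \<le> j" "j \<le> int (size T)"
    "mark_count 0 (inorder T) = int (size U)"
  shows "computes B alg_code 10 [RI j, RN x, RI m, enc T, enc U] (enc_pair (place j x m T U)) (14000 * \<tau>)"
proof -
  define p where "p = prefix_count 0 j T"
  have "int (length (filter (\<lambda>e. snd e = 0) (take (nat j) (inorder T)))) \<le> int (length (filter (\<lambda>e. snd e = 0) (inorder T)))"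
    by (metis append_take_drop_id filter_append le_add1 length_append of_nat_mono)
  then have p: "0 \<le> p" "p \<le> int (size U)"
    using assms(5-7) by (simp_all add: p_def prefix_count_inorder mark_count_def)
  define r where "r = (if p < int (size U) \<and> fst (get p U) < x then conflict j x m p T U
     else (ins j (x, 0) T, ins p (x, 0) U))"
  have c: "place j x m T U = (if 0 < p \<and> x < fst (get (p - 1) U) then conflict j x m (p - 1) T U else r)"
    by (simp add: place_def p_def r_def Let_def)
  have B: "\<bar>p - 1\<bar> \<le> B" using p XB assms(4) by simp
  have R: "computes B alg_code 11 [RI p, RI j, RN x, RI m, enc T, enc U] (enc_pair r) (13000 * \<tau>)"
    unfolding r_def by (rule place_right_computes) (use assms p in auto)
  consider "0 < p" "x < fst (get (p - 1) U)" | "0 < p" "\<not> x < fst (get (p - 1) U)" | "\<not> 0 < p" by blast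
  then show ?thesis
  proof cases
    case 1
    then have *: "place j x m T U = conflict j x m (p - 1) T U" using c by auto
    show ?thesis
      unfolding *
      using assms tau_pos twenty_le_B p B 1
      apply (intro alg_start)
      apply (simp add: place_code_def wp_simps)
      apply (rule computesD[OF prefix_count_small, of T j 0, folded p_def], simp, simp, simp, simp)
      apply (simp add: wp_simps)
      apply (rule computesD[OF getx_small], simp, simp, simp)
      apply (simp add: wp_simps)
      apply (rule computesD[OF conflict_computes], simp_all)
      done
  next
    case 2
    then have *: "place j x m T U = r" using c by auto
    show ?thesis
      unfolding *
      using assms tau_pos twenty_le_B p B 2
      apply (intro alg_start)
      apply (simp add: place_code_def wp_simps)
      apply (rule computesD[OF prefix_count_small, of T j 0, folded p_def], simp, simp, simp, simp)
      apply (simp add: wp_simps)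
      apply (rule computesD[OF getx_small], simp, simp, simp)
      apply (simp add: wp_simps)
      apply (rule computesD[OF R], simp)
      done
  next
    case 3
    then have p0: "p = 0" using p by simp
    from 3 have *: "place j x m T U = r" using c by auto
    show ?thesis
      unfolding *
      using assms tau_pos twenty_le_B p B 3
      apply (intro alg_start)
      apply (simp add: place_code_def wp_simps)
      apply (rule computesD[OF prefix_count_small, of T j 0, folded p_def], simp, simp, simp, simp)
      apply (simp add: wp_simps)
      apply (rule computesD[OF R[unfolded p0]], simp)
      done
  qed
qed

lemma refresh_computes:
  assumes "small T" "small U" "size U < X" "old = 1 \<or> old = 2"
    "mark_count 0 (inorder T) = int (size U)"
  shows "computes B alg_code 12 [RI old, enc T, enc U] (enc_pair (refresh old T U)) (17000 * \<tau>)"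
proof (cases "0 < mark_count old (inorder T)")
  case True
  define i where "i = select old 0 T"
  have i: "0 \<le> i" "i < int (size T)" "snd (inorder T ! nat i) = old"
    using select_inorder[of 0 old T] assms True unfolding i_def by auto
  let ?T1 = "del i T"
  have T1: "small ?T1" "int (size ?T1) = int (size T) - 1" "size ?T1 < X"
    using i assms small_del[of T i] size_del[of i T] by (auto simp: small_def)
  have m: "mark_count 0 (inorder ?T1) = int (size U)"
  proof -
    have "inorder T = take (nat i) (inorder T) @ inorder T ! nat i # drop (Suc (nat i)) (inorder T)"
      using i by (intro id_take_nth_drop) simp
    then have "mark_count 0 (inorder T) = mark_count 0 (inorder ?T1)"
      using i assms(4) unfolding inorder_del[OF i(1,2)] by (smt (verit) mark_count_simps(2,3))
    then show ?thesis using assms by simp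
  qed
  have c: "refresh old T U = place i (fst (get i T)) (3 - old) ?T1 U"
    unfolding refresh_def i_def using True by (simp add: Let_def)
  have old: "old = 0 \<or> old = 1 \<or> old = 2" "\<bar>3 - old\<bar> \<le> B" using assms(4) XB by auto
  show ?thesis
    unfolding c
    using assms(1-3) tau_pos twenty_le_B old(2) i(1,2) T1 m
    apply (intro alg_start)
    apply (simp add: refresh_code_def wp_simps)
    apply (rule wp_count_field[OF old(1), where t = T and c = 1], simp, simp, simp, simp add: wp_simps)
    apply (simp add: True wp_simps)
    apply (rule computesD[OF select_small[OF assms(1) _ True old(1), folded i_def]], simp)
    apply (rule computesD[OF getx_small], simp, simp, simp)
    apply (rule computesD[OF del_small], simp, simp, simp)
    apply (rule computesD[OF place_computes], simp_all)
    done
next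
  case False
  have old: "old = 0 \<or> old = 1 \<or> old = 2" using assms(4) by auto
  show ?thesis
    using tau_pos twenty_le_B False
    apply (intro alg_start)
    apply (simp add: refresh_code_def wp_simps)
    apply (rule wp_count_field[OF old(1), where t = T and c = 1], simp, simp, simp, simp add: wp_simps)
    apply (simp add: wp_simps refresh_def)
    done
qed

lemma q_step_computes:
  assumes "d = DP ts us m k c v q cost dn" "small q" "size q < X" "0 \<le> rq" "rq \<le> int (size q)"
    "\<bar>k + 1\<bar> \<le> B" "\<bar>cost + 1\<bar> \<le> B"
  shows "computes B alg_code 17 [RI w, RN s, RI rq, enc_dp d] (enc_dp (q_step w s rq d)) (6000 * \<tau>)"
  using assms tau_pos twenty_le_B small_del[of q rq] size_del[of rq q]
  apply (intro alg_start)
  apply (simp add: q_step_code_def wp_simps)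
  apply (auto intro!: computesD[OF del_small] computesD[OF ins_small] simp: wp_simps)
  done

lemma v_step_computes:
  assumes "d = DP ts us m k c v q cost dn" "small q" "small v" "size q < X" "0 \<le> rq" "rq \<le> int (size q)"
    "\<bar>k + 1\<bar> \<le> B" "\<bar>cost + 1\<bar> \<le> B" "0 \<le> rv" "rv < int (size v)"
  shows "computes B alg_code 18 [RI w, RN s, RI rq, RI rv, enc_dp d]
    (enc_dp (DP ts us m (k + 1) w (del rv v) (ins rq (s, 0) q) (cost + 1) 0)) (6000 * \<tau>)"
  using assms tau_pos twenty_le_B
  apply (intro alg_start)
  apply (simp add: v_step_code_def wp_simps)
  apply (auto intro!: computesD[OF del_small] computesD[OF ins_small] simp: wp_simps)
  done

lemma s_step_computes:
  assumes "d = DP ts us m k c v q cost dn" "small q" "small v" "small us" "size q < X"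
    "\<bar>k + 1\<bar> \<le> B" "\<bar>cost + 1\<bar> \<le> B"
  shows "computes B alg_code 16 [RI w, RN s, enc_dp d] (enc_dp (s_step w s d)) (8000 * \<tau>)"
  using assms tau_pos twenty_le_B rank_bounds[of s q] rank_bounds[of s v]
  apply (intro alg_start)
  apply (simp add: s_step_code_def wp_simps)
  apply (rule computesD[OF rank_small], simp)
  apply (rule computesD[OF rank_small], simp)
  apply (auto intro!: computesD[OF rank_small] computesD[OF getx_small] computesD[OF v_step_computes[OF refl, unfolded enc_dp.simps]] computesD[OF q_step_computes[OF refl, unfolded enc_dp.simps]]
    simp: wp_simps Let_def simp del: q_step.simps)
  done

lemma next_step_computes:
  assumes "d = DP ts us m k c v q cost dn" "small ts" "small q" "small v" "small us" "size q < X"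
    "\<bar>k + 1\<bar> \<le> B" "\<bar>cost + 1\<bar> \<le> B" "m = 1 \<or> m = 2" "0 \<le> k + w" "k < mark_count m (inorder ts) \<Longrightarrow> k + w < int (size ts)"
  shows "computes B alg_code 15 [RI w, enc_dp d] (enc_dp (next_step w d)) (9000 * \<tau>)"
proof -
  have m: "m = 0 \<or> m = 1 \<or> m = 2" using assms(9) by auto
  have B: "\<bar>k + w\<bar> \<le> B" if "k < mark_count m (inorder ts)"
    using assms(2,10,11) that XB by (auto simp: small_def)
  note S = computesD[OF s_step_computes[OF refl, unfolded enc_dp.simps]]
  define r where "r = next_step w d"
  show ?thesis
    unfolding r_def[symmetric]
    using assms(1-8,10,11) tau_pos twenty_le_B B
    apply (intro alg_start)
    apply (simp add: next_step_code_def wp_simps)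
    apply (rule wp_count_field[OF m, where t = ts and c = 4], simp, simp, simp, simp add: wp_simps)
    unfolding r_def
    apply (auto intro!: S computesD[OF getx_small] simp: wp_simps simp del: s_step.simps)
    done
qed

lemma bump_step_computes:
  assumes "d = DP ts us m k c v q cost dn" "small ts" "small q" "small v" "small us" "size q < X"
    "\<bar>k + 1\<bar> \<le> B" "\<bar>cost + 1\<bar> \<le> B" "m = 1 \<or> m = 2" "0 \<le> k + w" "k < mark_count m (inorder ts) \<Longrightarrow> k + w < int (size ts)"
    "0 \<le> c" "w \<le> int (size us)"
  shows "computes B alg_code 14 [RI w, enc_dp d] (enc_dp (bump_step w d)) (12000 * \<tau>)"
proof -
  note S = computesD[OF next_step_computes[OF refl, unfolded enc_dp.simps]]
  have B: "\<bar>c + 1\<bar> \<le> B" if "c < w"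
    using assms(5,12,13) that XB by (auto simp: small_def)
  note r = rank_bounds[of "fst (get c us)" q]
  define r where "r = bump_step w d"
  show ?thesis
    unfolding r_def[symmetric]
    using assms tau_pos twenty_le_B B r
    apply (intro alg_start)
    apply (simp add: bump_step_code_def wp_simps)
    unfolding r_def
    apply (auto intro!: S computesD[OF getx_small] computesD[OF rank_small] computesD[OF del_small]
      simp: wp_simps simp del: next_step.simps)
    done
qed

lemma dp_step_computes:
  assumes "d = DP ts us m k c v q cost dn" "small ts" "small q" "small v" "small us" "size q < X"
    "\<bar>cost + 1\<bar> \<le> B" "m = 1 \<or> m = 2" "0 \<le> k" "k \<le> mark_count m (inorder ts)" "0 \<le> c"
    "limit d \<le> int (size us)"
  shows "computes B alg_code 13 [enc_dp d] (enc_dp (dp_step d)) (13000 * \<tau>)"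
proof -
  have m: "m = 0 \<or> m = 1 \<or> m = 2" using assms(8) by auto
  note S = computesD[OF bump_step_computes[OF refl, unfolded enc_dp.simps]]
  define w where "w = limit d"
  have kB: "\<bar>k + 1\<bar> \<le> B"
    using assms(2,9,10) mark_count_bounds(2)[of m "inorder ts"] XB by (auto simp: small_def)
  have w: "0 \<le> k + w" "k < mark_count m (inorder ts) \<Longrightarrow> k + w < int (size ts)"
    "w \<le> int (size us)" "k < mark_count m (inorder ts) \<Longrightarrow> \<bar>w\<bar> \<le> B"
  proof -
    have "w = (if k < mark_count m (inorder ts) then select m k ts - k else int (size us))"
      using assms(1) by (simp add: w_def)
    moreover have "0 \<le> select m k ts \<and> select m k ts < int (size ts)" if "k < mark_count m (inorder ts)"
      using select_inorder[of k m ts] assms(9) that by auto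
    ultimately show "0 \<le> k + w" "k < mark_count m (inorder ts) \<Longrightarrow> k + w < int (size ts)"
      "w \<le> int (size us)" "k < mark_count m (inorder ts) \<Longrightarrow> \<bar>w\<bar> \<le> B"
      using assms kB XB by (auto simp: w_def small_def)
  qed
  define r where "r = dp_step d"
  have r: "r = (if 0 < dn then d else bump_step w d)" using assms(1) by (simp add: r_def w_def)
  show ?thesis
    unfolding r_def[symmetric]
  proof (cases "k < mark_count m (inorder ts)")
    case True
    then have w': "w = select m k ts - k" using assms(1) by (simp add: w_def)
    show "computes B alg_code 13 [enc_dp d] (enc_dp r) (13000 * \<tau>)"
      using assms(1-7,8-11) tau_pos twenty_le_B w kB True
      apply (intro alg_start)
      apply (simp add: dp_step_code_def wp_simps)
      apply (intro conjI impI)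
      apply (simp add: r)
      apply (rule wp_count_field[OF m, where t = ts and c = 4], simp, simp, simp, simp add: wp_simps)
      apply (simp add: wp_simps)
      apply (rule computesD[OF select_small[OF _ _ _ m]], simp, simp, simp)
      using w'
      apply (simp add: wp_simps)
      apply (rule S)
      unfolding r
      apply (simp_all del: bump_step.simps)
      done
  next
    case False
    then have w': "w = int (size us)" using assms(1) by (simp add: w_def)
    show "computes B alg_code 13 [enc_dp d] (enc_dp r) (13000 * \<tau>)"
      using assms(1-7,8-11) tau_pos twenty_le_B w kB False
      apply (intro alg_start)
      apply (simp add: dp_step_code_def wp_simps)
      apply (intro conjI impI)
      apply (simp add: r)
      apply (rule wp_count_field[OF m, where t = ts and c = 4], simp, simp, simp, simp add: wp_simps)
      apply (simp add: wp_simps)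
      using w'
      apply (simp add: wp_simps)
      apply (rule S)
      unfolding r
      apply (simp_all del: bump_step.simps)
      done
  qed
qed

text \<open>Balance, sizes and index ranges that keep the code from getting stuck, separated from
  the invariants that give its results a meaning.\<close>

fun runnable :: "st \<Rightarrow> bool" where
  "runnable (St T U par (DP ts us m k c v q cost dn) est ages agee act) \<longleftrightarrow>
     small T \<and> small U \<and> size U < X \<and> (par = 1 \<or> par = 2) \<and> mark_count 0 (inorder T) = int (size U) \<and>
     small ts \<and> small q \<and> small v \<and> small us \<and> size q < X \<and> \<bar>cost + 1\<bar> \<le> B \<and> (m = 1 \<or> m = 2) \<and>
     0 \<le> k \<and> k \<le> mark_count m (inorder ts) \<and> 0 \<le> c \<and> limit (DP ts us m k c v q cost dn) \<le> int (size us)"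

lemma work_computes:
  assumes "runnable s"
  shows "computes B alg_code 19 [enc_st s] (enc_st (work s)) (31000 * \<tau>)"
proof -
  obtain T U par d est ages agee act where s: "s = St T U par d est ages agee act" by (cases s)
  obtain ts us m k c v q cost dn where d: "d = DP ts us m k c v q cost dn" by (cases d)
  obtain T' U' where p: "refresh par T U = (T', U')" by (cases "refresh par T U")
  have R: "computes B alg_code 12 [RI par, enc T, enc U] (enc_pair (T', U')) (17000 * \<tau>)"
    unfolding p[symmetric] using assms unfolding s d by (intro refresh_computes) auto
  have D: "computes B alg_code 13 [enc_dp d] (enc_dp (dp_step d)) (13000 * \<tau>)"
    using assms unfolding s d by (intro dp_step_computes[OF refl]) auto
  show ?thesis
    unfolding s
    using tau_pos twenty_le_B
    apply (intro alg_start)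
    apply (simp add: work_code_def wp_simps p)
    apply (rule computesD[OF R])
    apply (simp add: wp_simps)
    apply (rule computesD[OF D])
    apply simp
    done
qed

lemma loop_computes:
  assumes "\<And>i. i < n \<Longrightarrow> runnable ((work ^^ i) s)" "int n \<le> B"
  shows "computes B alg_code 20 [RI (int n), enc_st s] (enc_st ((work ^^ n) s)) (32000 * \<tau> * (n + 1))"
  using assms
proof (induction n arbitrary: s)
  case 0
  then show ?case
    using tau_pos twenty_le_B
    apply (intro alg_start)
    apply (simp add: loop_code_def wp_simps)
    done
next
  case (Suc n)
  have "runnable s" using Suc.prems(1)[of 0] by simp
  note W = work_computes[OF this]
  have "runnable ((work ^^ i) (work s))" if "i < n" for i
    using Suc.prems(1)[of "Suc i"] that by (simp add: funpow_swap1)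
  then have IH: "computes B alg_code 20 [RI (int n), enc_st (work s)] (enc_st ((work ^^ n) (work s))) (32000 * \<tau> * (n + 1))"
    using Suc by auto
  have e: "(work ^^ Suc n) s = (work ^^ n) (work s)" by (simp add: funpow_swap1)
  show ?case
    unfolding e
    using tau_pos twenty_le_B Suc.prems(2)
    apply (intro alg_start)
    apply (simp add: loop_code_def wp_simps)
    apply (rule computesD[OF W])
    apply (rule computesD[OF IH])
    apply (simp add: algebra_simps)
    done
qed

lemma publish_computes:
  assumes "s = St T U par d est ages agee act" "par = 1 \<or> par = 2"
  shows "computes B alg_code 21 [enc_st s] (enc_st (publish s)) (500 * \<tau>)"
proof -
  obtain ts us m k c v q cost dn where d: "d = DP ts us m k c v q cost dn" by (cases d)
  have m: "par = 0 \<or> par = 1 \<or> par = 2" using assms(2) by auto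
  define res where "res = publish s"
  show ?thesis
    unfolding res_def[symmetric]
    using tau_pos twenty_le_B assms(1)[unfolded d]
    apply (intro alg_start)
    apply (simp add: publish_code_def wp_simps)
    apply (intro conjI impI)
    apply (rule wp_count_field[OF m, where t = T and c = 4], simp, simp, simp, simp add: wp_simps)
    apply (simp_all add: wp_simps res_def)
    done
qed

lemma work_par: "\<exists>T' U' d'. (work ^^ n) (St T U par d est ages agee act) = St T' U' par d' est ages agee act"
proof (induction n)
  case (Suc n)
  then show ?case by (auto simp: Let_def)
qed auto

lemma finish_computes:
  assumes "s = St T U par d est ages agee act" "par = 1 \<or> par = 2" "\<bar>ages + 1\<bar> \<le> B" "\<bar>agee + 1\<bar> \<le> B"
    "\<And>i. i < n \<Longrightarrow> runnable ((work ^^ i) (begin_update s))" "int n \<le> B"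
  shows "computes B alg_code 22 [RI (int n), enc_st s] (enc_st (finish_update (int n) s)) (35000 * \<tau> * (n + 1))"
proof -
  note L = loop_computes[OF assms(5,6)]
  obtain T' U' par' d' est' ages' agee' act' where b: "begin_update s = St T' U' par' d' est' ages' agee' act'"
    by (cases "begin_update s")
  have par': "par' = 1 \<or> par' = 2" using b assms(1,2) by (auto split: if_splits)
  obtain T'' U'' d'' where w: "(work ^^ n) (begin_update s) = St T'' U'' par' d'' est' ages' agee' act'"
    using work_par[of n T' U' par' d' est' ages' agee' act'] b by auto
  note P = publish_computes[OF w par']
  have f: "finish_update (int n) s = publish ((work ^^ n) (begin_update s))" by (simp add: finish_update_def)
  have L': "wpc B alg_code 20 [RI (int n), enc_st (begin_update s)] Q"
    if "\<And>t. t \<le> 32000 * \<tau> * (n + 1) \<Longrightarrow> Q (enc_st ((work ^^ n) (begin_update s))) t" for Q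
    using computesD[OF L] that by blast
  show ?thesis
  proof (cases "0 < act")
    case True
    then have be: "enc_st (begin_update s) = RC [enc T, enc U, RI par, enc_dp d, RI est, RI (ages + 1), RI (agee + 1), RI 1, RI 0]"
      using assms(1) by simp
    show ?thesis
      unfolding f
      using tau_pos twenty_le_B assms(1-4) True
      apply (intro alg_start)
      apply (simp add: finish_code_def wp_simps)
      apply (rule L'[unfolded be])
      apply (rule computesD[OF P])
      apply (simp add: algebra_simps)
      done
  next
    case False
    then have be: "enc_st (begin_update s) = RC [enc T, enc U, RI (3 - par), RC [enc T, enc U, RI (3 - par), RI 0, RI 0, enc U, RI 0, RI 0, RI 0],
        RI est, RI 0, RI (agee + 1), RI 1, RI 0]"
      using assms(1) by simp
    have "\<bar>3 - par\<bar> \<le> B" using assms(2) twenty_le_B by auto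
    then show ?thesis
      unfolding f
      using tau_pos twenty_le_B assms(1,3,4) False
      apply (intro alg_start)
      apply (simp add: finish_code_def wp_simps)
      apply (rule L'[unfolded be])
      apply (rule computesD[OF P])
      apply (simp add: algebra_simps)
      done
  qed
qed

lemma wp_initial:
  assumes "represents r s" "i < length env" "env ! i = r" "\<And>t. t \<le> 300 \<Longrightarrow> Q (enc_st s) t"
  shows "wp B alg_code (IfNil (V i) initial_code (V i)) env Q"
proof -
  obtain vs where vs: "enc_st s = RC vs" by (cases s) simp
  show ?thesis
    using assms twenty_le_B unfolding represents_def
    by (elim disjE; simp add: wp_simps vs; simp add: vs[symmetric] initial_st_def)
qed

lemma insert_computes:
  assumes "s = St T U par d est ages agee act" "represents r s" "par = 1 \<or> par = 2" "\<bar>ages + 1\<bar> \<le> B" "\<bar>agee + 1\<bar> \<le> B"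
    "small T" "small U" "size T < X" "size U < X" "1 \<le> i" "i \<le> int (size T) + 1"
    "mark_count 0 (inorder T) = int (size U)" "p = place (i - 1) x (3 - par) T U"
    "\<And>i. i < n \<Longrightarrow> runnable ((work ^^ i) (begin_update (St (fst p) (snd p) par d est ages agee act)))" "int n \<le> B"
  shows "computes B alg_code 23 [RI (int n), RI i, RN x, r] (enc_st (insert_update (int n) i x s)) (50000 * \<tau> * (n + 1))"
proof -
  have P: "computes B alg_code 10 [RI (i - 1), RN x, RI (3 - par), enc T, enc U] (enc_pair p) (14000 * \<tau>)"
    unfolding assms(13) by (rule place_computes) (use assms in auto)
  obtain T' U' where p: "p = (T', U')" by (cases p)
  \<comment> \<open>The product is abbreviated to keep the estimate of the total time
    linear.\<close>
  define N where "N = \<tau> * (n + 1)"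
  have N: "\<tau> \<le> N" "50000 * \<tau> * (n + 1) = 50000 * N" "35000 * \<tau> * (n + 1) = 35000 * N"
    by (simp_all add: N_def)
  note F = finish_computes[OF refl assms(3-5) assms(14,15), unfolded p N]
  have e: "insert_update (int n) i x s = finish_update (int n) (St T' U' par d est ages agee act)"
    using assms(1,13) p by (simp add: Let_def) (metis fst_conv snd_conv)
  have "\<bar>i - 1\<bar> \<le> B" "\<bar>3 - par\<bar> \<le> B" "enc_st s = RC [enc T, enc U, RI par, enc_dp d, RI est, RI ages, RI agee, RI act, RI 0]"
    using assms XB by (auto simp: small_def)
  then show ?thesis
    unfolding e N
    using tau_pos twenty_le_B N(1)
    apply (intro alg_start)
    apply (simp only: insert_code_def wp_Let)
    apply (rule wp_initial[OF assms(2)], simp, simp)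
    apply (simp add: wp_simps)
    apply (rule computesD[OF P])
    apply (simp add: wp_simps p)
    apply (rule computesD[OF F[unfolded fst_conv snd_conv enc_st.simps]])
    apply simp_all
    done
qed

lemma delete_computes:
  assumes "s = St T U par d est ages agee act" "represents r s" "par = 1 \<or> par = 2" "\<bar>ages + 1\<bar> \<le> B" "\<bar>agee + 1\<bar> \<le> B"
    "small T" "small U" "1 \<le> i" "i \<le> int (size T)"
    "mark_count 0 (inorder T) = int (size U)" "p = prefix_count 0 (i - 1) T"
    "U' = (if p < prefix_count 0 i T then del p U else U)"
    "\<And>i'. i' < n \<Longrightarrow> runnable ((work ^^ i') (begin_update (St (del (i - 1) T) U' par d est ages agee act)))" "int n \<le> B"
  shows "computes B alg_code 24 [RI (int n), RI i, r] (enc_st (delete_update (int n) i s)) (50000 * \<tau> * (n + 1))"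
proof -
  define N where "N = \<tau> * (n + 1)"
  have N: "\<tau> \<le> N" "50000 * \<tau> * (n + 1) = 50000 * N" "35000 * \<tau> * (n + 1) = 35000 * N"
    by (simp_all add: N_def)
  note F = finish_computes[OF refl assms(3-5) assms(13,14), unfolded N]
  have e: "delete_update (int n) i s = finish_update (int n) (St (del (i - 1) T) U' par d est ages agee act)"
    using assms(1,11,12) by (simp add: Let_def)
  have c: "0 \<le> p" "p < prefix_count 0 i T \<Longrightarrow> p < int (size U)"
  proof -
    have "int (length (filter (\<lambda>e. snd e = 0) (take (nat i) (inorder T)))) \<le> int (length (filter (\<lambda>e. snd e = 0) (inorder T)))"
      by (metis append_take_drop_id filter_append le_add1 length_append of_nat_mono)
    then have "prefix_count 0 i T \<le> int (size U)"
      using assms(8-10) by (simp add: prefix_count_inorder mark_count_def)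
    then show "p < prefix_count 0 i T \<Longrightarrow> p < int (size U)" by simp
    show "0 \<le> p" using assms(8,9,11) by (simp add: prefix_count_inorder mark_count_def)
  qed
  have st: "\<bar>i - 1\<bar> \<le> B" "\<bar>3 - par\<bar> \<le> B" "enc_st s = RC [enc T, enc U, RI par, enc_dp d, RI est, RI ages, RI agee, RI act, RI 0]"
    using assms XB by (auto simp: small_def)
  define res where "res = enc_st (finish_update (int n) (St (del (i - 1) T) U' par d est ages agee act))"
  note F = F[folded res_def]
  show ?thesis
    unfolding e res_def[symmetric] N
  proof (cases "p < prefix_count 0 i T")
    case True
    then have U': "U' = del p U" using assms(12) by simp
    show "computes B alg_code 24 [RI (int n), RI i, r] res (50000 * N)"
      using N(1) tau_pos twenty_le_B st assms(6-9) c True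
      apply (intro alg_start)
      apply (simp only: delete_code_def wp_Let)
      apply (rule wp_initial[OF assms(2)], simp, simp)
      apply (simp add: wp_simps)
      apply (rule computesD[OF prefix_count_small[of T "i - 1" 0, folded assms(11)]], simp, simp, simp, simp)
      apply (rule computesD[OF del_small[of T "i - 1"]], simp, simp, simp)
      apply (rule computesD[OF prefix_count_small[of T i 0]], simp, simp, simp, simp)
      apply (simp add: wp_simps)
      apply (rule computesD[OF del_small[of U p]], simp, simp, simp)
      apply (rule computesD[OF F[unfolded U' enc_st.simps]])
      apply simp_all
      done
  next
    case False
    then have U': "U' = U" using assms(12) by simp
    show "computes B alg_code 24 [RI (int n), RI i, r] res (50000 * N)"
      using N(1) tau_pos twenty_le_B st assms(6-9) c False
      apply (intro alg_start)
      apply (simp only: delete_code_def wp_Let)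
      apply (rule wp_initial[OF assms(2)], simp, simp)
      apply (simp add: wp_simps)
      apply (rule computesD[OF prefix_count_small[of T "i - 1" 0, folded assms(11)]], simp, simp, simp, simp)
      apply (rule computesD[OF del_small[of T "i - 1"]], simp, simp, simp)
      apply (rule computesD[OF prefix_count_small[of T i 0]], simp, simp, simp, simp)
      apply (simp add: wp_simps)
      apply (rule computesD[OF F[unfolded U' enc_st.simps]])
      apply simp_all
      done
  qed
qed

end

section \<open>Increasing subsequences\<close>

definition lis :: "real list \<Rightarrow> nat" where
  "lis xs = Max {length ys | ys. subseq ys xs \<and> sorted_wrt (<) ys}"

lemma lis_set: "finite {length ys | ys. subseq ys xs \<and> sorted_wrt (<) ys}"
  "{length ys | ys. subseq ys xs \<and> sorted_wrt (<) ys} \<noteq> {}"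
proof -
  have "{length ys | ys. subseq ys xs \<and> sorted_wrt (<) ys} \<subseteq> {..length xs}"
    by (auto dest: list_emb_length)
  then show "finite {length ys | ys. subseq ys xs \<and> sorted_wrt (<) ys}"
    using finite_subset by blast
  show "{length ys | ys. subseq ys xs \<and> sorted_wrt (<) ys} \<noteq> {}"
    by (auto intro!: exI[of _ "[]"])
qed

lemma lis_ge: "subseq ys xs \<Longrightarrow> sorted_wrt (<) ys \<Longrightarrow> length ys \<le> lis xs"
  unfolding lis_def using lis_set by (intro Max_ge) auto

lemma lis_witness: obtains ys where "subseq ys xs" "sorted_wrt (<) ys" "length ys = lis xs"
  using Max_in[OF lis_set, of xs] unfolding lis_def by auto

lemma lis_le: "(\<And>ys. subseq ys xs \<Longrightarrow> sorted_wrt (<) ys \<Longrightarrow> length ys \<le> n) \<Longrightarrow> lis xs \<le> n"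
  using lis_witness by metis

lemma lis_le_length: "lis xs \<le> length xs"
  by (intro lis_le) (rule list_emb_length)

lemma subseq_set: "subseq ys xs \<Longrightarrow> set ys \<subseteq> set xs"
  by (induction rule: list_emb.induct) auto

lemma dtm_eq: "dtm xs = length xs - lis xs"
  unfolding dtm_def
proof (rule Least_equality)
  obtain ys where ys: "subseq ys xs" "sorted_wrt (<) ys" "length ys = lis xs" by (rule lis_witness)
  obtain N where N: "ys = nths xs N" using ys(1) by (auto simp: subseq_conv_nths)
  let ?D = "{..<length xs} - N"
  have e: "nths xs ({..<length xs} - ?D) = ys"
    unfolding N nths_def by (intro arg_cong[where f = "map fst"] filter_cong) (auto simp: set_zip)
  have "length ys = card ({..<length xs} \<inter> N)"
    unfolding N length_nths by (intro arg_cong[where f = card]) auto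
  moreover have "card ?D = length xs - card ({..<length xs} \<inter> N)"
    by (simp add: card_Diff_subset_Int)
  ultimately show "\<exists>D\<subseteq>{..<length xs}. card D = length xs - lis xs \<and> sorted_wrt (<) (nths xs ({..<length xs} - D))"
    using e ys by (intro exI[of _ ?D]) auto
next
  fix k assume "\<exists>D\<subseteq>{..<length xs}. card D = k \<and> sorted_wrt (<) (nths xs ({..<length xs} - D))"
  then obtain D where D: "D \<subseteq> {..<length xs}" "card D = k" "sorted_wrt (<) (nths xs ({..<length xs} - D))"
    by blast
  have "length (nths xs ({..<length xs} - D)) \<le> lis xs"
    using D(3) by (intro lis_ge) (auto simp: subseq_conv_nths)
  moreover have "length (nths xs ({..<length xs} - D)) = card ({..<length xs} - D)"
    unfolding length_nths by (intro arg_cong[where f = card]) auto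
  moreover have "card ({..<length xs} - D) = length xs - k"
    using D by (simp add: card_Diff_subset finite_subset)
  ultimately show "length xs - lis xs \<le> k" by linarith
qed

lemma dtm_lis: "dtm xs + lis xs = length xs"
  using lis_le_length by (simp add: dtm_eq)

lemma lis_insert: "lis (as @ bs) \<le> lis (as @ x # bs)" "lis (as @ x # bs) \<le> lis (as @ bs) + 1"
proof -
  obtain ys where "subseq ys (as @ bs)" "sorted_wrt (<) ys" "length ys = lis (as @ bs)" by (rule lis_witness)
  moreover have "subseq (as @ bs) (as @ x # bs)" by (simp add: subseq_append' list_emb_Cons)
  ultimately show "lis (as @ bs) \<le> lis (as @ x # bs)" by (metis lis_ge subseq_order.order_trans)
  show "lis (as @ x # bs) \<le> lis (as @ bs) + 1"
  proof (rule lis_le)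
    fix ys assume ys: "subseq ys (as @ x # bs)" "sorted_wrt (<) ys"
    then obtain y1 y2 where y: "ys = y1 @ y2" "subseq y1 as" "subseq y2 (x # bs)"
      by (auto simp: subseq_append_iff)
    show "length ys \<le> lis (as @ bs) + 1"
    proof (cases "subseq y2 bs")
      case True
      then have "subseq ys (as @ bs)" unfolding y(1) by (rule list_emb_append_mono[OF y(2)])
      then show ?thesis using lis_ge[OF _ ys(2)] by fastforce
    next
      case False
      then obtain y3 where y3: "y2 = x # y3" "subseq y3 bs" using y(3) by (cases y2) (auto split: if_splits)
      have "length (y1 @ y3) \<le> lis (as @ bs)"
        using list_emb_append_mono[OF y(2) y3(2)] y y3 ys by (intro lis_ge) (auto simp: sorted_wrt_append)
      then show ?thesis using y y3 by simp
    qed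
  qed
qed

lemma dtm_insert: "dtm (as @ bs) \<le> dtm (as @ x # bs)" "dtm (as @ x # bs) \<le> dtm (as @ bs) + 1"
  using lis_insert(1)[of as bs x] lis_insert(2)[of as x bs] dtm_lis[of "as @ bs"] dtm_lis[of "as @ x # bs"] by simp_all

lemma dtm_subseq: "subseq xs zs \<Longrightarrow> dtm xs \<le> dtm zs"
proof -
  have "dtm (as @ xs) \<le> dtm (as @ zs)" if "subseq xs zs" for as
    using that
  proof (induction arbitrary: as rule: list_emb.induct)
    case (list_emb_Nil ys)
    show ?case
    proof (induction ys arbitrary: as)
      case (Cons y ys)
      show ?case using Cons.IH[of as] dtm_insert(1)[of as ys y] by simp
    qed simp
  next
    case (list_emb_Cons xs ys y)
    then show ?case using dtm_insert(1)[of as ys y] order_trans by blast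
  next
    case (list_emb_Cons2 x y xs ys)
    then show ?case using list_emb_Cons2.IH[of "as @ [x]"] by simp
  qed
  then show "subseq xs zs \<Longrightarrow> dtm xs \<le> dtm zs" by (metis append_Nil)
qed

text \<open>An increasing subsequence contains at most one of x and y: behind x all its members
  exceed x, so y is not among them. Two elements are added, but the longest increasing subsequence
  gains at most one.\<close>

lemma dtm_insert_inverted:
  assumes "y < x"
  shows "dtm (as @ bs @ cs) + 1 \<le> dtm (as @ x # bs @ y # cs)"
proof -
  have "lis (as @ x # bs @ y # cs) \<le> lis (as @ bs @ cs) + 1"
  proof (rule lis_le)
    fix zs assume zs: "subseq zs (as @ x # bs @ y # cs)" "sorted_wrt (<) zs"
    then obtain z1 z2 where z: "zs = z1 @ z2" "subseq z1 as" "subseq z2 (x # bs @ y # cs)"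
      by (auto simp: subseq_append_iff)
    show "length zs \<le> lis (as @ bs @ cs) + 1"
    proof (cases "subseq z2 (bs @ y # cs)")
      case True
      then have "subseq zs (as @ bs @ y # cs)" unfolding z(1) by (rule list_emb_append_mono[OF z(2)])
      then have "subseq zs ((as @ bs) @ y # cs)" by simp
      then show ?thesis using lis_insert(2)[of "as @ bs" y cs] lis_ge[OF _ zs(2)] by fastforce
    next
      case False
      then obtain z3 where z3: "z2 = x # z3" "subseq z3 (bs @ y # cs)"
        using z(3) by (cases z2) (auto split: if_splits)
      have gt: "\<forall>t\<in>set z3. x < t" using zs(2) z z3 by (simp add: sorted_wrt_append)
      obtain z4 z5 where z4: "z3 = z4 @ z5" "subseq z4 bs" "subseq z5 (y # cs)"
        using z3 by (auto simp: subseq_append_iff)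
      have "y \<notin> set z5" using gt z4(1) assms by (metis UnCI less_asym set_append)
      then have "subseq z5 cs" using z4(3) by (cases z5) (auto split: if_splits)
      then have "subseq (z1 @ z4 @ z5) (as @ bs @ cs)" using z z4 by (simp add: list_emb_append_mono)
      moreover have "sorted_wrt (<) (z1 @ z4 @ z5)" using zs(2) z z3 z4 by (simp add: sorted_wrt_append)
      ultimately have "length (z1 @ z4 @ z5) \<le> lis (as @ bs @ cs)" by (rule lis_ge)
      then show ?thesis using z z3 z4 by simp
    qed
  qed
  then show ?thesis using dtm_lis[of "as @ bs @ cs"] dtm_lis[of "as @ x # bs @ y # cs"] by simp
qed

lemma lis_snoc: "lis (xs @ [x]) = max (lis xs) (lis (filter (\<lambda>y. y < x) xs) + 1)"
proof (rule antisym)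
  show "lis (xs @ [x]) \<le> max (lis xs) (lis (filter (\<lambda>y. y < x) xs) + 1)"
  proof (rule lis_le)
    fix ys assume ys: "subseq ys (xs @ [x])" "sorted_wrt (<) ys"
    then obtain y1 y2 where y: "ys = y1 @ y2" "subseq y1 xs" "subseq y2 [x]"
      by (auto simp: subseq_append_iff)
    show "length ys \<le> max (lis xs) (lis (filter (\<lambda>y. y < x) xs) + 1)"
    proof (cases "y2 = []")
      case True
      then show ?thesis using y ys lis_ge[of y1 xs] by auto
    next
      case False
      then have y2: "y2 = [x]" using y(3) by (cases y2) (auto split: if_splits)
      then have "\<forall>y\<in>set y1. y < x" using ys(2) y by (simp add: sorted_wrt_append)
      then have "filter (\<lambda>y. y < x) y1 = y1" by simp
      then have "subseq y1 (filter (\<lambda>y. y < x) xs)" using subseq_filter[OF y(2)] by metis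
      then have "length y1 \<le> lis (filter (\<lambda>y. y < x) xs)"
        using ys(2) y by (intro lis_ge) (auto simp: sorted_wrt_append)
      then show ?thesis using y y2 by simp
    qed
  qed
  obtain ys where ys: "subseq ys (filter (\<lambda>y. y < x) xs)" "sorted_wrt (<) ys"
    "length ys = lis (filter (\<lambda>y. y < x) xs)" by (rule lis_witness)
  have "\<forall>y\<in>set ys. y < x" using subseq_set[OF ys(1)] by auto
  moreover have "subseq ys xs" using ys(1) subseq_filter_left subseq_order.order_trans by blast
  then have "subseq (ys @ [x]) (xs @ [x])" by simp
  ultimately have "length (ys @ [x]) \<le> lis (xs @ [x])" using ys(2) by (intro lis_ge) (auto simp: sorted_wrt_append)
  then show "max (lis xs) (lis (filter (\<lambda>y. y < x) xs) + 1) \<le> lis (xs @ [x])"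
    using ys(3) lis_insert(1)[of xs "[]" x] by simp
qed

section \<open>Patience sorting\<close>

text \<open>A step of patience sorting. For distinct elements, the tail number l in increasing order
  is the least last element of an increasing subsequence of length l; a set suffices, since the
  order recovers l.\<close>

definition bump :: "real set \<Rightarrow> real \<Rightarrow> real set" where
  "bump A x = insert x (if \<exists>t\<in>A. x < t then A - {Min {t \<in> A. x < t}} else A)"

definition tails :: "real list \<Rightarrow> real set" where
  "tails xs = foldl bump {} xs"

lemma tails_Nil [simp]: "tails [] = {}"
  by (simp add: tails_def)

lemma tails_snoc: "tails (xs @ [x]) = bump (tails xs) x"
  by (simp add: tails_def)

lemma tails_subset: "tails xs \<subseteq> set xs"
  by (induction xs rule: rev_induct) (auto simp: tails_snoc bump_def split: if_splits)

lemma finite_tails: "finite (tails xs)"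
  using tails_subset finite_subset by blast

text \<open>The constantly true P gives the length of a longest increasing subsequence. The
  induction also needs the lower set of elements below x, since by \<open>lis_snoc\<close> a new
  element x extends a best sequence there; hence all lower sets are treated at once.\<close>

lemma card_tails_filter:
  assumes "distinct xs" "\<And>a b. P b \<Longrightarrow> a \<le> b \<Longrightarrow> P a"
  shows "card {t \<in> tails xs. P t} = lis (filter P xs)"
  using assms
proof (induction xs arbitrary: P rule: rev_induct)
  case Nil
  then show ?case using lis_le_length[of "[]"] by simp
next
  case (snoc x xs)
  let ?A = "tails xs"
  have fin: "finite ?A" by (rule finite_tails)
  have x: "x \<notin> ?A" using tails_subset[of xs] snoc.prems(1) by auto
  have IH: "card {t \<in> ?A. P t} = lis (filter P xs)" using snoc by simp
  show ?case
  proof (cases "P x")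
    case False
    have "{t \<in> bump ?A x. P t} = {t \<in> ?A. P t}"
    proof (cases "\<exists>t\<in>?A. x < t")
      case True
      let ?m = "Min {t \<in> ?A. x < t}"
      have "?m \<in> {t \<in> ?A. x < t}" using True fin by (intro Min_in) auto
      then have "\<not> P ?m" using False snoc.prems(2)[of ?m x] by auto
      then show ?thesis using True False by (auto simp: bump_def)
    qed (use False in \<open>auto simp: bump_def\<close>)
    then show ?thesis using IH False by (simp add: tails_snoc)
  next
    case True
    have IH': "card {t \<in> ?A. t < x} = lis (filter (\<lambda>y. y < x) xs)"
      using snoc by (intro snoc.IH) auto
    have f: "filter (\<lambda>y. y < x) (filter P xs) = filter (\<lambda>y. y < x) xs"
      using True snoc.prems(2)[of x] by (auto intro!: filter_cong)
    have rhs: "lis (filter P (xs @ [x])) = max (card {t \<in> ?A. P t}) (card {t \<in> ?A. t < x} + 1)"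
      using True lis_snoc[of "filter P xs" x] f IH IH' by simp
    show ?thesis
    proof (cases "\<exists>t\<in>?A. x < t \<and> P t")
      \<comment> \<open>The displaced tail satisfies P as well, so the count stays; it also shows
        that the tails below x are fewer by at least one, so the maximum stays too.\<close>
      case t: True
      let ?m = "Min {t \<in> ?A. x < t}"
      have m: "?m \<in> {t \<in> ?A. x < t}" using t fin by (intro Min_in) auto
      from t obtain t where t': "t \<in> ?A" "x < t" "P t" by blast
      have "?m \<le> t" using t' fin by (intro Min_le) auto
      then have Pm: "P ?m" using t' snoc.prems(2) by blast
      have "{t \<in> bump ?A x. P t} = insert x ({t \<in> ?A. P t} - {?m})"
        using t True m by (auto simp: bump_def)
      moreover have "card {t \<in> ?A. P t} = Suc (card ({t \<in> ?A. P t} - {?m}))"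
        using fin m Pm by (intro card.remove) auto
      ultimately have c: "card {t \<in> bump ?A x. P t} = card {t \<in> ?A. P t}"
        using x fin by simp
      have "insert ?m {t \<in> ?A. t < x} \<subseteq> {t \<in> ?A. P t}"
        using m Pm True snoc.prems(2) by (auto intro: less_imp_le)
      then have "card (insert ?m {t \<in> ?A. t < x}) \<le> card {t \<in> ?A. P t}"
        using fin by (intro card_mono) auto
      moreover have "card (insert ?m {t \<in> ?A. t < x}) = card {t \<in> ?A. t < x} + 1"
        using m fin by auto
      ultimately show ?thesis using rhs c by (simp add: tails_snoc)
    next
      \<comment> \<open>All tails satisfying P lie below x, so both the count and the maximum grow
        by one.\<close>
      case f: False
      have e: "{t \<in> ?A. P t} = {t \<in> ?A. t < x}"
        using f x True snoc.prems(2) by (metis (mono_tags, lifting) less_imp_le linorder_neqE)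
      have "{t \<in> bump ?A x. P t} = insert x {t \<in> ?A. P t}"
      proof (cases "\<exists>t\<in>?A. x < t")
        case t: True
        let ?m = "Min {t \<in> ?A. x < t}"
        have m: "?m \<in> {t \<in> ?A. x < t}" using t fin by (intro Min_in) auto
        then have "\<not> P ?m" using f by auto
        then show ?thesis using t True by (auto simp: bump_def)
      qed (use True in \<open>auto simp: bump_def\<close>)
      then show ?thesis using rhs e x fin by (simp add: tails_snoc)
    qed
  qed
qed

lemma dtm_tails: "distinct xs \<Longrightarrow> dtm xs + card (tails xs) = length xs"
  using card_tails_filter[of xs "\<lambda>_. True"] dtm_lis[of xs] by simp

text \<open>Each new element exceeds all tails, those just added included, and displaces none. This
  justifies reading a whole run at once.\<close>

lemma tails_append_increasing:
  assumes "sorted_wrt (<) ys" "\<forall>t\<in>tails xs. \<forall>y\<in>set ys. t < y"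
  shows "tails (xs @ ys) = tails xs \<union> set ys"
  using assms
proof (induction ys rule: rev_induct)
  case (snoc y ys)
  then have IH: "tails (xs @ ys) = tails xs \<union> set ys" by (simp add: sorted_wrt_append)
  have "\<not> (\<exists>t\<in>tails (xs @ ys). y < t)"
    using snoc.prems unfolding IH by (auto simp: sorted_wrt_append)
  then have "bump (tails (xs @ ys)) y = insert y (tails (xs @ ys))" by (auto simp: bump_def)
  then show ?case using IH tails_snoc[of "xs @ ys" y] by simp
qed simp

section \<open>Sorted trees as sets\<close>

abbreviation keys :: "elem tree \<Rightarrow> real list" where
  "keys t \<equiv> map fst (inorder t)"

lemma keys_del:
  assumes "sorted_wrt (<) (keys t)" "0 \<le> i" "i < int (size t)"
  shows "sorted_wrt (<) (keys (del i t))" "set (keys (del i t)) = set (keys t) - {fst (get i t)}"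
proof -
  let ?x = "keys t ! nat i"
  have e: "keys t = take (nat i) (keys t) @ ?x # drop (Suc (nat i)) (keys t)"
    using assms by (intro id_take_nth_drop) simp
  have d: "keys (del i t) = take (nat i) (keys t) @ drop (Suc (nat i)) (keys t)"
    using assms by (simp add: inorder_del take_map drop_map)
  show "sorted_wrt (<) (keys (del i t))"
    unfolding d using assms(1) by (subst (asm) e) (simp add: sorted_wrt_append)
  have x: "?x = fst (get i t)" using assms by (simp add: get_inorder)
  have "sorted_wrt (<) (take (nat i) (keys t) @ ?x # drop (Suc (nat i)) (keys t))"
    using assms(1) e by metis
  then have "?x \<notin> set (take (nat i) (keys t) @ drop (Suc (nat i)) (keys t))"
    by (auto simp: sorted_wrt_append)
  moreover have "set (keys t) = insert ?x (set (take (nat i) (keys t) @ drop (Suc (nat i)) (keys t)))"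
    by (subst e) auto
  ultimately show "set (keys (del i t)) = set (keys t) - {fst (get i t)}"
    unfolding d x by auto
qed

lemma sorted_filter_less:
  fixes xs :: "real list"
  shows "sorted_wrt (<) xs \<Longrightarrow> filter (\<lambda>y. y < x) xs = take (length (filter (\<lambda>y. y < x) xs)) xs"
proof (induction xs)
  case (Cons a xs)
  have "filter (\<lambda>y. y < x) xs = []" if "\<not> a < x" using Cons.prems that by (force intro: filter_False)
  then show ?case using Cons by auto
qed simp

lemma rank_split:
  assumes "sorted_wrt (<) (keys t)"
  obtains n where "rank x t = int n" "n \<le> size t" "\<forall>y\<in>set (take n (keys t)). y < x"
    "\<forall>y\<in>set (drop n (keys t)). x \<le> y"
proof -
  define n where "n = length (filter (\<lambda>y. y < x) (keys t))"
  have 1: "rank x t = int n"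
    using rank_inorder[OF assms, of x] by (simp add: n_def filter_map o_def)
  have 2: "n \<le> size t" unfolding n_def by (metis length_filter_le length_inorder length_map)
  have f: "filter (\<lambda>y. y < x) (keys t) = take n (keys t)"
    unfolding n_def by (rule sorted_filter_less[OF assms])
  have 3: "\<forall>y\<in>set (take n (keys t)). y < x"
    unfolding f[symmetric] by simp
  have "filter (\<lambda>y. y < x) (take n (keys t) @ drop n (keys t)) = take n (keys t)"
    unfolding append_take_drop_id by (rule f)
  moreover have "filter (\<lambda>y. y < x) (take n (keys t)) = take n (keys t)"
    by (intro filter_True) (use 3 in blast)
  ultimately have "filter (\<lambda>y. y < x) (drop n (keys t)) = []" unfolding filter_append by simp
  then have "\<forall>y\<in>set (drop n (keys t)). x \<le> y" unfolding filter_empty_conv not_less .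
  then show thesis using that 1 2 3 by blast
qed

lemma rank_card:
  assumes "sorted_wrt (<) (keys t)"
  shows "rank x t = int (card {y \<in> set (keys t). y < x})"
proof -
  have "distinct (filter (\<lambda>y. y < x) (keys t))" using assms by (simp add: strict_sorted_iff)
  from distinct_card[OF this] have "card {y \<in> set (keys t). y < x} = length (filter (\<lambda>y. y < x) (keys t))"
    by (simp only: set_filter)
  then show ?thesis
    using rank_inorder[OF assms, of x] by (simp only: filter_map length_map o_def)
qed

lemma keys_ins:
  assumes "sorted_wrt (<) (keys t)" "x \<notin> set (keys t)"
  shows "sorted_wrt (<) (keys (ins (rank x t) (x, m) t))" "set (keys (ins (rank x t) (x, m) t)) = insert x (set (keys t))"
proof -
  obtain n where n: "rank x t = int n" "n \<le> size t" "\<forall>y\<in>set (take n (keys t)). y < x"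
    "\<forall>y\<in>set (drop n (keys t)). x \<le> y" using rank_split[OF assms(1)] by blast
  have e: "keys (ins (rank x t) (x, m) t) = take n (keys t) @ x # drop n (keys t)"
    using n(1,2) by (simp add: inorder_ins take_map drop_map)
  have t: "keys t = take n (keys t) @ drop n (keys t)" by simp
  have "\<forall>y\<in>set (drop n (keys t)). x < y"
    using n(4) assms(2) by (metis in_set_dropD order_le_imp_less_or_eq)
  then show "sorted_wrt (<) (keys (ins (rank x t) (x, m) t))"
    using assms(1) n(3) unfolding e by (subst (asm) t) (fastforce simp: sorted_wrt_append)
  have "set (keys t) = set (take n (keys t)) \<union> set (drop n (keys t))" by (metis set_append t)
  then show "set (keys (ins (rank x t) (x, m) t)) = insert x (set (keys t))" unfolding e by simp
qed

text \<open>For x outside a sorted tree, its rank is the index of its successor; so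
  \<open>rank\<close> and \<open>get\<close> together find the tail that x displaces.\<close>

lemma rank_successor:
  assumes "sorted_wrt (<) (keys t)" "x \<notin> set (keys t)"
  shows "rank x t < int (size t) \<longleftrightarrow> (\<exists>y\<in>set (keys t). x < y)"
    and "rank x t < int (size t) \<Longrightarrow> fst (get (rank x t) t) \<in> set (keys t) \<and> x < fst (get (rank x t) t) \<and>
      (\<forall>y\<in>set (keys t). x < y \<longrightarrow> fst (get (rank x t) t) \<le> y)"
proof -
  obtain n where n: "rank x t = int n" "n \<le> size t" "\<forall>y\<in>set (take n (keys t)). y < x"
    "\<forall>y\<in>set (drop n (keys t)). x \<le> y" using rank_split[OF assms(1)] by blast
  have t: "set (keys t) = set (take n (keys t)) \<union> set (drop n (keys t))"
    by (metis append_take_drop_id set_append)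
  have *: "fst (get (rank x t) t) \<in> set (keys t) \<and> x < fst (get (rank x t) t) \<and>
      (\<forall>y\<in>set (keys t). x < y \<longrightarrow> fst (get (rank x t) t) \<le> y)" if "n < size t"
  proof -
    have d: "drop n (keys t) = keys t ! n # drop (Suc n) (keys t)"
      using that Cons_nth_drop_Suc[of n "keys t"] by simp
    have g: "fst (get (rank x t) t) = keys t ! n" using that n(1) by (simp add: get_inorder)
    have s: "sorted_wrt (<) (drop n (keys t))" using assms(1) by (rule sorted_wrt_drop)
    have m: "keys t ! n \<in> set (drop n (keys t))" using d by (metis list.set_intros(1))
    have "x < keys t ! n" using n(4) assms(2) m t by (metis UnCI order_le_imp_less_or_eq)
    moreover have "\<forall>y\<in>set (keys t). x < y \<longrightarrow> keys t ! n \<le> y"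
    proof (intro ballI impI)
      fix y assume "y \<in> set (keys t)" "x < y"
      then have "y \<in> set (drop n (keys t))" using t n(3) by force
      then show "keys t ! n \<le> y" using s d by auto
    qed
    ultimately show ?thesis unfolding g using m t by (metis UnCI)
  qed
  show "rank x t < int (size t) \<Longrightarrow> fst (get (rank x t) t) \<in> set (keys t) \<and> x < fst (get (rank x t) t) \<and>
      (\<forall>y\<in>set (keys t). x < y \<longrightarrow> fst (get (rank x t) t) \<le> y)"
    using * n(1) by simp
  have "\<not> (\<exists>y\<in>set (keys t). x < y)" if "n = size t"
    using n(3) that by (auto simp: not_less intro: less_imp_le)
  then show "rank x t < int (size t) \<longleftrightarrow> (\<exists>y\<in>set (keys t). x < y)"
    using * n(1,2) by (metis le_neq_implies_less nless_le of_nat_less_iff)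
qed

lemma bump_successor:
  assumes "finite A" "y \<in> A" "x < y" "\<forall>t\<in>A. x < t \<longrightarrow> y \<le> t"
  shows "bump A x = insert x (A - {y})"
proof -
  have "Min {t \<in> A. x < t} = y" using assms by (intro Min_eqI) auto
  then show ?thesis using assms(2,3) by (auto simp: bump_def)
qed

lemma bump_top: "\<not> (\<exists>t\<in>A. x < t) \<Longrightarrow> bump A x = insert x A"
  by (simp add: bump_def)

section \<open>Incremental patience sorting\<close>

text \<open>The sequence \<open>ts\<close> consists of the increasing subsequence \<open>us\<close> of the elements marked 0 and of
  elements marked \<open>m\<close>. After \<open>k\<close> elements of the second and \<open>c\<close> elements of the first kind, the
  set of tails of patience sorting is split into \<open>q\<close>, its elements marked \<open>m\<close>, and the part of
  \<open>v\<close> that has been read. A run of elements of \<open>us\<close> above all tails is read in one step.\<close>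

definition dp_inv ::
  "elem tree \<Rightarrow> elem tree \<Rightarrow> int \<Rightarrow> int \<Rightarrow> int \<Rightarrow> elem tree \<Rightarrow> elem tree \<Rightarrow> int \<Rightarrow> int \<Rightarrow> bool" where
  "dp_inv ts us m k c v q cost dn \<longleftrightarrow>
     avl ts \<and> avl us \<and> avl v \<and> avl q \<and> (m = 1 \<or> m = 2) \<and>
     inorder us = filter (\<lambda>e. snd e = 0) (inorder ts) \<and>
     (\<forall>e\<in>set (inorder ts). snd e = 0 \<or> snd e = m) \<and>
     distinct (keys ts) \<and> sorted_wrt (<) (keys us) \<and>
     0 \<le> k \<and> 0 \<le> c \<and> k + c \<le> int (size ts) \<and> mark_count m (take (nat (k + c)) (inorder ts)) = k \<and>
     sorted_wrt (<) (keys v) \<and> sorted_wrt (<) (keys q) \<and>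
     tails (take (nat (k + c)) (keys ts)) = (set (keys v) \<inter> set (take (nat c) (keys us))) \<union> set (keys q) \<and>
     set (drop (nat c) (keys us)) \<subseteq> set (keys v) \<and> set (keys v) \<subseteq> set (keys us) \<and>
     set (keys q) \<subseteq> fst ` set (filter (\<lambda>e. snd e = m) (take (nat (k + c)) (inorder ts))) \<and>
     cost = k + c - int (card (tails (take (nat (k + c)) (keys ts)))) \<and>
     (dn = 0 \<or> dn = 1 \<and> cost = int (dtm (keys ts)))"

fun dp_ok :: "dp \<Rightarrow> bool" where
  "dp_ok (DP ts us m k c v q cost dn) \<longleftrightarrow> dp_inv ts us m k c v q cost dn"

text \<open>A marked element lowers the first term by 2 and adds at most one element to q; a
  displacement by an unmarked one removes an element from q. The 1 pays for setting the completion
  flag. With q empty the start value is 2 K + 1 for K marked elements.\<close>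

fun dp_measure :: "dp \<Rightarrow> nat" where
  "dp_measure (DP ts us m k c v q cost dn) =
     (if 0 < dn then 0 else nat (2 * (mark_count m (inorder ts) - k)) + size q + 1)"

lemma mark_count_take_mono: "p \<le> p' \<Longrightarrow> mark_count m (take p ys) \<le> mark_count m (take p' ys)"
proof -
  assume "p \<le> p'"
  then have "take p' ys = take p ys @ take (p' - p) (drop p ys)" by (metis le_add_diff_inverse take_add)
  then show ?thesis using mark_count_bounds(1)[of m "take (p' - p) (drop p ys)"] by simp
qed

lemma mark_count_split:
  "\<forall>e\<in>set ys. snd e = 0 \<or> snd e = m \<Longrightarrow> m \<noteq> 0 \<Longrightarrow> mark_count 0 ys + mark_count m ys = int (length ys)"
  by (induction ys) auto

lemma prefix_marked:
  assumes "\<forall>e\<in>set ys. snd e = 0 \<or> snd e = m" "m \<noteq> 0" "p \<le> length ys"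
    "mark_count m (take p ys) = int k"
  shows "k \<le> p" "filter (\<lambda>e. snd e = 0) (take p ys) = take (p - k) (filter (\<lambda>e. snd e = 0) ys)"
    "p - k \<le> length (filter (\<lambda>e. snd e = 0) ys)"
proof -
  have "\<forall>e\<in>set (take p ys). snd e = 0 \<or> snd e = m" using assms(1) by (meson in_set_takeD)
  from mark_count_split[OF this assms(2)] have c: "mark_count 0 (take p ys) + int k = int p"
    using assms by simp
  then show "k \<le> p" using mark_count_bounds(1)[of 0 "take p ys"] by linarith
  have l: "length (filter (\<lambda>e. snd e = 0) (take p ys)) = p - k"
    using c \<open>k \<le> p\<close> by (simp add: mark_count_def)
  have f: "filter (\<lambda>e. snd e = 0) ys = filter (\<lambda>e. snd e = 0) (take p ys) @ filter (\<lambda>e. snd e = 0) (drop p ys)"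
    by (metis append_take_drop_id filter_append)
  show "filter (\<lambda>e. snd e = 0) (take p ys) = take (p - k) (filter (\<lambda>e. snd e = 0) ys)"
    unfolding f l[symmetric] by simp
  show "p - k \<le> length (filter (\<lambda>e. snd e = 0) ys)"
    unfolding f l[symmetric] by simp
qed

text \<open>Two prefixes with the same number of marked elements differ by unmarked ones only, and
  these are consecutive in the filtered list, from index p - k on.\<close>

lemma segment_unmarked:
  assumes "\<forall>e\<in>set ys. snd e = 0 \<or> snd e = m" "m \<noteq> 0" "p \<le> p'" "p' \<le> length ys"
    "mark_count m (take p ys) = int k" "mark_count m (take p' ys) = int k"
  shows "take p' ys = take p ys @ take (p' - p) (drop (p - k) (filter (\<lambda>e. snd e = 0) ys))"
proof -
  let ?s = "take (p' - p) (drop p ys)"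
  have t: "take p' ys = take p ys @ ?s" using assms(3) by (metis le_add_diff_inverse take_add)
  then have "mark_count m ?s = 0" using assms(5,6) by simp
  then have "\<forall>e\<in>set ?s. snd e \<noteq> m" by (auto simp: mark_count_def filter_empty_conv)
  moreover have "\<forall>e\<in>set ?s. snd e = 0 \<or> snd e = m" using assms(1) by (meson in_set_dropD in_set_takeD)
  ultimately have s: "filter (\<lambda>e. snd e = 0) ?s = ?s" by (auto intro: filter_True)
  have p: "p \<le> length ys" using assms by simp
  have "length (filter (\<lambda>e. snd e = 0) (take p ys)) = p - k"
    using prefix_marked[OF assms(1,2) p assms(5)] by simp
  moreover have "filter (\<lambda>e. snd e = 0) ys = filter (\<lambda>e. snd e = 0) (take p ys) @ ?s @ filter (\<lambda>e. snd e = 0) (drop p' ys)"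
    by (metis append_take_drop_id append_assoc filter_append s t)
  moreover have "length ?s = p' - p" using assms by simp
  ultimately show ?thesis using t by simp
qed

text \<open>Turns "already read" into a comparison of numbers: the subsequence is increasing and is
  read from the left.\<close>

lemma rank_less_iff:
  assumes "sorted_wrt (<) (keys t)" "y \<in> set (keys t)" "w \<le> size t"
  shows "rank y t < int w \<longleftrightarrow> y \<in> set (take w (keys t))"
proof -
  obtain n where n: "rank y t = int n" "n \<le> size t" "\<forall>z\<in>set (take n (keys t)). z < y"
    "\<forall>z\<in>set (drop n (keys t)). y \<le> z" using rank_split[OF assms(1)] by blast
  have "y \<in> set (take n (keys t)) \<union> set (drop n (keys t))"
    using assms(2) by (metis append_take_drop_id set_append)
  then have d: "y \<in> set (drop n (keys t))" using n(3) by blast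
  show ?thesis
  proof
    assume "rank y t < int w"
    then have nw: "n < w" using n(1) by simp
    have "n < length (keys t)" using d by (metis drop_all empty_iff empty_set linorder_not_less)
    then have e: "drop n (keys t) = keys t ! n # drop (Suc n) (keys t)" by (simp only: Cons_nth_drop_Suc)
    have "sorted_wrt (<) (drop n (keys t))" using assms(1) by (rule sorted_wrt_drop)
    then have "\<forall>z\<in>set (drop (Suc n) (keys t)). keys t ! n < z" unfolding e by simp
    moreover have "y \<le> keys t ! n" using n(4) unfolding e by simp
    ultimately have "y = keys t ! n" using d unfolding e by force
    moreover have "keys t ! n = take w (keys t) ! n" using nw by simp
    moreover have "n < length (take w (keys t))" using nw assms(3) by simp
    ultimately show "y \<in> set (take w (keys t))" by (metis nth_mem)
  next
    assume y: "y \<in> set (take w (keys t))"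
    show "rank y t < int w"
    proof (rule ccontr)
      assume "\<not> rank y t < int w"
      then have "w \<le> n" using n(1) by simp
      then have "y \<in> set (take n (keys t))" using y set_take_subset_set_take by (metis subsetD)
      then show False using n(3) by blast
    qed
  qed
qed

context
  fixes ts us m k c v q cost dn
  assumes inv: "dp_inv ts us m k c v q cost dn"
begin

lemma dp_marks: "\<forall>e\<in>set (inorder ts). snd e = 0 \<or> snd e = m" "m \<noteq> 0"
  using inv by (auto simp: dp_inv_def)

lemma dp_us: "inorder us = filter (\<lambda>e. snd e = 0) (inorder ts)" "sorted_wrt (<) (keys us)"
  using inv by (auto simp: dp_inv_def)

lemma dp_total: "int (size us) + mark_count m (inorder ts) = int (size ts)"
proof -
  have "int (size us) = mark_count 0 (inorder ts)"
    by (metis dp_us(1) length_inorder mark_count_def)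
  then show ?thesis using mark_count_split[OF dp_marks] by simp
qed

lemma dp_k: "0 \<le> k" "k \<le> mark_count m (inorder ts)" "0 \<le> c" "c \<le> int (size us)"
proof -
  show k: "0 \<le> k" "0 \<le> c" using inv by (auto simp: dp_inv_def)
  have p: "nat (k + c) \<le> length (inorder ts)" "mark_count m (take (nat (k + c)) (inorder ts)) = int (nat k)"
    using inv by (auto simp: dp_inv_def)
  show "k \<le> mark_count m (inorder ts)"
    using mark_count_take_mono[OF p(1), of m "inorder ts"] p(2) k by simp
  show "c \<le> int (size us)"
    using prefix_marked(3)[OF dp_marks p] k by (metis dp_us(1) length_inorder nat_add_distrib add_diff_cancel_left' nat_le_iff)
qed

lemma dp_limit:
  assumes "w = limit (DP ts us m k c v q cost dn)"
  shows "c \<le> w" "w \<le> int (size us)" "k + w \<le> int (size ts)" "mark_count m (take (nat (k + w)) (inorder ts)) = k"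
    "k < mark_count m (inorder ts) \<Longrightarrow> k + w < int (size ts) \<and> snd (inorder ts ! nat (k + w)) = m"
    "\<not> k < mark_count m (inorder ts) \<Longrightarrow> w = int (size us) \<and> k + w = int (size ts)"
proof -
  note k = dp_k
  have kc: "mark_count m (take (nat (k + c)) (inorder ts)) = k" using inv by (auto simp: dp_inv_def)
  have "c \<le> w \<and> w \<le> int (size us) \<and> k + w \<le> int (size ts) \<and> mark_count m (take (nat (k + w)) (inorder ts)) = k \<and>
    (k < mark_count m (inorder ts) \<longrightarrow> k + w < int (size ts) \<and> snd (inorder ts ! nat (k + w)) = m) \<and>
    (\<not> k < mark_count m (inorder ts) \<longrightarrow> w = int (size us) \<and> k + w = int (size ts))"
  proof (cases "k < mark_count m (inorder ts)")
    case True
    define i where "i = select m k ts"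
    have i: "0 \<le> i" "i < int (size ts)" "snd (inorder ts ! nat i) = m" "mark_count m (take (nat i) (inorder ts)) = k"
      using select_inorder[OF k(1) True] by (auto simp: i_def)
    have w: "w = i - k" using assms True by (simp add: i_def)
    \<comment> \<open>Otherwise the marked element at position i would be a further one in the
      prefix read, which contains only k.\<close>
    have "k + c \<le> i"
    proof (rule ccontr)
      assume "\<not> k + c \<le> i"
      then have "Suc (nat i) \<le> nat (k + c)" using i(1) by linarith
      from mark_count_take_mono[OF this, of m "inorder ts"]
      have "mark_count m (take (Suc (nat i)) (inorder ts)) \<le> k" using kc by simp
      moreover have "take (Suc (nat i)) (inorder ts) = take (nat i) (inorder ts) @ [inorder ts ! nat i]"
        using i by (intro take_Suc_conv_app_nth) simp
      ultimately show False using i(3,4) by simp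
    qed
    moreover have "i - k \<le> int (size us)"
    proof -
      have "nat i \<le> length (inorder ts)" using i by simp
      then have "nat i - nat k \<le> length (inorder us)"
        using prefix_marked(3)[OF dp_marks, of "nat i" "nat k"] i k(1) by (simp only: dp_us(1))
      then show ?thesis using i(1) k(1) by simp
    qed
    ultimately show ?thesis using w i True by simp
  next
    case False
    then have "w = int (size us)" "k + w = int (size ts)" using assms k(2) dp_total by simp_all
    then show ?thesis using k False dp_total by simp
  qed
  then show "c \<le> w" "w \<le> int (size us)" "k + w \<le> int (size ts)" "mark_count m (take (nat (k + w)) (inorder ts)) = k"
    "k < mark_count m (inorder ts) \<Longrightarrow> k + w < int (size ts) \<and> snd (inorder ts ! nat (k + w)) = m"
    "\<not> k < mark_count m (inorder ts) \<Longrightarrow> w = int (size us) \<and> k + w = int (size ts)" by auto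
qed

lemma dp_segment:
  assumes "c \<le> w" "k + w \<le> int (size ts)" "mark_count m (take (nat (k + w)) (inorder ts)) = k"
  shows "take (nat (k + w)) (keys ts) = take (nat (k + c)) (keys ts) @ take (nat (w - c)) (drop (nat c) (keys us))"
    "fst ` set (filter (\<lambda>e. snd e = m) (take (nat (k + w)) (inorder ts))) =
      fst ` set (filter (\<lambda>e. snd e = m) (take (nat (k + c)) (inorder ts)))"
proof -
  have e: "nat (k + w) - nat (k + c) = nat (w - c)" "nat (k + c) - nat k = nat c" using dp_k assms(1) by linarith+
  have kc: "mark_count m (take (nat (k + c)) (inorder ts)) = int (nat k)" using inv dp_k by (auto simp: dp_inv_def)
  have s: "take (nat (k + w)) (inorder ts) = take (nat (k + c)) (inorder ts) @ take (nat (w - c)) (drop (nat c) (inorder us))"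
    using segment_unmarked[OF dp_marks _ _ kc, of "nat (k + w)", folded dp_us(1), unfolded e] assms dp_k(1) by simp
  from arg_cong[OF this, of "map fst"]
  show "take (nat (k + w)) (keys ts) = take (nat (k + c)) (keys ts) @ take (nat (w - c)) (drop (nat c) (keys us))"
    by (simp add: take_map drop_map)
  have "filter (\<lambda>e. snd e = m) (take (nat (w - c)) (drop (nat c) (inorder us))) = []"
    using dp_marks(2) unfolding filter_empty_conv dp_us(1) by (metis (mono_tags, lifting) in_set_dropD in_set_takeD mem_Collect_eq set_filter)
  then show "fst ` set (filter (\<lambda>e. snd e = m) (take (nat (k + w)) (inorder ts))) =
      fst ` set (filter (\<lambda>e. snd e = m) (take (nat (k + c)) (inorder ts)))"
    unfolding s filter_append by simp
qed

text \<open>Keys of the snapshot are distinct, so a key determines its mark.\<close>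

lemma dp_q_disjoint: "set (keys q) \<inter> set (keys us) = {}"
proof -
  have d: "distinct (map fst (inorder ts))" using inv by (simp add: dp_inv_def)
  have "x = y" if "x \<in> set (inorder ts)" "y \<in> set (inorder ts)" "fst x = fst y" for x y
    using that d by (metis distinct_map inj_onD)
  moreover have "set (keys q) \<subseteq> fst ` {e \<in> set (inorder ts). snd e = m}"
  proof -
    have "set (keys q) \<subseteq> fst ` set (filter (\<lambda>e. snd e = m) (take (nat (k + c)) (inorder ts)))"
      using inv unfolding dp_inv_def by blast
    also have "\<dots> \<subseteq> fst ` {e \<in> set (inorder ts). snd e = m}"
      by (intro image_mono) (auto dest: in_set_takeD)
    finally show ?thesis .
  qed
  moreover have "set (keys us) = fst ` {e \<in> set (inorder ts). snd e = 0}"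
    by (simp add: dp_us(1))
  ultimately show ?thesis using dp_marks(2) by (smt (verit, best) disjoint_iff image_iff mem_Collect_eq subset_iff)
qed

lemma dp_bump:
  assumes "c < w" "w = limit (DP ts us m k c v q cost dn)" "rank (fst (get c us)) q < int (size q)"
  shows "dp_inv ts us m k (c + 1) v (del (rank (fst (get c us)) q) q) (cost + 1) 0"
proof -
  note L = dp_limit[OF assms(2)]
  define u where "u = fst (get c us)"
  have c: "0 \<le> c" "c < int (size us)" using dp_k L assms(1) by auto
  have u: "u = keys us ! nat c" using c by (simp add: u_def get_inorder)
  have kc: "mark_count m (take (nat (k + c)) (inorder ts)) = k" using inv by (auto simp: dp_inv_def)
  have kc1: "mark_count m (take (nat (k + (c + 1))) (inorder ts)) = k"
  proof -
    have "nat (k + c) \<le> nat (k + (c + 1))" "nat (k + (c + 1)) \<le> nat (k + w)"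
      using assms(1) by (intro nat_mono; linarith)+
    from this[THEN mark_count_take_mono, of m "inorder ts"] show ?thesis using kc L(4) by simp
  qed
  have size: "k + (c + 1) \<le> int (size ts)" using L assms(1) by linarith
  have cc: "c \<le> c + 1" by simp
  note S = dp_segment[OF cc size kc1]
  have dc: "drop (nat c) (keys us) = u # drop (nat (c + 1)) (keys us)"
  proof -
    have "nat (c + 1) = Suc (nat c)" using c by simp
    then show ?thesis unfolding u using Cons_nth_drop_Suc[of "nat c" "keys us"] c by simp
  qed
  have tc: "take (nat (c + 1)) (keys us) = take (nat c) (keys us) @ [u]"
  proof -
    have "nat (c + 1) = Suc (nat c)" using c by simp
    then show ?thesis unfolding u using take_Suc_conv_app_nth[of "nat c" "keys us"] c by simp
  qed
  have us: "keys us = take (nat c) (keys us) @ u # drop (nat (c + 1)) (keys us)"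
    using dc by (metis append_take_drop_id)
  have less: "\<forall>t\<in>set (take (nat c) (keys us)). t < u"
    using dp_us(2) us by (metis (no_types, lifting) list.set_intros(1) sorted_wrt_append)
  have uu: "u \<in> set (keys us)" "u \<in> set (keys v)"
    using us inv dc by (metis in_set_conv_decomp, auto simp: dp_inv_def)
  let ?T = "tails (take (nat (k + c)) (keys ts))"
  have T: "?T = (set (keys v) \<inter> set (take (nat c) (keys us))) \<union> set (keys q)"
    using inv by (simp add: dp_inv_def)
  have uq: "u \<notin> set (keys q)" using uu(1) dp_q_disjoint by blast
  have sq: "sorted_wrt (<) (keys q)" using inv by (simp add: dp_inv_def)
  define y where "y = fst (get (rank u q) q)"
  have y: "y \<in> set (keys q)" "u < y" "\<forall>z\<in>set (keys q). u < z \<longrightarrow> y \<le> z"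
    using rank_successor(2)[OF sq uq] assms(3) by (auto simp: y_def u_def)
  note D = keys_del[OF sq rank_bounds(1)[of u q] assms(3)[folded u_def]]
  \<comment> \<open>The unmarked tails precede u in \<open>us\<close> and are smaller, so the least
    tail above u is the successor of u in q.\<close>
  have b: "bump ?T u = insert u (?T - {y})"
    using y less unfolding T by (intro bump_successor) auto
  have t1: "tails (take (nat (k + (c + 1))) (keys ts)) = insert u (?T - {y})"
    using S(1) dc tails_snoc[of "take (nat (k + c)) (keys ts)" u] b by simp
  have uT: "u \<notin> ?T" using uq less unfolding T by blast
  have card: "card (insert u (?T - {y})) = card ?T"
  proof -
    have "card ?T = Suc (card (?T - {y}))" using y(1) finite_tails unfolding T[symmetric] by (intro card.remove) (auto simp: T)
    then show ?thesis using uT finite_tails by simp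
  qed
  have yv: "y \<notin> set (keys us)" using y(1) dp_q_disjoint by blast
  have vu: "set (keys v) \<subseteq> set (keys us)" using inv unfolding dp_inv_def by blast
  have "insert u (?T - {y}) = (set (keys v) \<inter> set (take (nat (c + 1)) (keys us))) \<union> set (keys (del (rank u q) q))"
    unfolding D T tc y_def[symmetric] using uu yv vu by auto
  then have 1: "tails (take (nat (k + (c + 1))) (keys ts)) =
      (set (keys v) \<inter> set (take (nat (c + 1)) (keys us))) \<union> set (keys (del (rank u q) q))"
    unfolding t1 .
  have 2: "set (drop (nat (c + 1)) (keys us)) \<subseteq> set (keys v)"
  proof -
    have "set (drop (nat c) (keys us)) \<subseteq> set (keys v)" using inv unfolding dp_inv_def by blast
    moreover have "set (drop (nat (c + 1)) (keys us)) \<subseteq> set (drop (nat c) (keys us))"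
      unfolding dc by (rule set_subset_Cons)
    ultimately show ?thesis by (rule subset_trans[rotated])
  qed
  have 3: "set (keys (del (rank u q) q)) \<subseteq> fst ` set (filter (\<lambda>e. snd e = m) (take (nat (k + (c + 1))) (inorder ts)))"
  proof -
    have "set (keys q) \<subseteq> fst ` set (filter (\<lambda>e. snd e = m) (take (nat (k + c)) (inorder ts)))"
      using inv unfolding dp_inv_def by (elim conjE)
    then show ?thesis unfolding D S(2) by (rule subset_trans[OF Diff_subset])
  qed
  have 4: "cost + 1 = k + (c + 1) - int (card (tails (take (nat (k + (c + 1))) (keys ts))))"
    unfolding t1 card using inv unfolding dp_inv_def by simp
  have 5: "0 \<le> c + 1" "(0::int) = 0 \<or> (0::int) = 1 \<and> cost + 1 = int (dtm (keys ts))" "avl (del (rank u q) q)"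
    using c avl_del[of q "rank u q"] inv by (auto simp: dp_inv_def)
  show ?thesis
    unfolding dp_inv_def u_def[symmetric]
    using inv[unfolded dp_inv_def] 1 2 3 4 5 D(1) kc1 size
    by (elim conjE, intro conjI) assumption+
qed

text \<open>The elements of a run are in v from the beginning and become tails by the mere increase
  of c; no tree changes. Elements read and tails grow alike, so the cost stays.\<close>

lemma dp_advance:
  assumes "w = limit (DP ts us m k c v q cost dn)" "\<not> (c < w \<and> rank (fst (get c us)) q < int (size q))"
  shows "dp_inv ts us m k w v q cost 0"
proof -
  note L = dp_limit[OF assms(1)]
  note S = dp_segment[OF L(1,3,4)]
  let ?T = "tails (take (nat (k + c)) (keys ts))"
  let ?b = "take (nat (w - c)) (drop (nat c) (keys us))"
  have T: "?T = (set (keys v) \<inter> set (take (nat c) (keys us))) \<union> set (keys q)"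
    using inv by (simp add: dp_inv_def)
  have sq: "sorted_wrt (<) (keys q)" using inv by (simp add: dp_inv_def)
  have us: "take (nat w) (keys us) = take (nat c) (keys us) @ ?b"
    using L(1) dp_k(3) by (metis take_add nat_add_distrib add_diff_inverse_nat diff_add_cancel diff_ge_0_iff_ge add.commute)
  have sus: "sorted_wrt (<) (take (nat w) (keys us))" using dp_us(2) by (rule sorted_wrt_take)
  have sb: "sorted_wrt (<) ?b" using sus unfolding us by (simp add: sorted_wrt_append)
  \<comment> \<open>By assumption no marked tail exceeds the first element of the run, and the
    unmarked tails stand before the run in an increasing sequence.\<close>
  have less: "\<forall>t\<in>?T. \<forall>y\<in>set ?b. t < y"
  proof (cases "c < w")
    case True
    define u where "u = fst (get c us)"
    have c: "0 \<le> c" "c < int (size us)" using dp_k L True by auto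
    have u: "u = keys us ! nat c" using c by (simp add: u_def get_inorder)
    have d: "drop (nat c) (keys us) = u # drop (Suc (nat c)) (keys us)"
      unfolding u using Cons_nth_drop_Suc[of "nat c" "keys us"] c by simp
    have "u \<in> set (keys us)" using d by (metis in_set_dropD list.set_intros(1))
    then have uq: "u \<notin> set (keys q)" using dp_q_disjoint by blast
    have "\<not> (\<exists>y\<in>set (keys q). u < y)"
      using rank_successor(1)[OF sq uq] assms(2) True by (simp add: u_def)
    then have q: "\<forall>t\<in>set (keys q). t < u" using uq by (metis linorder_neqE_linordered_idom)
    have "sorted_wrt (<) (drop (nat c) (keys us))" using dp_us(2) by (rule sorted_wrt_drop)
    then have "\<forall>y\<in>set (drop (nat c) (keys us)). u \<le> y" unfolding d by auto
    then have b: "\<forall>y\<in>set ?b. u \<le> y" by (meson in_set_takeD)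
    have "\<forall>t\<in>set (take (nat c) (keys us)). \<forall>y\<in>set ?b. t < y"
      using sus unfolding us by (simp add: sorted_wrt_append)
    then show ?thesis unfolding T using q b by fastforce
  qed (use L(1) in auto)
  have t: "tails (take (nat (k + w)) (keys ts)) = ?T \<union> set ?b"
    unfolding S(1) using tails_append_increasing[OF sb less] .
  have bv: "set ?b \<subseteq> set (keys v)"
    using inv unfolding dp_inv_def by (meson in_set_takeD subset_iff)
  have dis: "?T \<inter> set ?b = {}" using less by fastforce
  have lb: "card (set ?b) = nat (w - c)"
  proof -
    have "distinct ?b" using sb by (simp add: strict_sorted_iff)
    then have "card (set ?b) = length ?b" by (rule distinct_card)
    then show ?thesis using L(1,2) dp_k(3) by simp
  qed
  have card: "card (?T \<union> set ?b) = card ?T + nat (w - c)"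
    using card_Un_disjoint[OF finite_tails _ dis] lb by simp
  have v: "set (drop (nat w) (keys us)) \<subseteq> set (drop (nat c) (keys us))"
    using L(1) by (intro set_drop_subset_set_drop) simp
  have 1: "tails (take (nat (k + w)) (keys ts)) = (set (keys v) \<inter> set (take (nat w) (keys us))) \<union> set (keys q)"
    unfolding t T us set_append using bv by blast
  have 2: "set (drop (nat w) (keys us)) \<subseteq> set (keys v)"
    using v inv unfolding dp_inv_def by blast
  have 3: "set (keys q) \<subseteq> fst ` set (filter (\<lambda>e. snd e = m) (take (nat (k + w)) (inorder ts)))"
    unfolding S(2) using inv unfolding dp_inv_def by blast
  have 4: "cost = k + w - int (card (tails (take (nat (k + w)) (keys ts))))"
    unfolding t card using inv L(1) unfolding dp_inv_def by simp
  have 5: "0 \<le> w" "(0::int) = 0 \<or> (0::int) = 1 \<and> cost = int (dtm (keys ts))"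
    using L(1) dp_k(3) by auto
  show ?thesis
    unfolding dp_inv_def
    using inv[unfolded dp_inv_def] 1 2 3 4 5 L(3,4)
    by (elim conjE, intro conjI) assumption+
qed

end

text \<open>The invariant is assumed for the state in which the run up to w has been read, while the
  code still holds the old c: the run and the marked element behind it are read in one step, which
  overwrites c by w.\<close>

lemma s_step_ok:
  assumes inv: "dp_inv ts us m k w v q cost 0" and w: "w = limit (DP ts us m k w v q cost 0)"
    and k: "k < mark_count m (inorder ts)"
  shows "dp_ok (s_step w (fst (get (k + w) ts)) (DP ts us m k c v q cost dn))" (is "dp_ok ?d")
    "dp_measure (s_step w (fst (get (k + w) ts)) (DP ts us m k c v q cost dn)) <
      nat (2 * (mark_count m (inorder ts) - k)) + size q + 1"
proof -
  note L = dp_limit[OF inv w]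
  have kw: "0 \<le> k" "0 \<le> w" "w \<le> int (size us)" using dp_k[OF inv] by auto
  define i where "i = nat (k + w)"
  have i2: "k + w = int i" using kw by (simp add: i_def)
  have i: "i < size ts" "k + w = int i" using L(5)[OF k] i2 by linarith+
  define s where "s = fst (get (k + w) ts)"
  have s: "s = fst (inorder ts ! i)" "snd (inorder ts ! i) = m"
    using i L(5)[OF k] unfolding i_def[symmetric] by (simp_all add: s_def get_inorder)
  have i1: "nat (k + 1 + w) = Suc i" using i by linarith
  have t1: "take (Suc i) (inorder ts) = take i (inorder ts) @ [inorder ts ! i]"
    using i by (simp add: take_Suc_conv_app_nth)
  have t2: "take (Suc i) (keys ts) = take i (keys ts) @ [s]"
    using arg_cong[OF t1, of "map fst"] by (simp add: take_map s(1))
  have dist: "distinct (keys ts)" using inv by (simp add: dp_inv_def)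
  have "distinct (take (Suc i) (keys ts))" using dist by (rule distinct_take)
  then have snew: "s \<notin> set (take i (keys ts))" unfolding t2 by simp
  let ?T = "tails (take i (keys ts))"
  have T: "?T = (set (keys v) \<inter> set (take (nat w) (keys us))) \<union> set (keys q)"
    using inv by (simp add: dp_inv_def i_def)
  have sT: "s \<notin> ?T" using snew tails_subset by blast
  then have sq: "s \<notin> set (keys q)" using T by blast
  have "inj_on fst (set (inorder ts))" using dist by (simp add: distinct_map)
  moreover have "inorder ts ! i \<in> set (inorder ts)" by (rule nth_mem) (use i in simp)
  moreover have "inorder ts ! i \<notin> {e \<in> set (inorder ts). snd e = 0}" using s(2) dp_marks(2)[OF inv] by simp
  ultimately have "s \<notin> fst ` {e \<in> set (inorder ts). snd e = 0}"
    unfolding s(1) by (metis (no_types, lifting) image_iff inj_onD mem_Collect_eq)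
  then have su: "s \<notin> set (keys us)" using dp_us(1)[OF inv] by simp
  have vu: "set (keys v) \<subseteq> set (keys us)" using inv unfolding dp_inv_def by blast
  then have sv: "s \<notin> set (keys v)" using su by blast
  have srt: "sorted_wrt (<) (keys v)" "sorted_wrt (<) (keys q)" using inv by (simp_all add: dp_inv_def)
  have mc: "mark_count m (take (nat (k + 1 + w)) (inorder ts)) = k + 1"
    using inv s(2) unfolding i1 t1 by (simp add: dp_inv_def i_def)
  have tl: "tails (take (nat (k + 1 + w)) (keys ts)) = bump ?T s"
    unfolding i1 t2 tails_snoc ..
  have cost: "cost = k + w - int (card ?T)" using inv by (simp add: dp_inv_def i_def)
  have qf: "insert s (set (keys q)) \<subseteq> fst ` set (filter (\<lambda>e. snd e = m) (take (nat (k + 1 + w)) (inorder ts)))"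
  proof -
    have "set (keys q) \<subseteq> fst ` set (filter (\<lambda>e. snd e = m) (take i (inorder ts)))"
      using inv unfolding dp_inv_def i_def by blast
    then show ?thesis using s unfolding i1 t1 by auto
  qed
  have size: "k + 1 + w \<le> int (size ts)" using i by simp
  have finish: "dp_inv ts us m (k + 1) w v' q' cost' 0"
    if "avl v'" "avl q'" "sorted_wrt (<) (keys v')" "sorted_wrt (<) (keys q')"
      "bump ?T s = (set (keys v') \<inter> set (take (nat w) (keys us))) \<union> set (keys q')"
      "set (drop (nat w) (keys us)) \<subseteq> set (keys v')" "set (keys v') \<subseteq> set (keys us)"
      "set (keys q') \<subseteq> insert s (set (keys q))" "cost' = k + 1 + w - int (card (bump ?T s))"
    for v' q' cost'
  proof -
    have 1: "set (keys q') \<subseteq> fst ` set (filter (\<lambda>e. snd e = m) (take (nat (k + 1 + w)) (inorder ts)))"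
      using that(8) qf by blast
    have 2: "(0::int) = 0 \<or> (0::int) = 1 \<and> cost' = int (dtm (keys ts))" "0 \<le> k + 1" using kw by auto
    show ?thesis
      unfolding dp_inv_def tl
      using inv[unfolded dp_inv_def] that 1 2 mc size
      by (elim conjE, intro conjI) assumption+
  qed
  have av: "avl v" "avl q" using inv by (simp_all add: dp_inv_def)
  have dv: "set (drop (nat w) (keys us)) \<subseteq> set (keys v)" using inv unfolding dp_inv_def by blast
  have card: "card (insert s (?T - {y})) = card ?T" if "y \<in> ?T" for y
    using sT card.remove[OF finite_tails that] finite_tails by simp
  have insq: "set (keys (ins (rank s q) (s, 0) q)) = insert s (set (keys q))"
    "sorted_wrt (<) (keys (ins (rank s q) (s, 0) q))" "avl (ins (rank s q) (s, 0) q)"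
    using keys_ins[OF srt(2) sq] avl_ins[OF av(2)] by auto
  have vless: "rank (fst (get (rank s v) v)) us < w \<longleftrightarrow> fst (get (rank s v) v) \<in> set (take (nat w) (keys us))"
    if "rank s v < int (size v)"
  proof -
    have "fst (get (rank s v) v) \<in> set (keys us)" using rank_successor(2)[OF srt(1) sv that] vu by blast
    moreover have "nat w \<le> size us" "int (nat w) = w" using kw by simp_all
    ultimately show ?thesis using rank_less_iff[OF dp_us(2)[OF inv], of _ "nat w"] by metis
  qed
  define hasv where "hasv \<longleftrightarrow> rank s v < int (size v) \<and> rank (fst (get (rank s v) v)) us < w"
  \<comment> \<open>A read element t > s of v is at least the successor y of s in v. But y is
    unread, hence stands behind t in \<open>us\<close> and exceeds t.\<close>
  have nov: "\<forall>t\<in>set (keys v) \<inter> set (take (nat w) (keys us)). \<not> s < t" if "\<not> hasv"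
  proof (intro ballI notI)
    fix t assume t: "t \<in> set (keys v) \<inter> set (take (nat w) (keys us))" "s < t"
    then have r: "rank s v < int (size v)" using rank_successor(1)[OF srt(1) sv] by blast
    let ?y = "fst (get (rank s v) v)"
    have y: "?y \<in> set (keys v)" "?y \<le> t" using rank_successor(2)[OF srt(1) sv r] t by auto
    have "?y \<notin> set (take (nat w) (keys us))" using vless[OF r] r that by (simp add: hasv_def)
    moreover have us: "keys us = take (nat w) (keys us) @ drop (nat w) (keys us)" by simp
    ultimately have "?y \<in> set (drop (nat w) (keys us))" using y(1) vu by (metis UnE set_append subsetD)
    moreover have "sorted_wrt (<) (take (nat w) (keys us) @ drop (nat w) (keys us))"
      using dp_us(2)[OF inv] us by simp
    ultimately have "t < ?y" using t(1) unfolding sorted_wrt_append by blast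
    then show False using y(2) by simp
  qed
  have "dp_ok ?d \<and> dp_measure ?d < nat (2 * (mark_count m (inorder ts) - k)) + size q + 1"
  proof (cases "hasv \<and> \<not> (rank s q < int (size q) \<and> fst (get (rank s q) q) < fst (get (rank s v) v))")
    case True
    let ?y = "fst (get (rank s v) v)"
    have r: "rank s v < int (size v)" using True by (simp add: hasv_def)
    have y: "?y \<in> set (keys v)" "s < ?y" "\<forall>t\<in>set (keys v). s < t \<longrightarrow> ?y \<le> t" "?y \<in> set (take (nat w) (keys us))"
      using rank_successor(2)[OF srt(1) sv r] vless[OF r] True by (auto simp: hasv_def)
    have yq: "?y \<le> t" if "t \<in> set (keys q)" "s < t" for t
      using rank_successor[OF srt(2) sq] that True by fastforce
    have b: "bump ?T s = insert s (?T - {?y})"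
      using y yq by (intro bump_successor finite_tails) (auto simp: T)
    have yT: "?y \<in> ?T" using y by (simp add: T)
    have yq': "?y \<notin> set (keys q)" using dp_q_disjoint[OF inv] y(1) vu by blast
    note D = keys_del[OF srt(1) rank_bounds(1)[of s v] r]
    have yd: "?y \<notin> set (drop (nat w) (keys us))"
    proof -
      have "distinct (take (nat w) (keys us) @ drop (nat w) (keys us))"
        using dp_us(2)[OF inv] by (simp add: strict_sorted_iff)
      then show ?thesis using y(4) unfolding distinct_append by blast
    qed
    have dv': "set (drop (nat w) (keys us)) \<subseteq> set (keys (del (rank s v) v))"
      "set (keys (del (rank s v) v)) \<subseteq> set (keys us)"
      unfolding D using dv vu yd by blast+
    have "dp_inv ts us m (k + 1) w (del (rank s v) v) (ins (rank s q) (s, 0) q) (cost + 1) 0"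
    proof (rule finish)
      show "bump ?T s = (set (keys (del (rank s v) v)) \<inter> set (take (nat w) (keys us))) \<union> set (keys (ins (rank s q) (s, 0) q))"
        unfolding b unfolding D insq T using yq' by blast
      show "cost + 1 = k + 1 + w - int (card (bump ?T s))" unfolding b card[OF yT] using cost by simp
    qed (use D(1) dv' insq avl_del[OF av(1)] in simp_all)
    moreover have "?d = DP ts us m (k + 1) w (del (rank s v) v) (ins (rank s q) (s, 0) q) (cost + 1) 0"
      using True by (simp add: s_def[symmetric] hasv_def Let_def)
    ultimately show ?thesis using k by simp
  next
    case F: False
    have d: "?d = q_step w s (rank s q) (DP ts us m k c v q cost dn)"
      using F unfolding s_step.simps s_def[symmetric] hasv_def Let_def by meson
    show ?thesis
    proof (cases "rank s q < int (size q)")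
      case True
      let ?y = "fst (get (rank s q) q)"
      have y: "?y \<in> set (keys q)" "s < ?y" "\<forall>t\<in>set (keys q). s < t \<longrightarrow> ?y \<le> t"
        using rank_successor(2)[OF srt(2) sq True] by auto
      have yv: "?y \<le> t" if "t \<in> set (keys v) \<inter> set (take (nat w) (keys us))" "s < t" for t
      proof (cases hasv)
        case h: True
        then have "?y < fst (get (rank s v) v)" using F by blast
        also have "\<dots> \<le> t" using h that rank_successor(2)[OF srt(1) sv] by (auto simp: hasv_def)
        finally show ?thesis by simp
      qed (use nov that in blast)
      have b: "bump ?T s = insert s (?T - {?y})"
        using y yv by (intro bump_successor finite_tails) (auto simp: T)
      have yT: "?y \<in> ?T" using y by (simp add: T)
      have yu: "?y \<notin> set (keys us)" using dp_q_disjoint[OF inv] y(1) by blast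
      note D = keys_del[OF srt(2) rank_bounds(1)[of s q] True]
      let ?q = "del (rank s q) q"
      have sq': "s \<notin> set (keys ?q)" using sq D by blast
      \<comment> \<open>The removed key is larger than s, so the insertion index computed before the
        removal is still right.\<close>
      have re: "rank s ?q = rank s q"
      proof -
        have "{t \<in> set (keys ?q). t < s} = {t \<in> set (keys q). t < s}" unfolding D using y(2) by auto
        then have "int (card {t \<in> set (keys ?q). t < s}) = int (card {t \<in> set (keys q). t < s})" by (simp only:)
        with rank_card[OF D(1), of s] rank_card[OF srt(2), of s] show ?thesis by (simp only:)
      qed
      have insq': "set (keys (ins (rank s q) (s, 0) ?q)) = insert s (set (keys q) - {?y})"
        "sorted_wrt (<) (keys (ins (rank s q) (s, 0) ?q))" "avl (ins (rank s q) (s, 0) ?q)"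
        using keys_ins[OF D(1) sq', unfolded re D(2)]
        conjunct1[OF avl_ins[OF conjunct1[OF avl_del[OF av(2)]]]] by simp_all
      have "dp_inv ts us m (k + 1) w v (ins (rank s q) (s, 0) ?q) (cost + 1) 0"
      proof (rule finish)
        show "bump ?T s = (set (keys v) \<inter> set (take (nat w) (keys us))) \<union> set (keys (ins (rank s q) (s, 0) ?q))"
          unfolding b unfolding insq' T using yu vu by blast
        show "cost + 1 = k + 1 + w - int (card (bump ?T s))" unfolding b card[OF yT] using cost by simp
      qed (use dv vu srt insq' av in auto)
      then show ?thesis unfolding d using True k size_del[OF rank_bounds(1)[of s q] True] rank_bounds(1)[of s q] by simp
    next
      case q: False
      have "\<not> hasv" using F q by blast
      then have b: "bump ?T s = insert s ?T"
        using nov rank_successor(1)[OF srt(2) sq] q by (intro bump_top) (auto simp: T)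
      have c: "card (insert s ?T) = card ?T + 1" using sT finite_tails by simp
      have "dp_inv ts us m (k + 1) w v (ins (rank s q) (s, 0) q) cost 0"
      proof (rule finish)
        show "bump ?T s = (set (keys v) \<inter> set (take (nat w) (keys us))) \<union> set (keys (ins (rank s q) (s, 0) q))"
          unfolding b unfolding insq T by blast
        show "cost = k + 1 + w - int (card (bump ?T s))" unfolding b c using cost by simp
      qed (use dv vu srt insq av in auto)
      then show ?thesis unfolding d using q k by simp
    qed
  qed
  then show "dp_ok ?d" "dp_measure ?d < nat (2 * (mark_count m (inorder ts) - k)) + size q + 1" by auto
qed

lemma dp_finish:
  assumes "dp_inv ts us m k w v q cost 0" "k + w = int (size ts)"
  shows "cost = int (dtm (keys ts))"
proof -
  have "nat (k + w) = length (keys ts)" using assms(2) by simp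
  then have "tails (take (nat (k + w)) (keys ts)) = tails (keys ts)" by simp
  moreover have "dtm (keys ts) + card (tails (keys ts)) = size ts"
    using dtm_tails[of "keys ts"] assms(1) by (simp add: dp_inv_def)
  ultimately show ?thesis using assms unfolding dp_inv_def by simp
qed

lemma dp_step_ok:
  assumes "dp_ok d"
  shows "dp_ok (dp_step d)" "dp_measure d \<noteq> 0 \<Longrightarrow> dp_measure (dp_step d) < dp_measure d"
proof -
  obtain ts us m k c v q cost dn where d: "d = DP ts us m k c v q cost dn" by (cases d)
  have inv: "dp_inv ts us m k c v q cost dn" using assms d by simp
  have dn: "dn = 0 \<or> dn = 1" using inv by (auto simp: dp_inv_def)
  have "dp_ok (dp_step d) \<and> (dp_measure d \<noteq> 0 \<longrightarrow> dp_measure (dp_step d) < dp_measure d)"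
  proof (cases "dn = 1")
    case True
    then show ?thesis using inv d by simp
  next
    case False
    then have dn0: "dn = 0" using dn by simp
    define w where "w = limit d"
    have w: "w = limit (DP ts us m k c v q cost dn)" by (simp add: w_def d)
    have w': "w = limit (DP ts us m k w v q cost 0)" by (simp add: w_def d)
    note L = dp_limit[OF inv w]
    have st: "dp_step d = bump_step w (DP ts us m k c v q cost dn)" using dn0 d w by simp
    show ?thesis
    proof (cases "c < w \<and> rank (fst (get c us)) q < int (size q)")
      case True
      have "dp_inv ts us m k (c + 1) v (del (rank (fst (get c us)) q) q) (cost + 1) 0"
        using dp_bump[OF inv _ w] True by blast
      moreover have res: "dp_step d = DP ts us m k (c + 1) v (del (rank (fst (get c us)) q) q) (cost + 1) 0"
        unfolding st bump_step.simps using True by (rule if_P)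
      ultimately show ?thesis
        unfolding res unfolding d using True dn0 size_del[OF rank_bounds(1)[of "fst (get c us)" q], of q]
          rank_bounds(1)[of "fst (get c us)" q] by simp
    next
      case False
      have st: "dp_step d = next_step w (DP ts us m k c v q cost dn)" using st False by auto
      note A = dp_advance[OF inv w False]
      show ?thesis
      proof (cases "k < mark_count m (inorder ts)")
        case True
        then have "dp_step d = s_step w (fst (get (k + w) ts)) (DP ts us m k c v q cost dn)" using st by simp
        then show ?thesis using s_step_ok[OF A w' True] d dn0 by simp
      next
        case k: False
        \<comment> \<open>The counter c is not advanced over the final run, since reading it would
          not change the cost.\<close>
        then have "dp_step d = DP ts us m k c v q cost 1" using st by simp
        moreover have "cost = int (dtm (keys ts))" using dp_finish[OF A] L(6)[OF k] by simp
        then have "dp_inv ts us m k c v q cost 1" using inv unfolding dp_inv_def by blast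
        ultimately show ?thesis using d dn0 by simp
      qed
    qed
  qed
  then show "dp_ok (dp_step d)" "dp_measure d \<noteq> 0 \<Longrightarrow> dp_measure (dp_step d) < dp_measure d" by auto
qed

section \<open>Updating the marked sequence\<close>

definition tree_inv :: "elem tree \<Rightarrow> elem tree \<Rightarrow> bool" where
  "tree_inv T U \<longleftrightarrow> avl T \<and> avl U \<and> inorder U = filter (\<lambda>e. snd e = 0) (inorder T) \<and>
     sorted_wrt (<) (keys U) \<and> distinct (keys T) \<and>
     (\<forall>e\<in>set (inorder T). snd e = 0 \<or> snd e = 1 \<or> snd e = 2)"

definition marked :: "int \<Rightarrow> elem list \<Rightarrow> real list" where
  "marked m xs = map fst (filter (\<lambda>e. snd e = m) xs)"

text \<open>Disjoint inverted pairs have excess at most 0. Deletions can leave elements without a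
  partner, but each raises the excess by at most 1, so in a round it is bounded by the number of
  updates.\<close>

definition excess :: "int \<Rightarrow> elem list \<Rightarrow> int" where
  "excess m xs = int (length (marked m xs)) - 2 * int (dtm (marked m xs))"

lemma marked_simps [simp]:
  "marked m [] = []"
  "marked m (e # xs) = (if snd e = m then fst e # marked m xs else marked m xs)"
  "marked m (xs @ ys) = marked m xs @ marked m ys"
  by (auto simp: marked_def)

lemma length_marked: "int (length (marked m xs)) = mark_count m xs"
  by (simp add: marked_def mark_count_def)

lemma subseq_marked: "subseq (marked m xs) (map fst xs)"
  unfolding marked_def by (intro subseq_map) simp

lemma excess_pair:
  assumes "y < x"
  shows "excess m (as @ (x, m) # bs @ (y, m) # cs) \<le> excess m (as @ bs @ cs)"
  using dtm_insert_inverted[OF assms, of "marked m as" "marked m bs" "marked m cs"]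
  by (simp add: excess_def)

text \<open>The length drops by one and the distance by at most one, which changes the excess by at
  most 2 - 1.\<close>

lemma excess_delete: "excess m (as @ bs) \<le> excess m (as @ e # bs) + 1"
  using dtm_insert(2)[of "marked m as" "fst e" "marked m bs"] dtm_insert(1)[of "marked m as" "marked m bs" "fst e"]
  by (simp add: excess_def)

lemma filter_nth:
  assumes "i < length xs" "P (xs ! i)"
  shows "filter P xs ! length (filter P (take i xs)) = xs ! i" "length (filter P (take i xs)) < length (filter P xs)"
proof -
  have "filter P xs = filter P (take i xs) @ xs ! i # filter P (drop (Suc i) xs)"
    using assms(2) arg_cong[OF id_take_nth_drop[OF assms(1)], of "filter P"] by (simp only: filter_append filter.simps if_True)
  then show "filter P xs ! length (filter P (take i xs)) = xs ! i" "length (filter P (take i xs)) < length (filter P xs)"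
    by simp_all
qed

lemma mark_count_U: "tree_inv T U \<Longrightarrow> mark_count 0 (inorder T) = int (size U)"
  unfolding tree_inv_def mark_count_def by (metis length_inorder)

lemma avl_insI: "avl t \<Longrightarrow> avl (ins i a t)"
  by (rule conjunct1[OF avl_ins])

lemma avl_delI: "avl t \<Longrightarrow> avl (del i t)"
  by (rule conjunct1[OF avl_del])

lemma tree_invD:
  assumes "tree_inv T U"
  shows "avl T" "avl U" "inorder U = filter (\<lambda>e. snd e = 0) (inorder T)" "sorted_wrt (<) (keys U)"
    "distinct (keys T)" "\<forall>e\<in>set (inorder T). snd e = 0 \<or> snd e = 1 \<or> snd e = 2"
  by (insert assms[unfolded tree_inv_def], elim conjE, assumption)+

lemma distinct_insert_at: "distinct xs \<Longrightarrow> x \<notin> set xs \<Longrightarrow> distinct (take n xs @ x # drop n xs)"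
  using set_take_disj_set_drop_if_distinct[of xs n n] by (auto dest: in_set_takeD in_set_dropD)

text \<open>With p unmarked elements to the left of position j, the disjunction says that x and the
  element q of U form an inversion, with the partner on the left or on the right of x. So
  \<open>excess_pair\<close> applies on either side.\<close>

lemma conflict_spec:
  assumes inv: "tree_inv T U" and q: "0 \<le> q" "q < int (size U)" and j: "0 \<le> j" "j \<le> int (size T)"
    and x: "x \<notin> set (keys T)" and m: "m = 1 \<or> m = 2"
    and c: "mark_count 0 (take (nat j) (inorder T)) = p"
      "(q < p \<and> x < fst (get q U)) \<or> (p \<le> q \<and> fst (get q U) < x)"
  shows "tree_inv (fst (conflict j x m q T U)) (snd (conflict j x m q T U)) \<and>
    keys (fst (conflict j x m q T U)) = take (nat j) (keys T) @ x # drop (nat j) (keys T) \<and>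
    mark_count (3 - m) (inorder (fst (conflict j x m q T U))) = mark_count (3 - m) (inorder T) \<and>
    excess m (inorder (fst (conflict j x m q T U))) \<le> excess m (inorder T)"
proof -
  let ?xs = "inorder T"
  define i where "i = nat (select 0 q T)"
  have "q < mark_count 0 ?xs" using q(2) mark_count_U[OF inv] by simp
  from select_inorder[OF q(1) this] have i: "i < size T" "select 0 q T = int i" "snd (?xs ! i) = 0"
    "mark_count 0 (take i ?xs) = q" by (auto simp: i_def)
  define y where "y = fst (get q U)"
  have lq: "length (filter (\<lambda>e. snd e = 0) (take i ?xs)) = nat q" using i(4) by (simp add: mark_count_def)
  have xi: "?xs ! i = (y, 0)"
  proof -
    have "?xs ! i = inorder U ! nat q"
      using filter_nth(1)[of i ?xs "\<lambda>e. snd e = 0"] i lq inv by (simp add: tree_inv_def)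
    then have "?xs ! i = get q U" using q by (simp add: get_inorder)
    then show ?thesis using i(3) by (metis prod.collapse y_def)
  qed
  define A where "A = take i ?xs"
  define C where "C = drop (Suc i) ?xs"
  have xs: "?xs = A @ (y, 0) # C"
    unfolding A_def C_def xi[symmetric] by (rule id_take_nth_drop) (use i in simp)
  have lA: "length A = i" using i by (simp add: A_def)
  let ?T1 = "del (int i) T" and ?T2 = "ins (int i) (y, m) (del (int i) T)"
  have T1: "inorder ?T1 = A @ C" using i by (simp add: inorder_del A_def C_def)
  have s1: "size ?T1 = size T - 1" using i by (simp add: size_del)
  have T2: "inorder ?T2 = A @ (y, m) # C"
    using i s1 lA by (simp add: inorder_ins T1)
  have s2: "size ?T2 = size T" using s1 i by simp
  define T' where "T' = ins j (x, m) ?T2"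
  have T': "inorder T' = take (nat j) (A @ (y, m) # C) @ (x, m) # drop (nat j) (A @ (y, m) # C)"
    unfolding T'_def using j s2 by (simp add: inorder_ins T2)
  have conf: "conflict j x m q T U = (T', del q U)"
    by (simp add: conflict_def Let_def T'_def y_def i(2))
  have U': "inorder (del q U) = filter (\<lambda>e. snd e = 0) A @ filter (\<lambda>e. snd e = 0) C"
  proof -
    have "inorder U = filter (\<lambda>e. snd e = 0) A @ (y, 0) # filter (\<lambda>e. snd e = 0) C"
      using inv xs by (simp add: tree_inv_def)
    moreover have "length (filter (\<lambda>e. snd e = 0) A) = nat q" using lq by (simp add: A_def)
    ultimately show ?thesis using q by (simp add: inorder_del)
  qed
  have m0: "m \<noteq> 0" "3 - m \<noteq> 0" "3 - m \<noteq> m" using m by auto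
  have kT: "keys T = map fst A @ y # map fst C" by (simp add: xs)
  have kT': "keys T' = take (nat j) (keys T) @ x # drop (nat j) (keys T)"
  proof -
    have k: "keys T = map fst (A @ (y, m) # C)" using kT by simp
    show ?thesis unfolding T' k take_map drop_map by (simp only: map_append[of _ "take _ _"] list.map fst_conv)
  qed
  have zero: "filter (\<lambda>e. snd e = 0) (inorder T') = inorder (del q U)"
  proof -
    have "filter (\<lambda>e. snd e = 0) (inorder T') = filter (\<lambda>e. snd e = 0) (take (nat j) (A @ (y, m) # C) @ drop (nat j) (A @ (y, m) # C))"
      unfolding T' filter_append using m0 by simp
    also have "\<dots> = filter (\<lambda>e. snd e = 0) (A @ (y, m) # C)" by (simp only: append_take_drop_id)
    finally show ?thesis unfolding U' using m0 by simp
  qed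
  have "mark_count (3 - m) (inorder T') = mark_count (3 - m) (take (nat j) (A @ (y, m) # C)) + mark_count (3 - m) (drop (nat j) (A @ (y, m) # C))"
    unfolding T' using m0 by simp
  also have "\<dots> = mark_count (3 - m) (A @ (y, m) # C)"
    by (metis append_take_drop_id mark_count_simps(3))
  finally have mc: "mark_count (3 - m) (inorder T') = mark_count (3 - m) ?xs"
    unfolding xs using m0 by simp
  have ti: "tree_inv T' (del q U)"
    unfolding tree_inv_def zero
  proof (intro conjI)
    show "avl T'" unfolding T'_def by (intro avl_insI avl_delI tree_invD(1)[OF inv])
    show "avl (del q U)" by (intro avl_delI tree_invD(2)[OF inv])
    show "sorted_wrt (<) (keys (del q U))"
      by (rule keys_del(1)[OF _ q]) (rule tree_invD(4)[OF inv])
    show "distinct (keys T')"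
      unfolding kT' by (rule distinct_insert_at[OF tree_invD(5)[OF inv] x])
    have "set (inorder T') = insert (x, m) (set (A @ (y, m) # C))"
      unfolding T' by (metis append_take_drop_id list.set(2) set_append Un_insert_right)
    then show "\<forall>e\<in>set (inorder T'). snd e = 0 \<or> snd e = 1 \<or> snd e = 2"
      using inv m unfolding tree_inv_def xs by auto
  qed simp
  have ex: "excess m (inorder T') \<le> excess m ?xs"
  proof (cases "i < nat j")
    case True
    have "x < y"
    proof -
      have "mark_count 0 (take (Suc i) ?xs) \<le> p" using True c(1) mark_count_take_mono[of "Suc i" "nat j" 0 ?xs] by linarith
      moreover have "take (Suc i) ?xs = take i ?xs @ [(y, 0)]" using i xi by (simp add: take_Suc_conv_app_nth)
      ultimately have "q < p" using i(4) by simp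
      then show ?thesis using c(2) by (auto simp: y_def)
    qed
    define n where "n = nat j - i - 1"
    have "nat j = Suc (i + n)" using True by (simp add: n_def)
    then have "inorder T' = A @ (y, m) # take n C @ (x, m) # drop n C"
      unfolding T' using lA by simp
    moreover have "excess m ?xs = excess m (A @ take n C @ drop n C)" unfolding xs using m0 by (simp add: excess_def del: marked_simps(3)) simp
    ultimately show ?thesis using excess_pair[OF \<open>x < y\<close>, of m A "take n C" "drop n C"] by simp
  next
    case False
    have "y < x"
    proof -
      have "p \<le> q" using c(1) i(4) False mark_count_take_mono[of "nat j" i 0 ?xs] by simp
      then show ?thesis using c(2) by (auto simp: y_def)
    qed
    have "inorder T' = take (nat j) A @ (x, m) # drop (nat j) A @ (y, m) # C"
      unfolding T' using False lA by simp
    moreover have "excess m ?xs = excess m (take (nat j) A @ drop (nat j) A @ C)"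
    proof -
      have "marked m (A @ (y, 0) # C) = marked m ((take (nat j) A @ drop (nat j) A) @ C)"
        unfolding append_take_drop_id using m0 by simp
      then show ?thesis unfolding xs excess_def by (simp only: append_assoc)
    qed
    ultimately show ?thesis using excess_pair[OF \<open>y < x\<close>, of m "take (nat j) A" "drop (nat j) A" C] by simp
  qed
  show ?thesis unfolding conf using ti kT' mc ex by simp
qed

lemma place_spec:
  assumes inv: "tree_inv T U" and j: "0 \<le> j" "j \<le> int (size T)"
    and x: "x \<notin> set (keys T)" and m: "m = 1 \<or> m = 2"
  shows "tree_inv (fst (place j x m T U)) (snd (place j x m T U)) \<and>
    keys (fst (place j x m T U)) = take (nat j) (keys T) @ x # drop (nat j) (keys T) \<and>
    mark_count (3 - m) (inorder (fst (place j x m T U))) = mark_count (3 - m) (inorder T) \<and>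
    excess m (inorder (fst (place j x m T U))) \<le> excess m (inorder T)"
proof -
  let ?xs = "inorder T"
  define p where "p = prefix_count 0 j T"
  have p: "mark_count 0 (take (nat j) ?xs) = p" using j by (simp add: p_def prefix_count_inorder)
  have pl: "length (filter (\<lambda>e. snd e = 0) (take (nat j) ?xs)) = nat p" "0 \<le> p"
    using p by (auto simp: mark_count_def)
  have inU: "inorder U = filter (\<lambda>e. snd e = 0) (take (nat j) ?xs) @ filter (\<lambda>e. snd e = 0) (drop (nat j) ?xs)"
    using inv unfolding tree_inv_def by (metis append_take_drop_id filter_append)
  then have pU: "p \<le> int (size U)" using pl by (metis length_append length_inorder le_add1 nat_le_iff)
  consider "0 < p" "x < fst (get (p - 1) U)"
    | "\<not> (0 < p \<and> x < fst (get (p - 1) U))" "p < int (size U)" "fst (get p U) < x"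
    | "\<not> (0 < p \<and> x < fst (get (p - 1) U))" "\<not> (p < int (size U) \<and> fst (get p U) < x)" by blast
  then show ?thesis
  proof cases
    case 1
    then have "place j x m T U = conflict j x m (p - 1) T U" by (simp add: place_def p_def Let_def)
    then show ?thesis using conflict_spec[OF inv _ _ j x m p, of "p - 1"] 1 pU by simp
  next
    case 2
    then have "place j x m T U = conflict j x m p T U" by (auto simp: place_def p_def Let_def)
    then show ?thesis using conflict_spec[OF inv _ _ j x m p, of p] 2 pl by simp
  next
    case 3
    define T' where "T' = ins j (x, 0) T"
    define U' where "U' = ins p (x, 0) U"
    have pl': "place j x m T U = (T', U')" using 3 by (auto simp: place_def p_def Let_def T'_def U'_def)
    have iT: "inorder T' = take (nat j) ?xs @ (x, 0) # drop (nat j) ?xs" using j by (simp add: T'_def inorder_ins)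
    have kT: "keys T' = take (nat j) (keys T) @ x # drop (nat j) (keys T)" by (simp add: iT take_map drop_map)
    have iU: "inorder U' = take (nat p) (inorder U) @ (x, 0) # drop (nat p) (inorder U)"
      using pl pU by (simp add: U'_def inorder_ins)
    have kU: "keys U' = take (nat p) (keys U) @ x # drop (nat p) (keys U)" by (simp add: iU take_map drop_map)
    have zero: "inorder U' = filter (\<lambda>e. snd e = 0) (inorder T')"
      unfolding iU iT inU pl(1)[symmetric] by simp
    have sU: "sorted_wrt (<) (keys U)" using inv unfolding tree_inv_def by blast
    have xU: "x \<notin> set (keys U)" using x inv by (auto simp: tree_inv_def)
    have lU: "length (keys U) = size U" by simp
    have below: "\<forall>t\<in>set (take (nat p) (keys U)). t < x"
    proof (cases "0 < p")
      case True
      have n: "nat p = Suc (nat (p - 1))" using True by simp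
      have "nat (p - 1) < length (keys U)" using True pU by simp
      then have tk: "take (nat p) (keys U) = take (nat (p - 1)) (keys U) @ [keys U ! nat (p - 1)]"
        unfolding n by (simp only: take_Suc_conv_app_nth)
      have g: "keys U ! nat (p - 1) = fst (get (p - 1) U)" using True pU by (simp add: get_inorder)
      have "keys U ! nat (p - 1) \<in> set (keys U)" using True pU by (intro nth_mem) simp
      then have "keys U ! nat (p - 1) < x" using 3(1) True xU g by (metis linorder_neqE_linordered_idom)
      moreover have "sorted_wrt (<) (take (nat p) (keys U))" using sU by (rule sorted_wrt_take)
      ultimately show ?thesis unfolding tk sorted_wrt_append by fastforce
    qed simp
    have above: "\<forall>t\<in>set (drop (nat p) (keys U)). x < t"
    proof (cases "p < int (size U)")
      case True
      have "nat p < length (keys U)" using True pl by simp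
      then have d: "drop (nat p) (keys U) = keys U ! nat p # drop (Suc (nat p)) (keys U)"
        by (simp only: Cons_nth_drop_Suc)
      have g: "keys U ! nat p = fst (get p U)" using True pl by (simp add: get_inorder)
      have "keys U ! nat p \<in> set (keys U)" using True pl by (intro nth_mem) simp
      then have "x < keys U ! nat p" using 3(2) True xU g by (metis linorder_neqE_linordered_idom)
      moreover have "sorted_wrt (<) (drop (nat p) (keys U))" using sU by (rule sorted_wrt_drop)
      ultimately show ?thesis unfolding d by fastforce
    qed (use pU in simp)
    have "sorted_wrt (<) (take (nat p) (keys U) @ drop (nat p) (keys U))" using sU by simp
    then have sU': "sorted_wrt (<) (keys U')"
      unfolding kU sorted_wrt_append using below above by auto
    have dT: "distinct (keys T')" unfolding kT by (rule distinct_insert_at[OF tree_invD(5)[OF inv] x])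
    have "set (inorder T') = insert (x, 0) (set ?xs)"
      unfolding iT by (metis append_take_drop_id list.set(2) set_append Un_insert_right)
    then have mT: "\<forall>e\<in>set (inorder T'). snd e = 0 \<or> snd e = 1 \<or> snd e = 2" using inv unfolding tree_inv_def by auto
    have "avl T'" "avl U'" unfolding T'_def U'_def by (intro avl_insI tree_invD(1,2)[OF inv])+
    then have ti: "tree_inv T' U'" unfolding tree_inv_def using zero sU' dT mT by blast
    have mk: "marked k (inorder T') = marked k ?xs" if "k \<noteq> 0" for k
    proof -
      have "marked k (inorder T') = marked k (take (nat j) ?xs) @ marked k (drop (nat j) ?xs)" unfolding iT using that by simp
      then show ?thesis by (simp only: marked_simps(3)[symmetric] append_take_drop_id)
    qed
    have "m \<noteq> 0" "3 - m \<noteq> 0" using m by auto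
    then have "mark_count (3 - m) (inorder T') = mark_count (3 - m) ?xs" "excess m (inorder T') = excess m ?xs"
      using mk by (simp_all add: length_marked[symmetric] excess_def)
    then show ?thesis unfolding pl' using ti kT by simp
  qed
qed

text \<open>Taking out an element marked \<open>old\<close> changes neither U nor the elements of
  the other mark, so \<open>place_spec\<close> applies to the array without it. The new placement
  uses the other mark or 0, hence creates no element marked \<open>old\<close>.\<close>

lemma refresh_spec:
  assumes inv: "tree_inv T U" and old: "old = 1 \<or> old = 2"
  shows "tree_inv (fst (refresh old T U)) (snd (refresh old T U)) \<and>
    keys (fst (refresh old T U)) = keys T \<and>
    mark_count old (inorder (fst (refresh old T U))) = max 0 (mark_count old (inorder T) - 1) \<and>
    excess (3 - old) (inorder (fst (refresh old T U))) \<le> excess (3 - old) (inorder T)"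
proof (cases "0 < mark_count old (inorder T)")
  case True
  let ?xs = "inorder T"
  define i where "i = nat (select old 0 T)"
  from select_inorder[OF _ True] have i: "i < size T" "select old 0 T = int i" "snd (?xs ! i) = old"
    by (auto simp: i_def)
  define x where "x = fst (get (int i) T)"
  have xi: "?xs ! i = (x, old)" using i by (simp add: x_def get_inorder prod_eq_iff)
  define A where "A = take i ?xs"
  define C where "C = drop (Suc i) ?xs"
  have xs: "?xs = A @ (x, old) # C"
    unfolding A_def C_def xi[symmetric] by (rule id_take_nth_drop) (use i in simp)
  have lA: "length A = i" using i by (simp add: A_def)
  let ?T1 = "del (int i) T"
  have T1: "inorder ?T1 = A @ C" using i by (simp add: inorder_del A_def C_def)
  have s1: "int i \<le> int (size ?T1)" using i by (simp add: size_del)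
  have old0: "old \<noteq> 0" "3 - old = 1 \<or> 3 - old = 2" "3 - (3 - old) = old" "3 - old \<noteq> old" using old by auto
  have "avl ?T1" by (intro avl_delI tree_invD(1)[OF inv])
  moreover have "inorder U = filter (\<lambda>e. snd e = 0) (A @ C)" using inv old0 unfolding tree_inv_def xs by simp
  moreover have "distinct (map fst (A @ C))"
  proof -
    have "distinct (keys T)" using inv unfolding tree_inv_def by blast
    then show ?thesis unfolding xs by simp
  qed
  moreover have "\<forall>e\<in>set (A @ C). snd e = 0 \<or> snd e = 1 \<or> snd e = 2"
  proof -
    have "\<forall>e\<in>set ?xs. snd e = 0 \<or> snd e = 1 \<or> snd e = 2" using inv unfolding tree_inv_def by blast
    then show ?thesis unfolding xs by simp
  qed
  moreover have "avl U" "sorted_wrt (<) (keys U)" using inv unfolding tree_inv_def by blast+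
  ultimately have ti: "tree_inv ?T1 U" unfolding tree_inv_def T1 by blast
  have x: "x \<notin> set (keys ?T1)" using inv unfolding T1 tree_inv_def xs by auto
  have r: "refresh old T U = place (int i) x (3 - old) ?T1 U"
    using True by (simp add: refresh_def Let_def i(2) x_def)
  have "take (nat (int i)) (keys ?T1) @ x # drop (nat (int i)) (keys ?T1) = keys T"
    unfolding T1 xs using lA by simp
  moreover have "mark_count old (inorder ?T1) = mark_count old ?xs - 1" unfolding T1 xs by simp
  moreover have "excess (3 - old) (inorder ?T1) = excess (3 - old) ?xs"
    unfolding T1 xs excess_def using old0 by simp
  ultimately show ?thesis
    unfolding r using place_spec[OF ti _ s1 x old0(2)] old0(3) True by simp
next
  case False
  then show ?thesis using inv mark_count_bounds(1)[of old "inorder T"] by (simp add: refresh_def)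
qed

lemma delete_spec:
  assumes inv: "tree_inv T U" and i: "1 \<le> i" "i \<le> int (size T)"
    and U': "U' = (if prefix_count 0 (i - 1) T < prefix_count 0 i T then del (prefix_count 0 (i - 1) T) U else U)"
  shows "tree_inv (del (i - 1) T) U'"
    "keys (del (i - 1) T) = take (nat i - 1) (keys T) @ drop (nat i) (keys T)"
    "mark_count m (inorder (del (i - 1) T)) \<le> mark_count m (inorder T)"
    "excess m (inorder (del (i - 1) T)) \<le> excess m (inorder T) + 1"
proof -
  let ?xs = "inorder T"
  define n where "n = nat i - 1"
  have n: "i = int n + 1" "n < size T" "nat (i - 1) = n" "nat i = Suc n" using i by (auto simp: n_def)
  define A where "A = take n ?xs"
  define C where "C = drop (Suc n) ?xs"
  define e where "e = ?xs ! n"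
  have xs: "?xs = A @ e # C"
    unfolding A_def C_def e_def by (rule id_take_nth_drop) (use n in simp)
  have lA: "length A = n" using n by (simp add: A_def)
  have T1: "inorder (del (i - 1) T) = A @ C" using n by (simp add: inorder_del A_def C_def)
  show "keys (del (i - 1) T) = take (nat i - 1) (keys T) @ drop (nat i) (keys T)"
    unfolding T1 xs using lA n by simp
  show "mark_count m (inorder (del (i - 1) T)) \<le> mark_count m (inorder T)" unfolding T1 xs by simp
  show "excess m (inorder (del (i - 1) T)) \<le> excess m (inorder T) + 1"
    unfolding T1 xs by (rule excess_delete)
  have p1: "prefix_count 0 (i - 1) T = mark_count 0 A" using i n by (simp add: prefix_count_inorder A_def)
  have "take (nat i) ?xs = A @ [e]" using n by (simp add: take_Suc_conv_app_nth A_def e_def)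
  then have p2: "prefix_count 0 i T = mark_count 0 A + (if snd e = 0 then 1 else 0)"
    using i by (simp add: prefix_count_inorder)
  have iU: "inorder U = filter (\<lambda>e. snd e = 0) A @ filter (\<lambda>e. snd e = 0) (e # C)"
    using inv unfolding tree_inv_def xs by simp
  have "inorder U' = filter (\<lambda>e. snd e = 0) (A @ C) \<and> avl U' \<and> sorted_wrt (<) (keys U')"
  proof (cases "snd e = 0")
    case True
    then have u: "U' = del (mark_count 0 A) U" using U' p1 p2 by simp
    have l: "length (inorder U) = size U" by simp
    have b: "0 \<le> mark_count 0 A" "mark_count 0 A < int (size U)"
      using l True unfolding iU mark_count_def by simp_all
    have "inorder U' = filter (\<lambda>e. snd e = 0) (A @ C)"
      unfolding u inorder_del[OF b] iU using True by (simp add: mark_count_def)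
    moreover have "avl U'" unfolding u by (intro avl_delI tree_invD(2)[OF inv])
    moreover have "sorted_wrt (<) (keys U')" unfolding u
      by (rule keys_del(1)[OF _ b]) (rule tree_invD(4)[OF inv])
    ultimately show ?thesis by blast
  next
    case False
    then have "U' = U" "inorder U = filter (\<lambda>e. snd e = 0) (A @ C)" using U' p1 p2 iU by simp_all
    then show ?thesis using inv unfolding tree_inv_def by metis
  qed
  moreover have "avl (del (i - 1) T)" by (intro avl_delI tree_invD(1)[OF inv])
  moreover have "distinct (map fst (A @ C))"
  proof -
    have "distinct (keys T)" using inv unfolding tree_inv_def by blast
    then show ?thesis unfolding xs by simp
  qed
  moreover have "\<forall>e\<in>set (A @ C). snd e = 0 \<or> snd e = 1 \<or> snd e = 2"
  proof -
    have "\<forall>e\<in>set ?xs. snd e = 0 \<or> snd e = 1 \<or> snd e = 2" using inv unfolding tree_inv_def by blast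
    then show ?thesis unfolding xs by simp
  qed
  ultimately show "tree_inv (del (i - 1) T) U'" unfolding tree_inv_def T1 by blast
qed

section \<open>Rounds\<close>

text \<open>An update changes length and distance by at most one, so \<open>ages\<close> and
  \<open>agee\<close> bound the drift since the two snapshots. The last line says that the steps of
  all earlier updates of the round did not suffice to finish it; together with the line before, a
  round lasts about 6 D / N updates for the distance D of its snapshot.\<close>

definition core :: "int \<Rightarrow> real list \<Rightarrow> elem tree \<Rightarrow> elem tree \<Rightarrow> int \<Rightarrow> elem tree \<Rightarrow> int \<Rightarrow> int \<Rightarrow> int \<Rightarrow> int \<Rightarrow> bool" where
  "core N a T U par ts m est ages agee \<longleftrightarrow>
     tree_inv T U \<and> keys T = a \<and> (par = 1 \<or> par = 2) \<and> m = par \<and>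
     excess (3 - par) (inorder T) \<le> ages \<and> 0 \<le> ages \<and> ages \<le> agee \<and>
     int (dtm (keys ts)) \<le> int (dtm a) + ages \<and> int (dtm a) \<le> int (dtm (keys ts)) + ages \<and>
     est \<le> int (dtm a) + agee \<and> int (dtm a) \<le> est + agee \<and>
     int (size ts) \<le> int (length a) + ages \<and>
     mark_count m (inorder ts) \<le> 3 * int (dtm (keys ts)) + 1 \<and>
     N * ages \<le> 2 * mark_count m (inorder ts) + 1"

text \<open>The state within an update, after i of its N steps. During a round
  \<open>agee - ages - 1\<close> is constant, namely the final age of the previous snapshot; the
  inequality for it restates the length of the previous round in terms of the present
  snapshot.\<close>

fun st_mid :: "int \<Rightarrow> real list \<Rightarrow> int \<Rightarrow> st \<Rightarrow> bool" where
  "st_mid N a i (St T U par (DP ts us m k c v q cost dn) est ages agee act) \<longleftrightarrow>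
     core N a T U par ts m est ages agee \<and> dp_inv ts us m k c v q cost dn \<and> act = 1 \<and>
     1 \<le> agee - ages \<and> N * (agee - ages - 1) \<le> 6 * (int (dtm (keys ts)) + (agee - ages)) + 3 \<and>
     mark_count par (inorder T) \<le> max 0 (2 * mark_count m (inorder ts) + 1 - (N * ages + i)) \<and>
     int (dp_measure (DP ts us m k c v q cost dn)) \<le> max 0 (2 * mark_count m (inorder ts) + 1 - (N * ages + i))"

fun st_inv :: "int \<Rightarrow> real list \<Rightarrow> st \<Rightarrow> bool" where
  "st_inv N a (St T U par (DP ts us m k c v q cost dn) est ages agee act) \<longleftrightarrow>
     core N a T U par ts m est ages agee \<and> dp_inv ts us m k c v q cost dn \<and>
     (act = 0 \<and> mark_count par (inorder T) = 0 \<and> est = int (dtm (keys ts)) \<and> agee = ages \<or>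
      act = 1 \<and> N * (ages + 1) \<le> 2 * mark_count m (inorder ts) + 1 \<and>
      1 \<le> agee - ages \<and> N * (agee - ages - 1) \<le> 6 * (int (dtm (keys ts)) + (agee - ages)) + 3 \<and>
      mark_count par (inorder T) \<le> max 0 (2 * mark_count m (inorder ts) + 1 - N * (ages + 1)) \<and>
      int (dp_measure (DP ts us m k c v q cost dn)) \<le> max 0 (2 * mark_count m (inorder ts) + 1 - N * (ages + 1)))"

text \<open>The marked elements form a subsequence, whose distance is no larger than that of the
  whole.\<close>

lemma core_excess: "excess m xs \<le> n \<Longrightarrow> mark_count m xs \<le> 2 * int (dtm (map fst xs)) + n"
  using dtm_subseq[OF subseq_marked, of m xs] by (simp add: excess_def length_marked)

lemma dp_inv_start:
  assumes "tree_inv T U" "m = 1 \<or> m = 2" "mark_count (3 - m) (inorder T) = 0"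
  shows "dp_inv T U m 0 0 U Leaf 0 0"
proof -
  note t = tree_invD[OF assms(1)]
  have "\<forall>e\<in>set (inorder T). snd e \<noteq> 3 - m" using assms(3) by (auto simp: mark_count_def filter_empty_conv)
  then have "\<forall>e\<in>set (inorder T). snd e = 0 \<or> snd e = m" using t(6) assms(2) by fastforce
  then show ?thesis unfolding dp_inv_def using t assms(2) by simp
qed

text \<open>When a round starts, the elements to be swept are those marked since the previous start,
  so their excess is at most \<open>ages + 1\<close>. As the previous round was short compared to
  the distance, this bounds their number by three times the distance plus one: the induction from
  round to round.\<close>

lemma begin_ok:
  assumes inv: "st_inv N a (St T U par d est ages agee act)" and N: "16 \<le> N"
    and T': "tree_inv T' U'" "keys T' = a'" "excess (3 - par) (inorder T') \<le> ages + 1"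
      "mark_count par (inorder T') \<le> mark_count par (inorder T)"
    and a': "int (dtm a') \<le> int (dtm a) + 1" "int (dtm a) \<le> int (dtm a') + 1" "int (length a) \<le> int (length a') + 1"
  shows "st_mid N a' 0 (begin_update (St T' U' par d est ages agee act))"
proof -
  obtain ts us m k c v q cost dn where d: "d = DP ts us m k c v q cost dn" by (cases d)
  have co: "core N a T U par ts m est ages agee" and dp: "dp_inv ts us m k c v q cost dn" using inv d by auto
  let ?K = "mark_count m (inorder ts)" and ?D = "int (dtm (keys ts))"
  have par: "par = 1 \<or> par = 2" "m = par" using co by (auto simp: core_def)
  have dis: "act = 0 \<and> mark_count par (inorder T) = 0 \<and> est = ?D \<and> agee = ages \<or>
      act = 1 \<and> N * (ages + 1) \<le> 2 * ?K + 1 \<and>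
      1 \<le> agee - ages \<and> N * (agee - ages - 1) \<le> 6 * (?D + (agee - ages)) + 3 \<and>
      mark_count par (inorder T) \<le> max 0 (2 * ?K + 1 - N * (ages + 1)) \<and>
      int (dp_measure d) \<le> max 0 (2 * ?K + 1 - N * (ages + 1))"
    using inv unfolding d st_inv.simps by blast
  from dis show ?thesis
  proof
    assume A: "act = 1 \<and> N * (ages + 1) \<le> 2 * ?K + 1 \<and>
      1 \<le> agee - ages \<and> N * (agee - ages - 1) \<le> 6 * (?D + (agee - ages)) + 3 \<and>
      mark_count par (inorder T) \<le> max 0 (2 * ?K + 1 - N * (ages + 1)) \<and>
      int (dp_measure d) \<le> max 0 (2 * ?K + 1 - N * (ages + 1))"
    have "core N a' T' U' par ts m est (ages + 1) (agee + 1)"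
      using co T' a' A unfolding core_def by auto
    moreover have "mark_count par (inorder T') \<le> max 0 (2 * ?K + 1 - N * (ages + 1))" using A T'(4) by linarith
    moreover have "begin_update (St T' U' par d est ages agee act) = St T' U' par d est (ages + 1) (agee + 1) 1"
      using A by simp
    moreover have "agee + 1 - (ages + 1) = agee - ages" "N * (ages + 1) + 0 = N * (ages + 1)" by simp_all
    ultimately show ?thesis using A dp unfolding d by (simp only: st_mid.simps)
  next
    assume A: "act = 0 \<and> mark_count par (inorder T) = 0 \<and> est = ?D \<and> agee = ages"
    have mp: "mark_count par (inorder T') = 0" using A T'(4) mark_count_bounds(1)[of par "inorder T'"] by linarith
    let ?m = "3 - par"
    have m: "?m = 1 \<or> ?m = 2" "3 - ?m = par" using par by auto
    have dp': "dp_inv T' U' ?m 0 0 U' Leaf 0 0"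
      by (rule dp_inv_start[OF T'(1) m(1)]) (use mp m in simp)
    have ex: "excess par (inorder T') = 0"
    proof -
      have "marked par (inorder T') = []" using mp length_marked[of par "inorder T'"] by simp
      then show ?thesis using dtm_lis[of "[]"] by (simp add: excess_def)
    qed
    have Na: "N * ages \<le> 6 * ?D + 3" and ages: "0 \<le> ages" using co unfolding core_def by auto
    have Da: "?D \<le> int (dtm a') + ages + 1" "int (dtm a') \<le> ?D + ages + 1" using co a' unfolding core_def by auto
    \<comment> \<open>For the old snapshot N * ages \<le> 6 D + 3 and D \<le> dtm a' + ages + 1, so
      N \<ge> 16 yields 10 ages \<le> 6 dtm a' + 9. This is impossible for dtm a' < ages.\<close>
    have le: "ages \<le> int (dtm a')"
    proof (rule ccontr)
      assume n: "\<not> ages \<le> int (dtm a')"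
      have "16 * ages \<le> N * ages" using N ages by (intro mult_right_mono)
      then have "16 * ages \<le> 6 * int (dtm a') + 6 * ages + 9" using Na Da by linarith
      then show False using n by linarith
    qed
    have K: "mark_count ?m (inorder T') \<le> 3 * int (dtm a') + 1"
      using core_excess[OF T'(3)] T'(2) le by simp
    have K0: "0 \<le> mark_count ?m (inorder T')" by (rule mark_count_bounds)
    have "core N a' T' U' ?m T' ?m est 0 (agee + 1)"
      unfolding core_def m(2) using T'(1,2) m ex A ages K K0 Da by auto
    moreover have "N * ages \<le> 6 * (int (dtm a') + (ages + 1)) + 3"
    proof (rule order_trans[OF Na])
      show "6 * ?D + 3 \<le> 6 * (int (dtm a') + (ages + 1)) + 3" using Da(1) by simp
    qed
    ultimately show ?thesis using A dp' K0 T'(2) ages unfolding d by simp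
  qed
qed

lemma dp_step_ts: "\<exists>us' k' c' v' q' cost' dn'. dp_step (DP ts us m k c v q cost dn) = DP ts us' m k' c' v' q' cost' dn'"
  by (auto simp: Let_def)

lemma work_ok:
  assumes mid: "st_mid N a i s" "0 \<le> i"
  shows "st_mid N a (i + 1) (work s)"
proof -
  obtain T U par d est ages agee act where s: "s = St T U par d est ages agee act" by (cases s)
  obtain ts us m k c v q cost dn where d: "d = DP ts us m k c v q cost dn" by (cases d)
  obtain us' k' c' v' q' cost' dn' where d': "dp_step d = DP ts us' m k' c' v' q' cost' dn'"
    using dp_step_ts[of ts us m k c v q cost dn] unfolding d by blast
  have co: "core N a T U par ts m est ages agee" and dp: "dp_ok d"
    using mid(1) unfolding s d by auto
  have par: "par = 1 \<or> par = 2" and t: "tree_inv T U" using co by (auto simp: core_def)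
  note R = refresh_spec[OF t par]
  let ?T = "fst (refresh par T U)" and ?U = "snd (refresh par T U)"
  have co': "core N a ?T ?U par ts m est ages agee"
    using co R unfolding core_def by auto
  have dp': "dp_inv ts us' m k' c' v' q' cost' dn'" using dp_step_ok(1)[OF dp] d' by simp
  have ms: "int (dp_measure (dp_step d)) \<le> max 0 (int (dp_measure d) - 1)"
  proof (cases "dp_measure d = 0")
    case True
    then have "dp_step d = d" unfolding d by (auto split: if_splits)
    then show ?thesis using True by simp
  next
    case False
    then show ?thesis using dp_step_ok(2)[OF dp] by simp
  qed
  have w: "work s = St ?T ?U par (DP ts us' m k' c' v' q' cost' dn') est ages agee act"
    unfolding s by (simp add: d' Let_def)
  show ?thesis
    unfolding w st_mid.simps
    using mid(1)[unfolded s d st_mid.simps] co' dp' ms[unfolded d'] R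
    unfolding d by auto
qed

lemma works_ok: "st_mid N a 0 s \<Longrightarrow> st_mid N a (int i) ((work ^^ i) s)"
proof (induction i)
  case (Suc i)
  then show ?case using work_ok[of N a "int i" "(work ^^ i) s"] by (simp add: add.commute)
qed simp

lemma publish_ok:
  assumes "st_mid N a N s"
  shows "st_inv N a (publish s)"
proof -
  obtain T U par d est ages agee act where s: "s = St T U par d est ages agee act" by (cases s)
  obtain ts us m k c v q cost dn where d: "d = DP ts us m k c v q cost dn" by (cases d)
  note M = assms[unfolded s d st_mid.simps]
  have e: "N * ages + N = N * (ages + 1)" by (simp add: algebra_simps)
  have dn: "dn = 0 \<or> dn = 1 \<and> cost = int (dtm (keys ts))" using M by (auto simp: dp_inv_def)
  show ?thesis
  proof (cases "0 < dn \<and> \<not> 0 < mark_count par (inorder T)")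
    case True
    then have p: "publish s = St T U par (DP ts us m k c v q cost dn) cost ages ages 0"
      unfolding s d by simp
    have "cost = int (dtm (keys ts))" using dn True by auto
    moreover then have "core N a T U par ts m cost ages ages"
      using M unfolding core_def by auto
    moreover have "mark_count par (inorder T) = 0" using True mark_count_bounds(1)[of par "inorder T"] by linarith
    ultimately show ?thesis unfolding p st_inv.simps using M by simp
  next
    case False
    then have p: "publish s = St T U par (DP ts us m k c v q cost dn) est ages agee act"
      unfolding s d publish.simps by (rule if_not_P)
    \<comment> \<open>If the sweep or the sorting is unfinished, one of the two truncated bounds is
      positive, so the N * (ages + 1) steps done so far are fewer than 2 K + 1.\<close>
    have "0 < mark_count par (inorder T) \<or> 0 < dp_measure (DP ts us m k c v q cost dn)"
      using False dn by auto
    then have "N * (ages + 1) \<le> 2 * mark_count m (inorder ts) + 1" using M unfolding e by linarith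
    then show ?thesis unfolding p st_inv.simps using M[unfolded e] by blast
  qed
qed

lemma finish_ok:
  assumes "st_mid N a 0 (begin_update s)" "0 \<le> N"
  shows "st_inv N a (finish_update N s)"
  unfolding finish_update_def using works_ok[OF assms(1), of "nat N"] assms(2) by (intro publish_ok) simp

text \<open>The age \<open>agee\<close> covers at most the current and the previous round. The loss
  of 6 in N - 6 absorbs the drift of the distance within a round; the factor 30 leaves slack. For
  distance 0 the bound forces \<open>agee\<close> to be 0, so the report is exact.\<close>

lemma accuracy:
  assumes inv: "st_inv N a (St T U par d est ages agee act)" and N: "16 \<le> N"
  shows "(N - 6) * agee \<le> 30 * int (dtm a)" "int (dtm a) \<le> est + agee" "est + agee \<le> int (dtm a) + 2 * agee"
    "0 \<le> ages" "ages \<le> agee"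
proof -
  obtain ts us m k c v q cost dn where d: "d = DP ts us m k c v q cost dn" by (cases d)
  have co: "core N a T U par ts m est ages agee" using inv d by auto
  show "int (dtm a) \<le> est + agee" "est + agee \<le> int (dtm a) + 2 * agee" "0 \<le> ages" "ages \<le> agee"
    using co unfolding core_def by auto
  let ?K = "mark_count m (inorder ts)" and ?D = "int (dtm (keys ts))"
  have K: "?K \<le> 3 * ?D + 1" "N * ages \<le> 2 * ?K + 1" "?D \<le> int (dtm a) + ages" "0 \<le> ages"
    using co unfolding core_def by auto
  have dis: "agee = ages \<or> N * (ages + 1) \<le> 2 * ?K + 1 \<and>
      1 \<le> agee - ages \<and> N * (agee - ages - 1) \<le> 6 * (?D + (agee - ages)) + 3"
    using inv unfolding d st_inv.simps by blast
  from dis show "(N - 6) * agee \<le> 30 * int (dtm a)"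
  proof
    assume A: "agee = ages"
    show ?thesis
    proof (cases "ages = 0")
      case False
      have m: "16 * ages \<le> N * ages" using N K(4) by (intro mult_right_mono)
      have e: "(N - 6) * agee = N * ages - 6 * ages" unfolding A by (simp add: algebra_simps)
      have "N * ages \<le> 6 * int (dtm a) + 6 * ages + 3" using K by linarith
      \<comment> \<open>Here ages \<ge> 1 gives 10 \<le> 6 dtm a + 3, so the distance is positive
        and absorbs the additive 3.\<close>
      then show ?thesis using m e False K(4) by linarith
    qed (use A in simp)
  next
    assume A: "N * (ages + 1) \<le> 2 * ?K + 1 \<and> 1 \<le> agee - ages \<and>
      N * (agee - ages - 1) \<le> 6 * (?D + (agee - ages)) + 3"
    define A' where "A' = ages + 1"
    define L where "L = agee - ages"
    define M where "M = N - 6"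
    define D where "D = int (dtm a)"
    have M: "10 \<le> M" "N = M + 6" using N by (auto simp: M_def)
    have A1: "1 \<le> A'" using K by (simp add: A'_def)
    have 1: "M * A' \<le> 6 * D"
    proof -
      have "N * A' = M * A' + 6 * A'" unfolding M(2) by (simp add: algebra_simps)
      then show ?thesis using A K by (simp add: A'_def D_def)
    qed
    have 2: "M * 1 \<le> M * A'" using M A1 by (intro mult_left_mono) auto
    have 3: "10 * A' \<le> M * A'" using M A1 by (intro mult_right_mono) auto
    have "N * (L - 1) = M * L + 6 * L - M - 6" unfolding M(2) by (simp add: algebra_simps)
    then have 4: "M * L \<le> 6 * D + 6 * A' + 3 + M" using A K by (simp add: A'_def D_def L_def)
    have "(N - 6) * agee = M * L + M * A' - M" by (simp add: M_def L_def A'_def algebra_simps)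
    then show ?thesis using 1 2 3 4 M A1 unfolding D_def by linarith
  qed
qed

text \<open>After deletions the snapshot may be larger than the array, while the time is measured in
  the current size. From 16 ages \<le> 2 K + 1 and K \<le> length a + ages follows ages \<le> length
  a, so the snapshot has at most twice the current size.\<close>

lemma st_mid_runnable:
  assumes "bounded_machine B X \<tau>" "st_mid N a i s" "16 \<le> N" "2 * length a + 2 \<le> X"
  shows "bounded_machine.runnable B X s"
proof -
  interpret bounded_machine B X \<tau> by (rule assms(1))
  obtain T U par d est ages agee act where s: "s = St T U par d est ages agee act" by (cases s)
  obtain ts us m k c v q cost dn where d: "d = DP ts us m k c v q cost dn" by (cases d)
  note M = assms(2)[unfolded s d st_mid.simps]
  have co: "core N a T U par ts m est ages agee" and dp: "dp_inv ts us m k c v q cost dn" using M by auto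
  have t: "tree_inv T U" using co by (simp add: core_def)
  have T: "size T = length a" using co by (auto simp: core_def)
  have "int (size U) \<le> int (size T)"
    using mark_count_U[OF t] mark_count_bounds(2)[of 0 "inorder T"] by simp
  then have U: "size U \<le> length a" using T by simp
  have ts: "int (size ts) \<le> int (length a) + ages" "N * ages \<le> 2 * mark_count m (inorder ts) + 1" "0 \<le> ages"
    using co by (auto simp: core_def)
  have "16 * ages \<le> N * ages" using assms(3) ts(3) by (intro mult_right_mono)
  moreover have "mark_count m (inorder ts) \<le> int (size ts)" using mark_count_bounds(2)[of m "inorder ts"] by simp
  ultimately have "ages \<le> int (length a)" using ts by linarith
  then have sz: "size ts \<le> 2 * length a" using ts by linarith
  have us: "size us \<le> size ts" using dp_total[OF dp] mark_count_bounds(1)[of m "inorder ts"] by linarith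
  have card: "size t = card (set (keys t))" if "sorted_wrt (<) (keys t)" for t :: "elem tree"
  proof -
    have "distinct (keys t)" using that by (simp add: strict_sorted_iff)
    from distinct_card[OF this] show ?thesis by (simp only: length_map length_inorder)
  qed
  have srt: "sorted_wrt (<) (keys v)" "sorted_wrt (<) (keys q)" "set (keys v) \<subseteq> set (keys us)"
    "set (keys q) \<subseteq> fst ` set (filter (\<lambda>e. snd e = m) (take (nat (k + c)) (inorder ts)))"
    "k + c \<le> int (size ts)" "cost = k + c - int (card (tails (take (nat (k + c)) (keys ts))))"
    "avl ts" "avl us" "avl v" "avl q" "m = 1 \<or> m = 2"
    by (insert dp[unfolded dp_inv_def], elim conjE, assumption)+
  have v: "size v \<le> size us"
    unfolding card[OF srt(1)] card[OF dp_us(2)[OF dp]] using srt(3) by (intro card_mono) auto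
  have "fst ` set (filter (\<lambda>e. snd e = m) (take (nat (k + c)) (inorder ts))) \<subseteq> fst ` set (inorder ts)"
    by (intro image_mono) (auto dest: in_set_takeD)
  with srt(4) have "set (keys q) \<subseteq> set (keys ts)" unfolding list.set_map by (rule subset_trans)
  then have "card (set (keys q)) \<le> card (set (keys ts))" by (intro card_mono) auto
  also have "\<dots> \<le> size ts" by (metis card_length length_inorder length_map)
  finally have q: "size q \<le> size ts" unfolding card[OF srt(2)] .
  note k = dp_k[OF dp]
  have "card (tails (take (nat (k + c)) (keys ts))) \<le> card (set (take (nat (k + c)) (keys ts)))"
    using tails_subset by (intro card_mono) auto
  also have "\<dots> \<le> nat (k + c)" by (rule order_trans[OF card_length]) simp
  finally have "0 \<le> cost" "cost \<le> int (size ts)" using srt(5,6) k by linarith+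
  then have cost: "\<bar>cost + 1\<bar> \<le> B" using sz assms(4) XB by linarith
  have lim: "limit (DP ts us m k c v q cost dn) \<le> int (size us)" by (rule dp_limit(2)[OF dp refl])
  have par: "par = 1 \<or> par = 2" using co by (simp add: core_def)
  show ?thesis
    unfolding s d runnable.simps small_def
    using tree_invD(1,2)[OF t] T U par mark_count_U[OF t] srt(7-11) sz us v q cost k lim assms(4) by simp
qed

section \<open>The complete program\<close>

text \<open>The logarithm comes from \<open>avl_size\<close>; the 3 covers the rounding in halving
  the height and the extra level.\<close>

definition max_height :: "nat \<Rightarrow> nat" where
  "max_height n = nat \<lfloor>2 * log 2 (real n + 1)\<rfloor> + 3"

lemma max_height: "avl t \<Longrightarrow> size t \<le> n \<Longrightarrow> height t + 1 \<le> max_height n"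
proof -
  assume t: "avl t" "size t \<le> n"
  have "2 ^ (height t div 2) \<le> n + 1" using avl_size[OF t(1)] t(2) by linarith
  then have "real (height t div 2) \<le> log 2 (real (n + 1))" by (intro le_log2_of_power)
  then have "int (2 * (height t div 2)) \<le> \<lfloor>2 * log 2 (real n + 1)\<rfloor>" by (simp add: le_floor_iff add.commute)
  then show ?thesis unfolding max_height_def by linarith
qed

text \<open>The root in cell 1 is the last argument of the procedure and is replaced by its result.
  Fields 4 and 6 are \<open>est\<close> and \<open>agee\<close>; adding the age keeps the report
  from falling below the distance.\<close>

definition main :: "int \<Rightarrow> nat \<Rightarrow> expr list \<Rightarrow> expr" where
  "main N f es = Bind (Call f (Const N # es @ [Load (Const 1)]))
     (Bind (Store (Const 1) (Var 0)) (Plus (Load (Plus (Var 0) (Const 4))) (Load (Plus (Var 0) (Const 6)))))"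

definition dtm_program :: "int \<Rightarrow> program" where
  "dtm_program N = link (main N 26 [Var 0, Var 1]) (main N 27 [Var 0]) alg_code"

text \<open>The size \<open>2 * n + 2\<close> bounds the trees of the snapshot too, not only those
  of the current array.\<close>

definition step_bound :: "int \<Rightarrow> nat \<Rightarrow> nat" where
  "step_bound N n = 50000 * max_height (2 * n + 2) * (nat N + 1)"

lemma bounded_machine_max_height: "int X + 20 \<le> W \<Longrightarrow> bounded_machine W X (max_height X)"
  by unfold_locales (simp, rule max_height)

lemma insert_step:
  assumes inv: "st_inv N a s" and N: "16 \<le> N" "N \<le> W" and l: "legal a (Insert i x)"
    and a': "a' = apply_update a (Insert i x)" and r: "represents r s" and W: "10 * int (length a') + 40 \<le> W"
  shows "st_inv N a' (insert_update N (int i) x s) \<and>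
    computes W alg_code 23 [RI N, RI (int i), RN x, r] (enc_st (insert_update N (int i) x s)) (step_bound N (length a'))"
proof -
  obtain T U par d est ages agee act where s: "s = St T U par d est ages agee act" by (cases s)
  obtain ts us m k c v q cost dn where d: "d = DP ts us m k c v q cost dn" by (cases d)
  have co: "core N a T U par ts m est ages agee" using inv unfolding s d by simp
  have t: "tree_inv T U" "keys T = a" "par = 1 \<or> par = 2" "excess (3 - par) (inorder T) \<le> ages"
    using co unfolding core_def by auto
  let ?j = "int i - 1"
  have sz: "size T = length a" using t(2) by auto
  have i: "0 \<le> ?j" "?j \<le> int (size T)" "nat ?j = i - 1" using l sz by auto
  have x: "x \<notin> set (keys T)" using l t(2) by simp
  have par': "3 - par = 1 \<or> 3 - par = 2" "3 - (3 - par) = par" using t(3) by auto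
  define p where "p = place ?j x (3 - par) T U"
  note P = place_spec[OF t(1) i(1,2) x par'(1), folded p_def, unfolded par'(2)]
  have ka: "keys (fst p) = a'" using P t(2) i(3) a' by simp
  have la: "length a' = length a + 1" using l a' by (auto simp: min_def)
  have D: "dtm a' \<le> dtm a + 1" "dtm a \<le> dtm a'"
    using dtm_insert(1)[of "take (i - 1) a"  "drop (i - 1) a" x] dtm_insert(2)[of "take (i - 1) a" x "drop (i - 1) a"] a' by simp_all
  have mid: "st_mid N a' 0 (begin_update (St (fst p) (snd p) par d est ages agee act))"
    by (rule begin_ok[OF inv[unfolded s] N(1)]) (use P ka t(4) D la in auto)
  have e: "insert_update N (int i) x s = finish_update N (St (fst p) (snd p) par d est ages agee act)"
    unfolding s by (simp add: p_def Let_def)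
  let ?X = "2 * length a' + 2"
  interpret bounded_machine W ?X "max_height ?X"
    by (rule bounded_machine_max_height) (use W in simp)
  note A = accuracy[OF inv[unfolded s] N(1)]
  have "dtm a \<le> length a" using dtm_lis[of a] by simp
  moreover have "10 * agee \<le> (N - 6) * agee" using N(1) A(4,5) by (intro mult_right_mono) auto
  \<comment> \<open>Bounds the counters of the state by the length of the array, so that they fit
    into a word.\<close>
  ultimately have ag: "agee \<le> 3 * int (length a)" using A(1) by linarith
  have iN: "int (nat N) = N" using N(1) by simp
  have U: "int (size U) \<le> int (size T)"
    using mark_count_U[OF t(1)] mark_count_bounds(2)[of 0 "inorder T"] by simp
  have run: "runnable ((work ^^ n) (begin_update (St (fst p) (snd p) par d est ages agee act)))" for n
    by (rule st_mid_runnable[OF bounded_machine_axioms works_ok[OF mid] N(1)]) simp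
  have "computes W alg_code 23 [RI (int (nat N)), RI (int i), RN x, r] (enc_st (insert_update (int (nat N)) (int i) x s))
      (50000 * max_height ?X * (nat N + 1))"
  proof (rule insert_computes[OF s r t(3) _ _ _ _ _ _ _ _ mark_count_U[OF t(1)] p_def run])
    show "\<bar>ages + 1\<bar> \<le> W" "\<bar>agee + 1\<bar> \<le> W" using A(4,5) ag la W by auto
    show "small T" "small U" using tree_invD(1,2)[OF t(1)] U sz la unfolding small_def by auto
    show "size T < ?X" "size U < ?X" using U sz la by auto
    show "1 \<le> int i" "int i \<le> int (size T) + 1" using i l sz by auto
    show "int (nat N) \<le> W" using N iN by simp
  qed
  then show ?thesis using finish_ok[OF mid] N(1) e unfolding iN step_bound_def by simp
qed

lemma delete_step:
  assumes inv: "st_inv N a s" and N: "16 \<le> N" "N \<le> W" and l: "legal a (Delete i)"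
    and a': "a' = apply_update a (Delete i)" and r: "represents r s" and W: "10 * int (length a') + 40 \<le> W"
  shows "st_inv N a' (delete_update N (int i) s) \<and>
    computes W alg_code 24 [RI N, RI (int i), r] (enc_st (delete_update N (int i) s)) (step_bound N (length a'))"
proof -
  obtain T U par d est ages agee act where s: "s = St T U par d est ages agee act" by (cases s)
  obtain ts us m k c v q cost dn where d: "d = DP ts us m k c v q cost dn" by (cases d)
  have co: "core N a T U par ts m est ages agee" using inv unfolding s d by simp
  have t: "tree_inv T U" "keys T = a" "par = 1 \<or> par = 2" "excess (3 - par) (inorder T) \<le> ages"
    using co unfolding core_def by auto
  have sz: "size T = length a" using t(2) by auto
  have i: "1 \<le> int i" "int i \<le> int (size T)" using l sz by auto
  define p where "p = prefix_count 0 (int i - 1) T"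
  define U' where "U' = (if p < prefix_count 0 (int i) T then del p U else U)"
  note P = delete_spec[OF t(1) i U'_def[unfolded p_def]]
  have ka: "keys (del (int i - 1) T) = a'" using P(2) t(2) a' by simp
  have la: "length a = length a' + 1" using l a' by (auto simp: min_def)
  have "a = take (i - 1) a @ a ! (i - 1) # drop (Suc (i - 1)) a"
    using l by (intro id_take_nth_drop) auto
  then have "a = take (i - 1) a @ a ! (i - 1) # drop i a" using l by simp
  then have D: "dtm a' \<le> dtm a" "dtm a \<le> dtm a' + 1"
    using dtm_insert(1)[of "take (i - 1) a"  "drop i a" "a ! (i - 1)"]
      dtm_insert(2)[of "take (i - 1) a" "a ! (i - 1)" "drop i a"] a' by simp_all
  have mid: "st_mid N a' 0 (begin_update (St (del (int i - 1) T) U' par d est ages agee act))"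
    by (rule begin_ok[OF inv[unfolded s] N(1) P(1) ka]) (use P(3)[of par] P(4)[of "3 - par"] t(4) D la in auto)
  have e: "delete_update N (int i) s = finish_update N (St (del (int i - 1) T) U' par d est ages agee act)"
    unfolding s by (simp add: p_def U'_def Let_def)
  let ?X = "2 * length a' + 2"
  interpret bounded_machine W ?X "max_height ?X"
    by (rule bounded_machine_max_height) (use W in simp)
  note A = accuracy[OF inv[unfolded s] N(1)]
  have "dtm a \<le> length a" using dtm_lis[of a] by simp
  moreover have "10 * agee \<le> (N - 6) * agee" using N(1) A(4,5) by (intro mult_right_mono) auto
  ultimately have ag: "agee \<le> 3 * int (length a)" using A(1) by linarith
  have iN: "int (nat N) = N" using N(1) by simp
  have U: "int (size U) \<le> int (size T)"
    using mark_count_U[OF t(1)] mark_count_bounds(2)[of 0 "inorder T"] by simp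
  have run: "runnable ((work ^^ n) (begin_update (St (del (int i - 1) T) U' par d est ages agee act)))" for n
    by (rule st_mid_runnable[OF bounded_machine_axioms works_ok[OF mid] N(1)]) simp
  have "computes W alg_code 24 [RI (int (nat N)), RI (int i), r] (enc_st (delete_update (int (nat N)) (int i) s))
      (50000 * max_height ?X * (nat N + 1))"
  proof (rule delete_computes[OF s r t(3) _ _ _ _ i mark_count_U[OF t(1)] p_def U'_def run])
    show "\<bar>ages + 1\<bar> \<le> W" "\<bar>agee + 1\<bar> \<le> W" using A(4,5) ag la W by auto
    show "small T" "small U" using tree_invD(1,2)[OF t(1)] U sz la unfolding small_def by auto
    show "int (nat N) \<le> W" using N iN by simp
  qed
  then show ?thesis using finish_ok[OF mid] N(1) e unfolding iN step_bound_def by simp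
qed

text \<open>Cell 1 belongs to no record, as these start at address 2.\<close>

lemma rep_store_root: "rep s v r \<Longrightarrow> rep (s(1 := w)) v r"
proof (induction rule: rep.induct)
  case (RC h p vs)
  then show ?case by (intro rep.RC[where h = h]) auto
qed (auto intro: rep.intros)

lemma evals_snoc:
  "evals W P env s es vs s' t \<Longrightarrow> eval W P env s' e v s'' t' \<Longrightarrow> evals W P env s (es @ [e]) (vs @ [v]) s'' (t + t')"
proof (induction es arbitrary: s vs t)
  case Nil
  from Nil(1) have "vs = []" "s' = s" "t = 0" by (auto elim: evals.cases)
  then show ?case using eval_evals.Cons[OF Nil(2) eval_evals.Nil] by simp
next
  case (Cons e' es)
  from Cons.prems(1) obtain v1 s1 t1 vs1 t2 where *: "vs = v1 # vs1" "t = t1 + t2"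
    "eval W P env s e' v1 s1 t1" "evals W P env s1 es vs1 s' t2"
    by (cases rule: evals.cases) auto
  show ?case using eval_evals.Cons[OF *(3) Cons.IH[OF *(4) Cons.prems(2)]] * by (simp add: add.assoc)
qed

lemma main_eval:
  assumes P: "P = link e0 e1 alg_code" and c: "computes W alg_code f (RI N # args @ [r]) (enc_st st) t"
    and st: "st = St T U par d est ages agee act"
    and es: "evals W P cargs s es cargs s n" "list_all2 (rep s) cargs args"
    and r: "rep s (s 1) r" and h: "s 0 = IntV h" "0 \<le> h" "h + int t + 12 \<le> W"
    and b: "\<bar>N\<bar> \<le> W" "\<bar>est + agee\<bar> \<le> W"
  shows "\<exists>s' u h'. eval W P cargs s (main N (f + 3) es) (IntV (est + agee)) s' u \<and> u \<le> t + n + 20 \<and>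
    rep s' (s' 1) (enc_st st) \<and> s' 0 = IntV h' \<and> 0 \<le> h' \<and> h' \<le> h + int t"
proof -
  obtain t0 where t0: "t0 \<le> t" "reval W alg_code (RI N # args @ [r]) (alg_code ! f) (enc_st st) t0" "f < length alg_code"
    using c unfolding computes_def wpc_def wp_def by blast
  have sim: "simulates W P (RI N # args @ [r]) (alg_code ! f) (enc_st st) t0"
    unfolding P by (rule compile_correct(1)[OF order_refl t0(2)])
  have W: "12 \<le> W" using h by simp
  have ld: "eval W P cargs s (Load (Const 1)) (s 1) s (1 + 1)"
    by (rule eval_evals.Load[OF eval_evals.Const]) (use W in auto)
  have ev: "evals W P cargs s (Const N # es @ [Load (Const 1)]) (IntV N # cargs @ [s 1]) s (1 + (n + (1 + 1)))"
    by (rule eval_evals.Cons[OF eval_evals.Const evals_snoc[OF es(1) ld]]) (use b in auto)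
  have le: "list_all2 (rep s) (IntV N # cargs @ [s 1]) (RI N # args @ [r])"
    using es(2) r rep.RI by (simp add: list_all2_appendI)
  have room: "room W s t0" unfolding room_def using h t0(1) by simp
  obtain cv s1 u1 where 1: "eval W P (IntV N # cargs @ [s 1]) s (compile (alg_code ! f)) cv s1 u1" "u1 \<le> t0"
    "rep s1 cv (enc_st st)" "grows t0 s s1"
    by (rule simulatesE[OF sim le room order_refl])
  have call: "eval W P cargs s (Call (f + 3) (Const N # es @ [Load (Const 1)])) cv s1 (1 + (n + (1 + 1)) + u1 + 1)"
    by (rule eval_evals.Call[OF ev]) (use 1(1) t0(3) in \<open>auto simp: P link_def\<close>)
  obtain h1 where h1: "s1 0 = IntV h1" "h \<le> h1" "h1 \<le> h + int t0" using 1(4) h(1) by (auto simp: grows_def)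
  define s2 where "s2 = s1(1 := cv)"
  have r2: "rep s2 cv (enc_st st)" unfolding s2_def by (rule rep_store_root[OF 1(3)])
  have h2: "s2 0 = IntV h1" "s2 1 = cv" by (simp_all add: s2_def h1)
  have enc: "enc_st st = RC [enc T, enc U, RI par, enc_dp d, RI est, RI ages, RI agee, RI act, RI 0]"
    unfolding st by simp
  obtain p where p: "cv = IntV p" "2 \<le> p" "p + 9 \<le> h1 + 2"
    "\<And>i. i < 9 \<Longrightarrow> rep s2 (s2 (p + int i)) ([enc T, enc U, RI par, enc_dp d, RI est, RI ages, RI agee, RI act, RI 0] ! i)"
    using r2[unfolded enc] h2(1) by (elim rep_RCE) auto
  have f4: "s2 (p + 4) = IntV est" and f6: "s2 (p + 6) = IntV agee"
    using p(4)[of 4] p(4)[of 6] by (auto elim!: rep_RIE)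
  have pW: "p + 6 \<le> W" using p(3) h1 h t0(1) by linarith
  let ?env = "cv # cv # cargs"
  have ld': "eval W P ?env s2 (Load (Plus (Var 0) (Const k))) (s2 (p + k)) s2 (1 + 1 + 1 + 1)" if "0 \<le> k" "k \<le> 6" for k
  proof -
    have v: "eval W P ?env s2 (Var 0) (IntV p) s2 1" using eval_evals.Var[of 0 ?env] p(1) by simp
    show ?thesis
      by (rule eval_evals.Load[OF eval_evals.Plus[OF v eval_evals.Const]]) (use that pW p(2) W in auto)
  qed
  have pl: "eval W P ?env s2 (Plus (Load (Plus (Var 0) (Const 4))) (Load (Plus (Var 0) (Const 6)))) (IntV (est + agee)) s2
      (1 + 1 + 1 + 1 + (1 + 1 + 1 + 1) + 1)"
    by (rule eval_evals.Plus[OF ld'[of 4, unfolded f4] ld'[of 6, unfolded f6]]) (use b in auto)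
  have v0: "eval W P (cv # cargs) s1 (Var 0) cv s1 1" using eval_evals.Var[of 0 "cv # cargs"] by simp
  have sto: "eval W P (cv # cargs) s1 (Store (Const 1) (Var 0)) cv s2 (1 + 1 + 1)"
    unfolding s2_def by (rule eval_evals.Store[OF eval_evals.Const v0]) (use W in auto)
  have "eval W P cargs s (main N (f + 3) es) (IntV (est + agee)) s2
      (1 + (n + (1 + 1)) + u1 + 1 + (1 + 1 + 1 + (1 + 1 + 1 + 1 + (1 + 1 + 1 + 1) + 1) + 1) + 1)"
    unfolding main_def by (rule eval_evals.Bind[OF call eval_evals.Bind[OF sto pl]])
  moreover have "rep s2 (s2 1) (enc_st st)" using r2 h2 by simp
  ultimately show ?thesis using h2(1) h1 h(2) t0(1) 1(2)
    by (intro exI[of _ s2] exI[of _ "1 + (n + (1 + 1)) + u1 + 1 + (1 + 1 + 1 + (1 + 1 + 1 + 1 + (1 + 1 + 1 + 1) + 1) + 1) + 1"] exI[of _ h1]) auto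
qed

text \<open>A crude bound, used only to estimate the memory taken by the whole run, for which any
  polynomial will do.\<close>

lemma max_height_linear: "max_height n \<le> 2 * n + 3"
proof -
  have "real (n + 1) \<le> 2 ^ n" by (induction n) auto
  then have "log 2 (real (n + 1)) \<le> real n" by (intro log2_of_power_le) (simp_all flip: of_nat_Suc)
  then have "\<lfloor>2 * log 2 (real n + 1)\<rfloor> \<le> 2 * int n" by (simp add: floor_le_iff add.commute)
  then show ?thesis unfolding max_height_def by linarith
qed

lemma legal_length:
  "legal a u \<Longrightarrow> length (apply_update a u) \<le> length a + 1 \<and> length a \<le> length (apply_update a u) + 1"
  by (cases u) (auto simp: min_def)

lemma update_eval:
  assumes inv: "st_inv N a s" and N: "16 \<le> N" "N \<le> W" and l: "legal a u" and r: "represents r s"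
    and a': "a' = apply_update a u" and W: "10 * int (length a') + 40 \<le> W"
    and m: "rep \<sigma> (\<sigma> 1) r" "\<sigma> 0 = IntV h" "0 \<le> h" "h + int (step_bound N (length a')) + 12 \<le> W"
  obtains f args s' est agee \<sigma>' t h' where "invoke u = (f, args)" "f < length (dtm_program N)"
    "eval W (dtm_program N) args \<sigma> (dtm_program N ! f) (IntV (est + agee)) \<sigma>' t" "t \<le> step_bound N (length a') + 30"
    "st_inv N a' s'" "rep \<sigma>' (\<sigma>' 1) (enc_st s')" "\<sigma>' 0 = IntV h'" "0 \<le> h'" "h' \<le> h + int (step_bound N (length a'))"
    "int (dtm a') \<le> est + agee" "est + agee \<le> int (dtm a') + 2 * agee" "(N - 6) * agee \<le> 30 * int (dtm a')"
proof -
  define s' where "s' = (case u of Insert i x \<Rightarrow> insert_update N (int i) x s | Delete i \<Rightarrow> delete_update N (int i) s)"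
  have inv': "st_inv N a' s'"
    using insert_step[OF inv N _ _ r W] delete_step[OF inv N _ _ r W] l a' unfolding s'_def by (cases u) auto
  obtain T U par d est ages agee act where s': "s' = St T U par d est ages agee act" by (cases s')
  note A = accuracy[OF inv'[unfolded s'] N(1)]
  have dl: "dtm a' \<le> length a'" using dtm_lis[of a'] by simp
  have "10 * agee \<le> (N - 6) * agee" using N(1) A(4,5) by (intro mult_right_mono) auto
  then have ag: "agee \<le> 3 * int (length a')" using A(1) dl by linarith
  have b: "\<bar>N\<bar> \<le> W" "\<bar>est + agee\<bar> \<le> W" using N A(2,3) ag dl W by linarith+
  show thesis
  proof (cases u)
    case (Insert i x)
    have c: "computes W alg_code 23 (RI N # [RI (int i), RN x] @ [r]) (enc_st s') (step_bound N (length a'))"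
      using insert_step[OF inv N l[unfolded Insert] a'[unfolded Insert] r W] unfolding s'_def Insert by simp
    have e: "evals W (dtm_program N) [IntV (int i), NumV x] \<sigma> [Var 0, Var 1] [IntV (int i), NumV x] \<sigma> (1 + (1 + 0))"
      using eval_evals.Cons[OF eval_evals.Var[of 0] eval_evals.Cons[OF eval_evals.Var[of 1] eval_evals.Nil]]
      by (metis (no_types, lifting) One_nat_def length_Cons nth_Cons_0 nth_Cons_Suc zero_less_Suc Suc_less_eq list.size(3) lessI)
    have l2: "list_all2 (rep \<sigma>) [IntV (int i), NumV x] [RI (int i), RN x]" by (simp add: rep.RI rep.RN)
    obtain \<sigma>' t h' where "eval W (dtm_program N) [IntV (int i), NumV x] \<sigma> (main N (23 + 3) [Var 0, Var 1]) (IntV (est + agee)) \<sigma>' t"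
      "t \<le> step_bound N (length a') + (1 + (1 + 0)) + 20" "rep \<sigma>' (\<sigma>' 1) (enc_st s')" "\<sigma>' 0 = IntV h'" "0 \<le> h'"
      "h' \<le> h + int (step_bound N (length a'))"
      using main_eval[OF dtm_program_def c s' e l2 m b] by blast
    then show thesis
      using that[of 0 "[IntV (int i), NumV x]" est agee \<sigma>' t s' h'] inv' A(1-3) Insert
      by (simp add: dtm_program_def link_def)
  next
    case (Delete i)
    have c: "computes W alg_code 24 (RI N # [RI (int i)] @ [r]) (enc_st s') (step_bound N (length a'))"
      using delete_step[OF inv N l[unfolded Delete] a'[unfolded Delete] r W] unfolding s'_def Delete by simp
    have e: "evals W (dtm_program N) [IntV (int i)] \<sigma> [Var 0] [IntV (int i)] \<sigma> (1 + 0)"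
      using eval_evals.Cons[OF eval_evals.Var[of 0] eval_evals.Nil]
      by (metis (no_types, lifting) length_Cons nth_Cons_0 zero_less_Suc)
    have l2: "list_all2 (rep \<sigma>) [IntV (int i)] [RI (int i)]" by (simp add: rep.RI)
    obtain \<sigma>' t h' where "eval W (dtm_program N) [IntV (int i)] \<sigma> (main N (24 + 3) [Var 0]) (IntV (est + agee)) \<sigma>' t"
      "t \<le> step_bound N (length a') + (1 + 0) + 20" "rep \<sigma>' (\<sigma>' 1) (enc_st s')" "\<sigma>' 0 = IntV h'" "0 \<le> h'"
      "h' \<le> h + int (step_bound N (length a'))"
      using main_eval[OF dtm_program_def c s' e l2 m b] by blast
    then show thesis
      using that[of 1 "[IntV (int i)]" est agee \<sigma>' t s' h'] inv' A(1-3) Delete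
      by (simp add: dtm_program_def link_def)
  qed
qed

lemma step_bound_mono: "n \<le> n' \<Longrightarrow> step_bound N n \<le> step_bound N n'"
proof -
  assume "n \<le> n'"
  then have "max_height (2 * n + 2) \<le> max_height (2 * n' + 2)"
    unfolding max_height_def by (intro add_right_mono nat_mono floor_mono mult_left_mono) simp_all
  then show ?thesis unfolding step_bound_def by (intro mult_le_mono) simp_all
qed

text \<open>The array never exceeds n elements. The last premise reserves memory for all remaining
  updates, as the step bound of an update also bounds the cells that it allocates.\<close>

lemma run_ok:
  assumes N: "16 \<le> N" "N \<le> W" and W: "10 * int n + 40 \<le> W" and eps: "60 \<le> \<epsilon> * real_of_int (N - 6)" "0 < \<epsilon>"
  shows "st_inv N a s \<Longrightarrow> represents r s \<Longrightarrow> rep \<sigma> (\<sigma> 1) r \<Longrightarrow> \<sigma> 0 = IntV h \<Longrightarrow> 0 \<le> h \<Longrightarrow>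
    legal_updates a us \<Longrightarrow> length a + length us \<le> n \<Longrightarrow>
    h + int (length us) * int (step_bound N n) + 12 \<le> W \<Longrightarrow>
    \<exists>rs. run W (dtm_program N) \<sigma> us rs \<and> length rs = length us \<and> (\<forall>j<length us.
      let a' = foldl apply_update a (take (Suc j) us); (v, t) = rs ! j in
        real (dtm a') \<le> real_of_int v \<and> real_of_int v \<le> (1 + \<epsilon>) * real (dtm a') \<and>
        real t \<le> real (step_bound N (length a') + 30))"
proof (induction us arbitrary: a s r \<sigma> h)
  case Nil
  then show ?case by (auto intro: run.Done)
next
  case (Cons u us)
  let ?a = "apply_update a u"
  have l: "legal a u" "legal_updates ?a us" using Cons.prems by auto
  have len: "length ?a + length us \<le> n" using legal_length[OF l(1)] Cons.prems(7) by simp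
  then have sb: "step_bound N (length ?a) \<le> step_bound N n" by (intro step_bound_mono) simp
  have e: "int (length (u # us)) * int (step_bound N n) = int (step_bound N n) + int (length us) * int (step_bound N n)"
    by (simp add: algebra_simps)
  have nn: "0 \<le> int (length us) * int (step_bound N n)" by simp
  have room: "h + int (step_bound N (length ?a)) + 12 \<le> W" using Cons.prems(8) sb nn unfolding e by linarith
  have Wa: "10 * int (length ?a) + 40 \<le> W" using W len by linarith
  obtain f args s' est agee \<sigma>' t h' where 1: "invoke u = (f, args)" "f < length (dtm_program N)"
    "eval W (dtm_program N) args \<sigma> (dtm_program N ! f) (IntV (est + agee)) \<sigma>' t" "t \<le> step_bound N (length ?a) + 30"
    "st_inv N ?a s'" "rep \<sigma>' (\<sigma>' 1) (enc_st s')" "\<sigma>' 0 = IntV h'" "0 \<le> h'" "h' \<le> h + int (step_bound N (length ?a))"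
    "int (dtm ?a) \<le> est + agee" "est + agee \<le> int (dtm ?a) + 2 * agee" "(N - 6) * agee \<le> 30 * int (dtm ?a)"
    by (rule update_eval[OF Cons.prems(1) N l(1) Cons.prems(2) refl Wa Cons.prems(3-5) room])
  have "h' + int (length us) * int (step_bound N n) + 12 \<le> W" using 1(9) sb Cons.prems(8) unfolding e by linarith
  from Cons.IH[OF 1(5) _ 1(6-8) l(2) len this] obtain rs where
    rs: "run W (dtm_program N) \<sigma>' us rs" "length rs = length us" "\<forall>j<length us.
      let a' = foldl apply_update ?a (take (Suc j) us); (v, t) = rs ! j in
        real (dtm a') \<le> real_of_int v \<and> real_of_int v \<le> (1 + \<epsilon>) * real (dtm a') \<and>
        real t \<le> real (step_bound N (length a') + 30)"
    by (auto simp: represents_def)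
  have run: "run W (dtm_program N) \<sigma> (u # us) ((est + agee, t) # rs)"
    by (rule run.Step[OF 1(1-3) rs(1)])
  have acc: "real_of_int (est + agee) \<le> (1 + \<epsilon>) * real (dtm ?a)"
  proof -
    have M: "0 < real_of_int (N - 6)" using N(1) by simp
    have "real_of_int ((N - 6) * agee) \<le> real_of_int (30 * int (dtm ?a))" using 1(12) by (simp only: of_int_le_iff)
    then have "real_of_int (N - 6) * real_of_int agee \<le> 30 * real (dtm ?a)"
      by (simp only: of_int_mult of_int_of_nat_eq of_int_numeral)
    then have "real_of_int (N - 6) * (2 * real_of_int agee) \<le> 60 * real (dtm ?a)"
      unfolding mult.left_commute[of _ 2] by linarith
    also have "\<dots> \<le> \<epsilon> * real_of_int (N - 6) * real (dtm ?a)" using eps(1) by (intro mult_right_mono) auto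
    finally have "real_of_int (N - 6) * (2 * real_of_int agee) \<le> real_of_int (N - 6) * (\<epsilon> * real (dtm ?a))"
      by (simp add: mult_ac)
    then have "2 * real_of_int agee \<le> \<epsilon> * real (dtm ?a)" using M by (simp only: mult_le_cancel_left_pos)
    moreover have "real_of_int (est + agee) \<le> real_of_int (int (dtm ?a) + 2 * agee)" using 1(11) by (simp only: of_int_le_iff)
    ultimately show ?thesis by (simp add: algebra_simps)
  qed
  have low: "real (dtm ?a) \<le> real_of_int (est + agee)" using 1(10) by linarith
  have time: "real t \<le> real (step_bound N (length ?a) + 30)" using 1(4) by linarith
  show ?case
  proof (intro exI[of _ "(est + agee, t) # rs"] conjI allI impI run)
    show "length ((est + agee, t) # rs) = length (u # us)" using rs(2) by simp
    fix j assume "j < length (u # us)"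
    then show "let a' = foldl apply_update a (take (Suc j) (u # us)); (v, t) = ((est + agee, t) # rs) ! j in
        real (dtm a') \<le> real_of_int v \<and> real_of_int v \<le> (1 + \<epsilon>) * real (dtm a') \<and>
        real t \<le> real (step_bound N (length a') + 30)"
      using rs(3) acc low time by (cases j) (auto simp: Let_def)
  qed
qed

lemma st_inv_initial: "st_inv N [] initial_st"
proof -
  have d: "dtm [] = 0" using dtm_lis[of "[]"] by simp
  have "dp_inv Leaf Leaf 1 0 0 Leaf Leaf 0 1" unfolding dp_inv_def using d by simp
  moreover have "core N [] Leaf Leaf 1 Leaf 1 0 0 0" unfolding core_def tree_inv_def excess_def using d by simp
  ultimately show ?thesis unfolding initial_st_def by (simp add: d)
qed

text \<open>For n \<ge> 3 one has 2 n + 3 \<le> n ^ 3 and ln 2 \<ge> 1 / 2, so twice the binary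
  logarithm is at most 12 ln n, and the height bound at most 15 ln n. The square enters only at the
  end, through ln n \<ge> 1.\<close>

lemma step_bound_growth: "(\<lambda>n. real (step_bound N n + 30)) \<in> O(\<lambda>n. (ln (real n)) ^ 2)"
proof (rule bigoI)
  let ?C = "50000 * 15 * real (nat N + 1) + 30"
  show "\<forall>\<^sub>F n in at_top. norm (real (step_bound N n + 30)) \<le> ?C * norm ((ln (real n)) ^ 2)"
  proof (rule eventually_at_top_linorderI[of 3])
    fix n :: nat assume n: "3 \<le> n"
    have "exp 1 \<le> real n" using exp_le n by linarith
    then have ln1: "1 \<le> ln (real n)" using n by (subst ln_ge_iff) auto
    have "2 * real n + 3 \<le> real n ^ 3"
    proof -
      have "9 * real n \<le> real n ^ 2 * real n" using n power_mono[of 3 "real n" 2] by (intro mult_right_mono) auto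
      also have "\<dots> = real n ^ 3" by (simp add: power3_eq_cube power2_eq_square)
      finally show ?thesis using n by simp
    qed
    then have "ln (2 * real n + 3) \<le> ln (real n ^ 3)" using n by (subst ln_le_cancel_iff) auto
    also have "\<dots> = 3 * ln (real n)" using n by (simp add: ln_realpow)
    finally have "log 2 (2 * real n + 3) \<le> 3 * ln (real n) / ln 2" by (simp add: log_def divide_right_mono)
    also have "\<dots> \<le> 3 * ln (real n) / (1 / 2)"
    proof -
      have "1 / 2 \<le> ln (2 :: real)" using exp_half_le2 by (subst ln_ge_iff) auto
      then show ?thesis using ln1 by (intro divide_left_mono) auto
    qed
    finally have log: "2 * log 2 (2 * real n + 3) \<le> 12 * ln (real n)" by simp
    have "real (max_height (2 * n + 2)) \<le> 2 * log 2 (2 * real n + 3) + 3"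
    proof -
      have "0 \<le> log 2 (2 * real n + 3)" by (subst zero_le_log_cancel_iff) auto
      then have "0 \<le> \<lfloor>2 * log 2 (2 * real n + 3)\<rfloor>" by simp
      then have "real (nat \<lfloor>2 * log 2 (2 * real n + 3)\<rfloor>) = real_of_int \<lfloor>2 * log 2 (2 * real n + 3)\<rfloor>"
        by (rule of_nat_nat)
      moreover have "real_of_int \<lfloor>2 * log 2 (2 * real n + 3)\<rfloor> \<le> 2 * log 2 (2 * real n + 3)" by (rule of_int_floor_le)
      moreover have e: "real (2 * n + 2) + 1 = 2 * real n + 3" by simp
      ultimately show ?thesis unfolding max_height_def e unfolding of_nat_add of_nat_numeral by linarith
    qed
    then have mh: "real (max_height (2 * n + 2)) \<le> 15 * ln (real n)" using log ln1 by linarith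
    have "real (step_bound N n + 30) = 50000 * real (nat N + 1) * real (max_height (2 * n + 2)) + 30"
      unfolding step_bound_def of_nat_add of_nat_mult of_nat_numeral by (simp only: mult_ac)
    also have "\<dots> \<le> 50000 * real (nat N + 1) * (15 * ln (real n)) + 30 * ln (real n)"
      using mh ln1 by (intro add_mono mult_left_mono) auto
    also have "\<dots> = ?C * ln (real n)" by (simp add: algebra_simps)
    also have "\<dots> \<le> ?C * (ln (real n)) ^ 2"
      using ln1 by (intro mult_left_mono) (auto simp: power2_eq_square)
    finally show "norm (real (step_bound N n + 30)) \<le> ?C * norm ((ln (real n)) ^ 2)" by simp
  qed
qed

theorem theorem5:
  fixes \<epsilon> :: real
  assumes "\<epsilon> > 0"
  shows "\<exists>P c T. dynamic_dtm_algorithm P c (1 + \<epsilon>) T \<and> T \<in> O(\<lambda>n. (ln (real n)) ^ 2)"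
proof -
  \<comment> \<open>The report exceeds the distance by at most 2 * agee, and (N - 6) * agee is at
    most 30 times the distance; 60 is the product of the two factors. The minimum 16 is what the
    analysis of the rounds needs.\<close>
  define N where "N = max 16 (6 + \<lceil>60 / \<epsilon>\<rceil>)"
  have N: "16 \<le> N" by (simp add: N_def)
  have "60 / \<epsilon> \<le> real_of_int (N - 6)" unfolding N_def by linarith
  then have eps: "60 \<le> \<epsilon> * real_of_int (N - 6)" using assms by (simp add: field_simps)
  \<comment> \<open>All updates together allocate at most (n + 2) * (n + 2) * Q cells, with 500000 =
    50000 * 10 from the linear bound on the height and 60 for the additive constants. As Q < 2 ^ Q,
    the exponent 2 + Q makes the words large enough even for few updates, although Q depends on
    \<epsilon>.\<close>
  define Q where "Q = 500000 * (nat N + 1) + 60"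
  have "dynamic_dtm_algorithm (dtm_program N) (2 + Q) (1 + \<epsilon>) (\<lambda>n. real (step_bound N n + 30))"
    unfolding dynamic_dtm_algorithm_def
  proof (intro allI impI)
    fix us :: "update list" and W :: int
    assume us: "legal_updates [] us" and W: "(int (length us) + 2) ^ (2 + Q) \<le> W"
    define n where "n = length us"
    have "Q < 2 ^ Q" by (rule less_exp)
    also have "\<dots> \<le> (n + 2) ^ Q" by (rule power_mono) simp_all
    finally have Q1: "Q \<le> (n + 2) ^ Q" by simp
    have "(n + 2) * (n + 2) * Q \<le> (n + 2) * (n + 2) * (n + 2) ^ Q" using Q1 by (rule mult_le_mono2)
    also have "\<dots> = (n + 2) ^ (2 + Q)" by (simp only: power_add power2_eq_square)
    finally have "int ((n + 2) * (n + 2) * Q) \<le> int ((n + 2) ^ (2 + Q))" by (simp only: of_nat_le_iff)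
    also have "\<dots> = (int (length us) + 2) ^ (2 + Q)"
      by (simp only: n_def of_nat_power of_nat_add of_nat_numeral)
    finally have WQ: "int ((n + 2) * (n + 2) * Q) \<le> W" using W by linarith
    have sb: "step_bound N n \<le> 500000 * (nat N + 1) * (n + 2)"
    proof -
      have "max_height (2 * n + 2) \<le> 10 * (n + 2)" using max_height_linear[of "2 * n + 2"] by simp
      then have "50000 * max_height (2 * n + 2) * (nat N + 1) \<le> 50000 * (10 * (n + 2)) * (nat N + 1)"
        by (intro mult_le_mono) auto
      then show ?thesis unfolding step_bound_def by (simp add: algebra_simps)
    qed
    have "n * step_bound N n + 60 * (n + 2) \<le> (n + 2) * (n + 2) * Q"
    proof -
      have "n * step_bound N n \<le> (n + 2) * (500000 * (nat N + 1) * (n + 2))" using sb by (intro mult_le_mono) auto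
      moreover have "60 * (n + 2) \<le> 60 * ((n + 2) * (n + 2))" by simp
      moreover have "(n + 2) * (500000 * (nat N + 1) * (n + 2)) + 60 * ((n + 2) * (n + 2)) = (n + 2) * (n + 2) * Q"
        unfolding Q_def by (simp add: algebra_simps)
      ultimately show ?thesis by linarith
    qed
    then have "int (n * step_bound N n + 60 * (n + 2)) \<le> W" using WQ by linarith
    then have room: "int n * int (step_bound N n) + 60 * (int n + 2) \<le> W" by simp
    have nn: "0 \<le> int n * int (step_bound N n)" by simp
    have "10 * int n + 40 \<le> 60 * (int n + 2)" by simp
    then have W2: "10 * int n + 40 \<le> W" using room nn by linarith
    have "1 * Q \<le> (n + 2) * (n + 2) * Q" by (intro mult_le_mono1) simp
    then have "int Q \<le> W" using WQ by linarith
    moreover have "N \<le> int Q" using N unfolding Q_def by simp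
    ultimately have NW: "N \<le> W" by linarith
    have "\<exists>rs. run W (dtm_program N) initial_memory us rs \<and> length rs = length us \<and> (\<forall>j<length us.
      let a' = foldl apply_update [] (take (Suc j) us); (v, t) = rs ! j in
        real (dtm a') \<le> real_of_int v \<and> real_of_int v \<le> (1 + \<epsilon>) * real (dtm a') \<and>
        real t \<le> real (step_bound N (length a') + 30))"
    proof (rule run_ok[OF N NW W2 eps assms st_inv_initial])
      show "represents (RI 0) initial_st" by (simp add: represents_def)
      show "rep initial_memory (initial_memory 1) (RI 0)" by (simp add: initial_memory_def rep.RI)
      show "initial_memory 0 = IntV 0" by (simp add: initial_memory_def)
      show "0 + int (length us) * int (step_bound N n) + 12 \<le> W" using room by (simp add: n_def)
    qed (use us in \<open>simp_all add: n_def\<close>)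
    then show "\<exists>rs. run W (dtm_program N) initial_memory us rs \<and> (\<forall>j<length us.
      let a = array_after (take (Suc j) us); (v, t) = rs ! j in
        real (dtm a) \<le> real_of_int v \<and> real_of_int v \<le> (1 + \<epsilon>) * real (dtm a) \<and>
        real t \<le> real (step_bound N (length a) + 30))"
      unfolding array_after_def by blast
  qed
  then show ?thesis using step_bound_growth by blast
qed

end
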